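(* Let $q\ge 1$ and $n\ge 5$. For $k=1,\dots,q$ define $\varphi_k:A_n^q\to A_n^q$ by $(\sigma_1,\dots,\sigma_{k-1},\sigma_k,\sigma_{k+1},\dots,\sigma_q)^{\varphi_k}=(\sigma_1,\dots,\sigma_{k-1},\sigma_k^{-1},\sigma_{k+1},\dots,\sigma_q)$. Then $$\mathrm{Aut}(A\Gamma_n^q)=(R(A_n^q)\rtimes(\mathrm{Inn}(S_n)\wr S_q))\rtimes Z_2^q,$$ where $\mathrm{Inn}(S_n)\cong S_n$ is the inner automorphism group of $S_n$, $Z_2^q=\langle\varphi_1\rangle\times\langle\varphi_2\rangle\times\cdots\times\langle\varphi_q\rangle$, and $\mathrm{Inn}(S_n)\wr S_q$ is the wreath product.
   Context: Let $X=\{1,\dots,n\}$; permutations act on the right, $i^\sigma$ denoting the image of $i$ under $\sigma$. $S_n$ is the symmetric group and $A_n$ the alternating group on $X$. Let $\mathcal{E}_n=\{\sigma\in A_n: i^\sigma\neq i \text{ for all } i\in X\}$. The even derangement graph $A\Gamma_n$ is the Cayley graph $\Gamma(A_n,\mathcal{E}_n)$: vertex set $A_n$, edges $\{g,sg\}$ for $g\in A_n$, $s\in\mathcal{E}_n$. $A\Gamma_n^q$ is the tensor product of $q$ copies of $A\Gamma_n$, i.e. the Cayley graph $\Gamma(A_n^q,\mathcal{E}_n^q)$: vertex set $A_n^q$ (direct product), with $(\sigma_1,\dots,\sigma_q)$ adjacent to $(\tau_1,\dots,\tau_q)$ iff $i^{\sigma_k}\neq i^{\tau_k}$ for all $i\in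 X$ and all $k$. All groups are regarded as permutation groups on the vertex set $A_n^q$: $R(A_n^q)$ is the right regular representation ($x\mapsto xg$, $g\in A_n^q$); $\mathrm{Inn}(S_n)\wr S_q$ acts as group automorphisms of $A_n^q$, with the $k$-th copy of $\mathrm{Inn}(S_n)$ conjugating the $k$-th coordinate by an element of $S_n$ and $S_q$ permuting coordinates.
   Formalization: For q ≥ 2 the left factor R(A_n^q)⋊(Inn(S_n) wr S_q) is not normal in Aut, so the outer ⋊ Z_2^q is proved as an exact factorization (product equals Aut, trivial intersection), as a true semidirect product for q = 1, and with R·Inn(S_n)^q normalized by Z_2^q for all q. *)

theory Defs
  imports
    "HOL-Algebra.Algebra"
begin

subsection \<open>Internal products of subgroups\<close>

definition internal_semidirect ::
  "('a, 'b) monoid_scheme \<Rightarrow> 'a set \<Rightarrow> 'a set \<Rightarrow> 'a set \<Rightarrow> bool" where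
  "internal_semidirect G N H K \<longleftrightarrow>
     subgroup K G \<and> N \<lhd> (G\<lparr>carrier := K\<rparr>) \<and> subgroup H (G\<lparr>carrier := K\<rparr>) \<and>
     N \<inter> H = {\<one>\<^bsub>G\<^esub>} \<and> N <#>\<^bsub>G\<^esub> H = K"

definition internal_factorization ::
  "('a, 'b) monoid_scheme \<Rightarrow> 'a set \<Rightarrow> 'a set \<Rightarrow> 'a set \<Rightarrow> bool" where
  "internal_factorization G M H K \<longleftrightarrow>
     subgroup K G \<and> subgroup M (G\<lparr>carrier := K\<rparr>) \<and> subgroup H (G\<lparr>carrier := K\<rparr>) \<and>
     M \<inter> H = {\<one>\<^bsub>G\<^esub>} \<and> M <#>\<^bsub>G\<^esub> H = K"

definition internal_direct_product ::
  "('a, 'b) monoid_scheme \<Rightarrow> 'i set \<Rightarrow> ('i \<Rightarrow> 'a set) \<Rightarrow> 'a set \<Rightarrow> bool" where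
  "internal_direct_product G I H K \<longleftrightarrow>
     (\<forall>i\<in>I. subgroup (H i) G) \<and>
     (\<forall>i\<in>I. \<forall>j\<in>I. i \<noteq> j \<longrightarrow> (\<forall>x\<in>H i. \<forall>y\<in>H j. x \<otimes>\<^bsub>G\<^esub> y = y \<otimes>\<^bsub>G\<^esub> x)) \<and>
     (\<forall>i\<in>I. H i \<inter> generate G (\<Union>j\<in>I - {i}. H j) = {\<one>\<^bsub>G\<^esub>}) \<and>
     K = generate G (\<Union>i\<in>I. H i)"


subsection \<open>Cayley graphs and graph automorphisms\<close>

definition cayley_edges :: "('a, 'b) monoid_scheme \<Rightarrow> 'a set \<Rightarrow> 'a set set" where
  "cayley_edges G S = {{g, s \<otimes>\<^bsub>G\<^esub> g} | g s. g \<in> carrier G \<and> s \<in> S}"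

definition graph_aut :: "'a set \<Rightarrow> 'a set set \<Rightarrow> ('a \<Rightarrow> 'a) set" where
  "graph_aut V E = {f \<in> Bij V. \<forall>u\<in>V. \<forall>v\<in>V. {f u, f v} \<in> E \<longleftrightarrow> {u, v} \<in> E}"


subsection \<open>The even derangement graph and its tensor powers\<close>

text \<open>
  The library multiplies permutations by \<open>(\<circ>)\<close>, i.e. permutations act on the left, whereas the
  source lets them act on the right. The two versions of \<open>A\<^sub>n\<close> are identified by
  \<open>\<sigma> \<mapsto> \<sigma>\<^sup>-\<^sup>1\<close>, which preserves the set of even derangements; hence the groups and
  the graph below are the source's, transported along this isomorphism.
\<close>

definition even_derangements :: "nat \<Rightarrow> (nat \<Rightarrow> nat) set" where
  "even_derangements n = {\<sigma> \<in> carrier (alt_group n). \<forall>i\<in>{1..n}. \<sigma> i \<noteq> i}"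

definition alt_power :: "nat \<Rightarrow> nat \<Rightarrow> (nat \<Rightarrow> nat \<Rightarrow> nat) monoid" where
  "alt_power n q = product_group {1..q} (\<lambda>_. alt_group n)"

definition even_derangement_edges :: "nat \<Rightarrow> nat \<Rightarrow> (nat \<Rightarrow> nat \<Rightarrow> nat) set set" where
  "even_derangement_edges n q =
     cayley_edges (alt_power n q) (\<Pi>\<^sub>E k\<in>{1..q}. even_derangements n)"

lemma mem_even_derangement_edges_iff:
  assumes "\<sigma> \<in> carrier (alt_power n q)" and "\<tau> \<in> carrier (alt_power n q)"
  shows "{\<sigma>, \<tau>} \<in> even_derangement_edges n q \<longleftrightarrow> (\<forall>k\<in>{1..q}. \<forall>i\<in>{1..n}. \<sigma> k i \<noteq> \<tau> k i)"
proof -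
  interpret A: group "alt_group n" by (rule alt_group_is_group)
  let ?D = "\<lambda>\<sigma> \<tau>. \<forall>k\<in>{1..q}. \<forall>i\<in>{1..n}. \<sigma> k i \<noteq> (\<tau> k i :: nat)"
  have fwd: "?D g (s \<otimes>\<^bsub>alt_power n q\<^esub> g)"
    if g: "g \<in> carrier (alt_power n q)" and s: "s \<in> (\<Pi>\<^sub>E k\<in>{1..q}. even_derangements n)" for g s
  proof (intro ballI)
    fix k i assume k: "k \<in> {1..q}" and i: "i \<in> {1..n}"
    have "g k permutes {1..n}"
      using g k by (auto simp: alt_power_def PiE_iff alt_group_carrier)
    hence "g k i \<in> {1..n}" using i permutes_in_image by metis
    moreover have "s k \<in> even_derangements n" using s k by (auto simp: PiE_iff)
    ultimately have "s k (g k i) \<noteq> g k i"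
      by (simp add: even_derangements_def)
    moreover have "(s \<otimes>\<^bsub>alt_power n q\<^esub> g) k i = s k (g k i)"
      using k by (simp add: alt_power_def alt_group_mult)
    ultimately show "g k i \<noteq> (s \<otimes>\<^bsub>alt_power n q\<^esub> g) k i" by metis
  qed
  have bwd: "\<exists>s \<in> (\<Pi>\<^sub>E k\<in>{1..q}. even_derangements n). \<tau> = s \<otimes>\<^bsub>alt_power n q\<^esub> \<sigma>" if D: "?D \<sigma> \<tau>"
  proof
    have m: "\<sigma> k \<in> carrier (alt_group n)" "\<tau> k \<in> carrier (alt_group n)" if "k \<in> {1..q}" for k
      using that assms by (auto simp: alt_power_def PiE_iff)
    let ?s = "\<lambda>k\<in>{1..q}. \<tau> k \<otimes>\<^bsub>alt_group n\<^esub> inv\<^bsub>alt_group n\<^esub> (\<sigma> k)"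
    show "?s \<in> (\<Pi>\<^sub>E k\<in>{1..q}. even_derangements n)"
    proof (rule restrict_PiE_iff[THEN iffD2], rule ballI)
      fix k assume k: "k \<in> {1..q}"
      have p: "\<sigma> k permutes {1..n}" using m(1)[OF k] by (simp add: alt_group_carrier)
      have "\<tau> k (inv' (\<sigma> k) i) \<noteq> i" if i: "i \<in> {1..n}" for i
      proof -
        have "inv' (\<sigma> k) i \<in> {1..n}" using i p permutes_in_image permutes_inv by metis
        thus ?thesis using D k permutes_inverses(1)[OF p] by metis
      qed
      moreover have "\<tau> k \<otimes>\<^bsub>alt_group n\<^esub> inv\<^bsub>alt_group n\<^esub> (\<sigma> k) \<in> carrier (alt_group n)"
        using m[OF k] by simp
      ultimately show "\<tau> k \<otimes>\<^bsub>alt_group n\<^esub> inv\<^bsub>alt_group n\<^esub> (\<sigma> k) \<in> even_derangements n"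
        by (simp add: even_derangements_def alt_group_mult alt_group_inv_equality[OF m(1)[OF k]])
    qed
    show "\<tau> = ?s \<otimes>\<^bsub>alt_power n q\<^esub> \<sigma>"
    proof
      fix k show "\<tau> k = (?s \<otimes>\<^bsub>alt_power n q\<^esub> \<sigma>) k"
        using m assms(2) by (cases "k \<in> {1..q}") (auto simp: alt_power_def A.m_assoc PiE_iff extensional_def)
    qed
  qed
  have sym: "?D a b = ?D b a" for a b by metis
  show ?thesis
  proof
    assume "{\<sigma>, \<tau>} \<in> even_derangement_edges n q"
    then obtain g s where gs: "g \<in> carrier (alt_power n q)" "s \<in> (\<Pi>\<^sub>E k\<in>{1..q}. even_derangements n)"
      and e: "{\<sigma>, \<tau>} = {g, s \<otimes>\<^bsub>alt_power n q\<^esub> g}"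
      unfolding even_derangement_edges_def cayley_edges_def by blast
    from e have "\<sigma> = g \<and> \<tau> = s \<otimes>\<^bsub>alt_power n q\<^esub> g \<or> \<tau> = g \<and> \<sigma> = s \<otimes>\<^bsub>alt_power n q\<^esub> g"
      by (auto simp: doubleton_eq_iff)
    thus "?D \<sigma> \<tau>"
    proof (elim disjE conjE)
      assume "\<sigma> = g" "\<tau> = s \<otimes>\<^bsub>alt_power n q\<^esub> g"
      thus ?thesis using fwd[OF gs] by simp
    next
      assume *: "\<tau> = g" "\<sigma> = s \<otimes>\<^bsub>alt_power n q\<^esub> g"
      show ?thesis unfolding sym[of \<sigma> \<tau>] using fwd[OF gs] unfolding * .
    qed
  next
    assume "?D \<sigma> \<tau>"
    from bwd[OF this] obtain s where s: "s \<in> (\<Pi>\<^sub>E k\<in>{1..q}. even_derangements n)"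
      and \<tau>: "\<tau> = s \<otimes>\<^bsub>alt_power n q\<^esub> \<sigma>" by (rule bexE)
    show "{\<sigma>, \<tau>} \<in> even_derangement_edges n q"
      unfolding even_derangement_edges_def cayley_edges_def mem_Collect_eq
      by (intro exI[of _ \<sigma>] exI[of _ s] conjI s assms(1)) (simp only: \<tau>)
  qed
qed

definition even_derangement_aut ::
  "nat \<Rightarrow> nat \<Rightarrow> ((nat \<Rightarrow> nat \<Rightarrow> nat) \<Rightarrow> (nat \<Rightarrow> nat \<Rightarrow> nat)) set" where
  "even_derangement_aut n q =
     graph_aut (carrier (alt_power n q)) (even_derangement_edges n q)"


subsection \<open>The groups acting on the vertex set\<close>

definition right_regular :: "('a, 'b) monoid_scheme \<Rightarrow> ('a \<Rightarrow> 'a) set" where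
  "right_regular G = {\<lambda>x\<in>carrier G. x \<otimes>\<^bsub>G\<^esub> g | g. g \<in> carrier G}"

definition inn_group :: "('a, 'b) monoid_scheme \<Rightarrow> ('a \<Rightarrow> 'a) monoid" where
  "inn_group G = (AutoGroup G)
     \<lparr>carrier := {\<lambda>x\<in>carrier G. g \<otimes>\<^bsub>G\<^esub> x \<otimes>\<^bsub>G\<^esub> inv\<^bsub>G\<^esub> g | g. g \<in> carrier G}\<rparr>"

definition wreath_sym ::
  "('a, 'b) monoid_scheme \<Rightarrow> nat \<Rightarrow> ((nat \<Rightarrow> 'a) \<times> (nat \<Rightarrow> nat)) monoid" where
  "wreath_sym G q =
     \<lparr>carrier = (\<Pi>\<^sub>E k\<in>{1..q}. carrier G) \<times> carrier (sym_group q),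
      monoid.mult = (\<lambda>(f, \<pi>) (g, \<rho>).
        (\<lambda>k\<in>{1..q}. f k \<otimes>\<^bsub>G\<^esub> g ((inv\<^bsub>sym_group q\<^esub> \<pi>) k), \<pi> \<otimes>\<^bsub>sym_group q\<^esub> \<rho>)),
      one = (\<lambda>k\<in>{1..q}. \<one>\<^bsub>G\<^esub>, \<one>\<^bsub>sym_group q\<^esub>)\<rparr>"

definition wreath_action ::
  "nat \<Rightarrow> nat \<Rightarrow> (nat \<Rightarrow> (nat \<Rightarrow> nat) \<Rightarrow> (nat \<Rightarrow> nat)) \<times> (nat \<Rightarrow> nat) \<Rightarrow>
   (nat \<Rightarrow> nat \<Rightarrow> nat) \<Rightarrow> (nat \<Rightarrow> nat \<Rightarrow> nat)" where
  "wreath_action n q = (\<lambda>(f, \<pi>).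
     \<lambda>x\<in>carrier (alt_power n q). \<lambda>k\<in>{1..q}. f k (x ((inv\<^bsub>sym_group q\<^esub> \<pi>) k)))"

definition inn_wreath ::
  "nat \<Rightarrow> nat \<Rightarrow> ((nat \<Rightarrow> nat \<Rightarrow> nat) \<Rightarrow> (nat \<Rightarrow> nat \<Rightarrow> nat)) set" where
  "inn_wreath n q = wreath_action n q ` carrier (wreath_sym (inn_group (sym_group n)) q)"

definition inn_base ::
  "nat \<Rightarrow> nat \<Rightarrow> ((nat \<Rightarrow> nat \<Rightarrow> nat) \<Rightarrow> (nat \<Rightarrow> nat \<Rightarrow> nat)) set" where
  "inn_base n q =
     wreath_action n q `
       ((\<Pi>\<^sub>E k\<in>{1..q}. carrier (inn_group (sym_group n))) \<times> {\<one>\<^bsub>sym_group q\<^esub>})"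

definition coord_inv ::
  "nat \<Rightarrow> nat \<Rightarrow> nat \<Rightarrow> (nat \<Rightarrow> nat \<Rightarrow> nat) \<Rightarrow> (nat \<Rightarrow> nat \<Rightarrow> nat)" where
  "coord_inv n q k = (\<lambda>x\<in>carrier (alt_power n q). x(k := inv\<^bsub>alt_group n\<^esub> (x k)))"

definition coord_inv_group ::
  "nat \<Rightarrow> nat \<Rightarrow> ((nat \<Rightarrow> nat \<Rightarrow> nat) \<Rightarrow> (nat \<Rightarrow> nat \<Rightarrow> nat)) set" where
  "coord_inv_group n q =
     generate (BijGroup (carrier (alt_power n q))) (coord_inv n q ` {1..q})"


subsection \<open>Why the outer product is not stated with a normal left factor\<close>

lemma alt_power_group: "group (alt_power n q)"
  unfolding alt_power_def by (rule product_group) (rule alt_group_is_group)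

lemma finite_alt_power: "finite (carrier (alt_power n q))"
proof -
  have "carrier (alt_group n) \<subseteq> {p. p permutes {1..n}}"
    by (auto simp: alt_group_carrier)
  hence "finite (carrier (alt_group n))"
    using finite_permutations[of "{1..n}"] finite_subset by blast
  thus ?thesis
    unfolding alt_power_def by (simp add: finite_PiE)
qed

lemma right_regular_subset_Bij: "right_regular (alt_power n q) \<subseteq> Bij (carrier (alt_power n q))"
proof
  interpret G: group "alt_power n q" by (rule alt_power_group)
  fix r assume "r \<in> right_regular (alt_power n q)"
  then obtain g where g: "g \<in> carrier (alt_power n q)"
    and r: "r = (\<lambda>x\<in>carrier (alt_power n q). x \<otimes>\<^bsub>alt_power n q\<^esub> g)"
    unfolding right_regular_def by auto
  have "inj_on r (carrier (alt_power n q))"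
    using g by (auto simp: r inj_on_def)
  moreover have "r ` carrier (alt_power n q) \<subseteq> carrier (alt_power n q)"
    using g by (auto simp: r)
  ultimately show "r \<in> Bij (carrier (alt_power n q))"
    using endo_inj_surj[OF finite_alt_power] by (auto simp: Bij_def bij_betw_def r)
qed

lemma inn_alt_group:
  assumes "c \<in> carrier (inn_group (sym_group n))"
  shows "\<And>x. x \<in> carrier (alt_group n) \<Longrightarrow> c x \<in> carrier (alt_group n)"
    and "\<And>x y. \<lbrakk>x \<in> carrier (alt_group n); y \<in> carrier (alt_group n)\<rbrakk> \<Longrightarrow> c (x \<circ> y) = c x \<circ> c y"
    and "inj_on c (carrier (alt_group n))"
proof -
  obtain g where g': "g \<in> carrier (sym_group n)"
    and c: "c = (\<lambda>x\<in>carrier (sym_group n). g \<circ> x \<circ> inv' g)"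
    using assms unfolding inn_group_def by (auto simp: sym_group_mult)
  have g: "g permutes {1..n}" using g' by (simp add: sym_group_carrier)
  have gg: "inv' g \<circ> g = id" "g \<circ> inv' g = id"
    using g permutes_inv_o by blast+
  have sub: "x \<in> carrier (sym_group n)" if "x \<in> carrier (alt_group n)" for x
    using that by (simp add: alt_group_carrier sym_group_carrier)
  have pg: "permutation g" "permutation (inv' g)"
    using g by (metis finite_atLeastAtMost permutation_permutes permutes_inv)+
  have cx: "c x = g \<circ> x \<circ> inv' g" if "x \<in> carrier (alt_group n)" for x
    using sub[OF that] by (simp add: c)
  show clos: "c x \<in> carrier (alt_group n)" if x: "x \<in> carrier (alt_group n)" for x
  proof -
    have px: "permutation x" "x permutes {1..n}" "evenperm x"
      using x alt_group_carrier' by (auto simp: alt_group_carrier)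
    have "(g \<circ> x \<circ> inv' g) permutes {1..n}"
      using g px by (meson permutes_compose permutes_inv)
    moreover have "evenperm (g \<circ> x \<circ> inv' g)"
      using pg px by (simp add: evenperm_comp permutation_compose evenperm_inv)
    ultimately show ?thesis
      by (simp add: cx[OF x] alt_group_carrier)
  qed
  show "c (x \<circ> y) = c x \<circ> c y" if x: "x \<in> carrier (alt_group n)" and y: "y \<in> carrier (alt_group n)" for x y
  proof -
    have "x \<circ> y \<in> carrier (alt_group n)"
      using x y group.is_monoid[OF alt_group_is_group] monoid.m_closed alt_group_mult by metis
    moreover have "g \<circ> (x \<circ> y) \<circ> inv' g = g \<circ> x \<circ> (inv' g \<circ> g) \<circ> y \<circ> inv' g"
      by (simp add: gg comp_assoc)
    ultimately show ?thesis
      using x y by (simp add: cx comp_assoc)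
  qed
  show "inj_on c (carrier (alt_group n))"
  proof (rule inj_onI)
    fix x y assume x: "x \<in> carrier (alt_group n)" and y: "y \<in> carrier (alt_group n)" and "c x = c y"
    hence "inv' g \<circ> (g \<circ> x \<circ> inv' g) \<circ> g = inv' g \<circ> (g \<circ> y \<circ> inv' g) \<circ> g"
      by (simp add: cx)
    hence "(inv' g \<circ> g) \<circ> x \<circ> (inv' g \<circ> g) = (inv' g \<circ> g) \<circ> y \<circ> (inv' g \<circ> g)"
      by (simp only: comp_assoc)
    thus "x = y" by (simp add: gg)
  qed
qed

lemma inn_wreath_elem:
  assumes "w \<in> inn_wreath n q"
  obtains f \<pi> where "\<forall>k\<in>{1..q}. f k \<in> carrier (inn_group (sym_group n))"
    "\<pi> permutes {1..q}"
    "w = (\<lambda>x\<in>carrier (alt_power n q). \<lambda>k\<in>{1..q}. f k (x (inv' \<pi> k)))"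
proof -
  obtain f \<pi> where f: "f \<in> (\<Pi>\<^sub>E k\<in>{1..q}. carrier (inn_group (sym_group n)))"
    and \<pi>: "\<pi> \<in> carrier (sym_group q)" and w: "w = wreath_action n q (f, \<pi>)"
    using assms unfolding inn_wreath_def wreath_sym_def by auto
  show thesis
  proof (rule that)
    show "\<forall>k\<in>{1..q}. f k \<in> carrier (inn_group (sym_group n))"
      using f by blast
    show "\<pi> permutes {1..q}" using \<pi> by (simp add: sym_group_carrier)
    show "w = (\<lambda>x\<in>carrier (alt_power n q). \<lambda>k\<in>{1..q}. f k (x (inv' \<pi> k)))"
      using \<pi> by (simp add: w wreath_action_def)
  qed
qed

lemma inn_wreath_subset_Bij: "inn_wreath n q \<subseteq> Bij (carrier (alt_power n q))"
proof
  fix w assume "w \<in> inn_wreath n q"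
  then obtain f \<pi> where f': "\<forall>k\<in>{1..q}. f k \<in> carrier (inn_group (sym_group n))"
    and \<pi>: "\<pi> permutes {1..q}"
    and w: "w = (\<lambda>x\<in>carrier (alt_power n q). \<lambda>k\<in>{1..q}. f k (x (inv' \<pi> k)))"
    by (rule inn_wreath_elem)
  have f: "f k \<in> carrier (inn_group (sym_group n))" if "k \<in> {1..q}" for k
    using f' that by blast
  have \<pi>': "inv' \<pi> k \<in> {1..q}" if "k \<in> {1..q}" for k
    using that \<pi> permutes_in_image permutes_inv by metis
  have "w ` carrier (alt_power n q) \<subseteq> carrier (alt_power n q)"
    unfolding w alt_power_def using inn_alt_group(1)[OF f] \<pi>' by (auto simp: PiE_iff)
  moreover have "inj_on w (carrier (alt_power n q))"
  proof (rule inj_onI)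
    fix x y assume x: "x \<in> carrier (alt_power n q)" and y: "y \<in> carrier (alt_power n q)" and e: "w x = w y"
    show "x = y"
    proof (rule PiE_ext)
      show "x \<in> (\<Pi>\<^sub>E k\<in>{1..q}. carrier (alt_group n))" "y \<in> (\<Pi>\<^sub>E k\<in>{1..q}. carrier (alt_group n))"
        using x y by (auto simp: alt_power_def)
      fix j assume j: "j \<in> {1..q}"
      have k: "\<pi> j \<in> {1..q}" using j \<pi> permutes_in_image by metis
      have "w x (\<pi> j) = w y (\<pi> j)" using e by simp
      hence "f (\<pi> j) (x j) = f (\<pi> j) (y j)"
        using x y k \<pi> by (simp add: w permutes_inverses(2))
      moreover have "x j \<in> carrier (alt_group n)" "y j \<in> carrier (alt_group n)"
        using x y j by (auto simp: alt_power_def PiE_iff)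
      ultimately show "x j = y j"
        using inn_alt_group(3)[OF f[OF k]] by (auto dest: inj_onD)
    qed
  qed
  ultimately show "w \<in> Bij (carrier (alt_power n q))"
    using endo_inj_surj[OF finite_alt_power] by (auto simp: Bij_def bij_betw_def w)
qed

lemma alt_group_noncommuting:
  assumes "n \<ge> 4"
  obtains a b where "a \<in> carrier (alt_group n)" "b \<in> carrier (alt_group n)" "a \<circ> b \<noteq> b \<circ> a"
proof
  let ?a = "transpose 1 2 \<circ> transpose 2 (3::nat)" and ?b = "transpose 1 2 \<circ> transpose 2 (4::nat)"
  have *: "transpose i j \<circ> transpose k l \<in> carrier (alt_group n)"
    if "i \<in> {1..n}" "j \<in> {1..n}" "k \<in> {1..n}" "l \<in> {1..n}" "i \<noteq> j" "k \<noteq> l" for i j k l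
    using that by (auto simp: alt_group_carrier evenperm_comp permutation_swap_id evenperm_swap
        intro!: permutes_compose permutes_swap_id)
  show "?a \<in> carrier (alt_group n)" "?b \<in> carrier (alt_group n)"
    using assms by (auto intro!: *)
  have "(?a \<circ> ?b) 1 \<noteq> (?b \<circ> ?a) 1"
    by (simp add: transpose_def)
  thus "?a \<circ> ?b \<noteq> ?b \<circ> ?a" by metis
qed

text \<open>
  For two or more coordinates, conjugating the swap of the first two coordinates by the inversion of the first
  coordinate gives a map that fixes the identity and sends \<open>(\<sigma>\<^sub>1, \<sigma>\<^sub>2, \<dots>)\<close> to
  \<open>(\<sigma>\<^sub>2\<^sup>-\<^sup>1, \<sigma>\<^sub>1\<^sup>-\<^sup>1, \<dots>)\<close>; this is no group automorphism, so it
  lies outside the product of the right regular representation and the wreath product.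
\<close>

lemma outer_factor_not_normal:
  assumes q: "q \<ge> 2" and n: "n \<ge> 4"
  defines "P \<equiv> BijGroup (carrier (alt_power n q))"
  shows "\<not> internal_semidirect P (right_regular (alt_power n q) <#>\<^bsub>P\<^esub> inn_wreath n q)
             (coord_inv_group n q) K"
proof
  define V where "V = carrier (alt_power n q)"
  define N where "N = right_regular (alt_power n q) <#>\<^bsub>P\<^esub> inn_wreath n q"
  assume "internal_semidirect P (right_regular (alt_power n q) <#>\<^bsub>P\<^esub> inn_wreath n q)
             (coord_inv_group n q) K"
  hence K: "subgroup K P" and N: "N \<lhd> (P\<lparr>carrier := K\<rparr>)"
    and Z: "subgroup (coord_inv_group n q) (P\<lparr>carrier := K\<rparr>)"
    by (auto simp: internal_semidirect_def N_def)
  have P: "group P" unfolding P_def by (rule group_BijGroup)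
  interpret P: group P by (rule P)
  interpret A: group "alt_group n" by (rule alt_group_is_group)
  interpret G: group "alt_power n q" by (rule alt_power_group)
  have Pc: "carrier P = Bij V" and Pm: "\<And>f g. f \<in> Bij V \<Longrightarrow> g \<in> Bij V \<Longrightarrow> f \<otimes>\<^bsub>P\<^esub> g = compose V f g"
    by (auto simp: P_def BijGroup_def V_def)
  have app: "(f \<otimes>\<^bsub>P\<^esub> g) x = f (g x)" if "f \<in> Bij V" "g \<in> Bij V" "x \<in> V" for f g x
    using that by (simp add: Pm compose_eq)
  have V: "V = (\<Pi>\<^sub>E k\<in>{1..q}. carrier (alt_group n))"
    by (simp add: V_def alt_power_def)
  define \<phi> where "\<phi> = coord_inv n q 1"
  have phiK: "\<phi> \<in> K"
  proof -
    have "\<phi> \<in> coord_inv_group n q"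
      using q unfolding \<phi>_def coord_inv_group_def by (intro generate.incl) auto
    thus ?thesis using subgroup.subset[OF Z] by auto
  qed
  have phiB: "\<phi> \<in> Bij V" using phiK subgroup.subset[OF K] Pc by auto
  have phi: "\<phi> x = x(1 := inv\<^bsub>alt_group n\<^esub> (x 1))" if "x \<in> V" for x
    using that by (simp add: \<phi>_def coord_inv_def V_def)
  have phiV: "\<phi> x \<in> V" if "x \<in> V" for x
    using phiB that Bij_imp_funcset by fastforce
  define \<tau> where "\<tau> = transpose 1 (2::nat)"
  have \<tau>: "\<tau> permutes {1..q}" unfolding \<tau>_def using q by (intro permutes_swap_id) auto
  define w where "w = wreath_action n q (\<lambda>k\<in>{1..q}. \<lambda>x\<in>carrier (sym_group n). x, \<tau>)"
  have idinn: "(\<lambda>x\<in>carrier (sym_group n). x) \<in> carrier (inn_group (sym_group n))"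
    unfolding inn_group_def
    by (auto intro!: exI[of _ id] restrict_ext simp: sym_group_mult sym_group_carrier permutes_id)
  have wW: "w \<in> inn_wreath n q"
    unfolding w_def inn_wreath_def wreath_sym_def
    using idinn \<tau> by (auto intro!: imageI simp: sym_group_carrier)
  have wB: "w \<in> Bij V" using wW inn_wreath_subset_Bij V_def by auto
  have w: "w x k = x (\<tau> k)" if "x \<in> V" "k \<in> {1..q}" for x k
  proof -
    have "inv\<^bsub>sym_group q\<^esub> \<tau> = \<tau>"
      using \<tau> by (simp add: sym_group_carrier \<tau>_def)
    moreover have "x (\<tau> k) \<in> carrier (sym_group n)"
    proof -
      have "\<tau> k \<in> {1..q}" using that \<tau> permutes_in_image by metis
      hence "x (\<tau> k) \<in> carrier (alt_group n)" using that by (auto simp: V PiE_iff)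
      thus ?thesis by (simp add: alt_group_carrier sym_group_carrier)
    qed
    ultimately show ?thesis
      using that by (simp add: w_def wreath_action_def V_def)
  qed
  have wV: "w x \<in> V" if "x \<in> V" for x
    using wB that Bij_imp_funcset by fastforce
  have wN: "w \<in> N"
  proof -
    have one: "\<one>\<^bsub>P\<^esub> \<in> right_regular (alt_power n q)"
      unfolding right_regular_def P_def BijGroup_def
      by (auto intro!: exI[of _ "\<one>\<^bsub>alt_power n q\<^esub>"] restrict_ext)
    have "\<one>\<^bsub>P\<^esub> \<otimes>\<^bsub>P\<^esub> w \<in> N"
      using one wW unfolding N_def set_mult_def by blast
    thus ?thesis using wB Pc by simp
  qed
  interpret K: group "P\<lparr>carrier := K\<rparr>" by (rule subgroup.subgroup_is_group[OF K P])
  have "\<phi> \<otimes>\<^bsub>P\<^esub> w \<otimes>\<^bsub>P\<^esub> inv\<^bsub>P\<lparr>carrier := K\<rparr>\<^esub> \<phi> \<in> N"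
    using normal.inv_op_closed2[OF N, of \<phi> w] phiK wN by simp
  hence "\<phi> \<otimes>\<^bsub>P\<^esub> w \<otimes>\<^bsub>P\<^esub> inv\<^bsub>P\<^esub> \<phi> \<in> N"
    using P.m_inv_consistent[OF K phiK] by simp
  moreover have "inv\<^bsub>P\<^esub> \<phi> = \<phi>"
  proof (rule P.inv_equality)
    have "compose V \<phi> \<phi> = (\<lambda>x\<in>V. x)"
    proof (rule ext)
      fix x show "compose V \<phi> \<phi> x = (\<lambda>x\<in>V. x) x"
      proof (cases "x \<in> V")
        case True
        hence "x 1 \<in> carrier (alt_group n)" using q by (auto simp: V PiE_iff)
        thus ?thesis using True phiV[OF True] by (simp add: compose_def phi)
      qed (simp add: compose_def)
    qed
    thus "\<phi> \<otimes>\<^bsub>P\<^esub> \<phi> = \<one>\<^bsub>P\<^esub>"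
      using phiB by (simp add: Pm) (simp add: P_def BijGroup_def V_def)
  qed (use phiB Pc in auto)
  ultimately have "\<phi> \<otimes>\<^bsub>P\<^esub> w \<otimes>\<^bsub>P\<^esub> \<phi> \<in> N" by simp
  then obtain r u where r: "r \<in> right_regular (alt_power n q)" and u: "u \<in> inn_wreath n q"
    and eq: "\<phi> \<otimes>\<^bsub>P\<^esub> w \<otimes>\<^bsub>P\<^esub> \<phi> = r \<otimes>\<^bsub>P\<^esub> u"
    unfolding N_def set_mult_def by auto
  have rB: "r \<in> Bij V" and uB: "u \<in> Bij V"
    using r u right_regular_subset_Bij[of n q] inn_wreath_subset_Bij[of n q] unfolding V_def by blast+
  obtain g where g: "g \<in> V" and rg: "\<And>x. x \<in> V \<Longrightarrow> r x = x \<otimes>\<^bsub>alt_power n q\<^esub> g"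
    using r unfolding right_regular_def V_def by auto
  obtain f \<pi> where f': "\<forall>k\<in>{1..q}. f k \<in> carrier (inn_group (sym_group n))"
    and \<pi>: "\<pi> permutes {1..q}"
    and u': "u = (\<lambda>x\<in>carrier (alt_power n q). \<lambda>k\<in>{1..q}. f k (x (inv' \<pi> k)))"
    using u by (rule inn_wreath_elem)
  have f: "f k \<in> carrier (inn_group (sym_group n))" if "k \<in> {1..q}" for k
    using f' that by blast
  have one: "1 \<in> {1..q}" and two: "2 \<in> {1..q}" using q by auto
  define j where "j = inv' \<pi> 1"
  have j: "j \<in> {1..q}" unfolding j_def using one \<pi> permutes_in_image permutes_inv by metis
  have main: "inv\<^bsub>alt_group n\<^esub> (x 2) = f 1 (x j) \<circ> g 1" if x: "x \<in> V" for x
  proof -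
    have uV: "u x \<in> V" using uB x Bij_imp_funcset by fastforce
    have wp: "\<phi> \<otimes>\<^bsub>P\<^esub> w \<in> Bij V" using phiB wB Pc P.m_closed by metis
    have "(\<phi> \<otimes>\<^bsub>P\<^esub> w \<otimes>\<^bsub>P\<^esub> \<phi>) x 1 = \<phi> (w (\<phi> x)) 1"
      using x phiV[OF x] wp phiB wB by (simp add: app)
    also have "\<dots> = inv\<^bsub>alt_group n\<^esub> (w (\<phi> x) 1)"
      using phi[OF wV[OF phiV[OF x]]] by simp
    also have "\<dots> = inv\<^bsub>alt_group n\<^esub> (x 2)"
      using w[OF phiV[OF x] one] phi[OF x] by (simp add: \<tau>_def)
    finally have 1: "(\<phi> \<otimes>\<^bsub>P\<^esub> w \<otimes>\<^bsub>P\<^esub> \<phi>) x 1 = inv\<^bsub>alt_group n\<^esub> (x 2)" .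
    have "(r \<otimes>\<^bsub>P\<^esub> u) x 1 = (u x \<otimes>\<^bsub>alt_power n q\<^esub> g) 1"
      using app[OF rB uB x] rg[OF uV] by simp
    also have "\<dots> = u x 1 \<circ> g 1"
      using one by (simp add: alt_power_def alt_group_mult)
    also have "u x 1 = f 1 (x j)"
      using x one by (simp add: u' V_def j_def)
    finally show ?thesis using 1 eq by metis
  qed
  obtain a b where a: "a \<in> carrier (alt_group n)" and b: "b \<in> carrier (alt_group n)"
    and ab: "a \<circ> b \<noteq> b \<circ> a"
    using alt_group_noncommuting[OF n] by blast
  define c where "c y = (\<lambda>k\<in>{1..q}. y)" for y :: "nat \<Rightarrow> nat"
  have cV: "c y \<in> V" if "y \<in> carrier (alt_group n)" for y
    using that by (auto simp: c_def V)
  have m: "inv\<^bsub>alt_group n\<^esub> y = f 1 y \<circ> g 1" if "y \<in> carrier (alt_group n)" for y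
    using main[OF cV[OF that]] j two by (simp add: c_def)
  have m1: "f 1 (y \<circ> z) = f 1 y \<circ> f 1 z"
    if "y \<in> carrier (alt_group n)" "z \<in> carrier (alt_group n)" for y z
    using inn_alt_group(2)[OF f[OF one]] that by blast
  have f1: "f 1 id \<in> carrier (alt_group n)"
    using inn_alt_group(1)[OF f[OF one]] A.one_closed alt_group_one by metis
  have id: "id \<in> carrier (alt_group n)" using A.one_closed by (simp add: alt_group_one)
  have "f 1 id \<otimes>\<^bsub>alt_group n\<^esub> f 1 id = f 1 id"
    using m1[OF id id] by (simp add: alt_group_mult)
  hence fid: "f 1 id = id"
    using A.r_cancel_one[OF f1 f1] by (simp add: alt_group_one)
  have "inv\<^bsub>alt_group n\<^esub> id = id" using A.inv_one by (simp add: alt_group_one)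
  hence g1: "g 1 = id" using m[OF id] fid by simp
  have m': "inv\<^bsub>alt_group n\<^esub> y = f 1 y" if "y \<in> carrier (alt_group n)" for y
    using m[OF that] g1 by simp
  have abc: "a \<circ> b \<in> carrier (alt_group n)" using A.m_closed[OF a b] by (simp add: alt_group_mult)
  have "inv\<^bsub>alt_group n\<^esub> (a \<circ> b) = inv\<^bsub>alt_group n\<^esub> a \<circ> inv\<^bsub>alt_group n\<^esub> b"
    using m1[OF a b] m' a b abc by simp
  hence "inv\<^bsub>alt_group n\<^esub> (a \<otimes>\<^bsub>alt_group n\<^esub> b) = inv\<^bsub>alt_group n\<^esub> (b \<otimes>\<^bsub>alt_group n\<^esub> a)"
    using a b by (simp add: alt_group_mult A.inv_mult_group[unfolded alt_group_mult])
  hence "a \<otimes>\<^bsub>alt_group n\<^esub> b = b \<otimes>\<^bsub>alt_group n\<^esub> a"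
    using a b A.inv_inj by (metis A.inv_inv A.m_closed)
  thus False using ab by (simp add: alt_group_mult)
qed

end

theory Submission
  imports Defs
begin

text \<open>
  Call two vertices \<^emph>\<open>close\<close> if they differ in a single coordinate, and there by a three-cycle. An
  automorphism of the graph preserves closeness. For \<open>n \<ge> 6\<close>, an even permutation that disagrees
  everywhere with two given ones may be prescribed at one point; hence the common neighbours of \<open>x\<close> and
  \<open>z\<close> are all neighbours of \<open>y\<close> iff at every point \<open>y\<close> agrees with \<open>x\<close> or with \<open>z\<close>, and for fixed \<open>x \<noteq> y\<close> the
  number of such \<open>z\<close> is largest precisely when \<open>x\<close> and \<open>y\<close> are close. For \<open>n = 5\<close> the number of common
  neighbours itself is largest precisely for close vertices.

  Two three-cycles are close iff they share an arc \<open>a \<mapsto> b\<close> or are mutually inverse. The three-cycles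
  through an arc form the lines of a geometry without triangles, and so do the arcs with a common tail or
  a common head; following both geometries, an automorphism of closeness that fixes the identity acts on
  the neighbours of the identity by permuting coordinates, conjugating and inverting. Comparing
  this description at adjacent vertices shows that an automorphism is determined by its action on the
  identity and its neighbours. Therefore the automorphisms are the maps whose \<open>k\<close>-th coordinate is
  \<open>g\<^sub>k x\<^sub>j\<^sup>\<plusminus>\<^sup>1 h\<^sub>k\<close> with \<open>j\<close> depending bijectively on \<open>k\<close> and \<open>g\<^sub>k\<close>, \<open>h\<^sub>k\<close> of equal parity, and all
  the asserted decompositions are read off from this normal form.
\<close>

subsection \<open>Even permutations avoiding two given permutations\<close>


text \<open>Closeness is read off from exact cardinalities, so no maximum is ever compared. Both
  counts factor over the coordinates: a factor is \<open>N\<close> where the vertices agree,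
  \<open>m < N\<close> where they differ by a three-cycle, and below \<open>m\<close> otherwise;
  hence the value \<open>N ^ (q - 1) * m\<close> singles out the close pairs. Correcting the parity
  of an avoiding permutation forbids up to five positions, which is why six points are asked for; on
  five points the sixty even permutations are evaluated instead.

  The obstacle in the local analysis is that closeness of three-cycles mixes two relations.
  Triangles separate them: two three-cycles sharing an arc have a third one close to both, mutually
  inverse ones have none. The inverse pairs are not waste: they tell which arcs are reverses of each
  other, and arcs with a common tail or head are recognised by the line of one meeting the line of
  the reverse of the other.

  Rigidity spreads from ball to ball: translated to a neighbour, an automorphism again has the local
  form, and the vertices shared by the two balls already force that form to be trivial.\<close>

definition disagree :: "'a set \<Rightarrow> ('a \<Rightarrow> 'a) \<Rightarrow> ('a \<Rightarrow> 'a) \<Rightarrow> 'a set" where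
  "disagree \<Omega> \<sigma> \<tau> = {i \<in> \<Omega>. \<sigma> i \<noteq> \<tau> i}"

lemma card_insert_le_Suc: "card (insert x A) \<le> Suc (card A)"
  by (simp add: card_insert_le_m1 card_insert_if)

text \<open>Descent on the number of bad positions, starting from any permutation with the
  prescribed value. The position \<open>a\<close> is never bad because \<open>b\<close> differs from
  both values there, and it is excluded as a partner of a swap, so \<open>\<omega> a = b\<close>
  survives.\<close>

lemma exists_permutation_avoiding:
  assumes \<Omega>: "finite \<Omega>" "card \<Omega> \<ge> 5" and \<sigma>: "\<sigma> permutes \<Omega>" and \<tau>: "\<tau> permutes \<Omega>"
    and b: "b \<noteq> \<sigma> a" "b \<noteq> \<tau> a"
    and \<omega>: "\<omega> permutes \<Omega>" "\<omega> a = b"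
  shows "\<exists>\<omega>. \<omega> permutes \<Omega> \<and> \<omega> a = b \<and> (\<forall>i\<in>\<Omega>. \<omega> i \<noteq> \<sigma> i \<and> \<omega> i \<noteq> \<tau> i)"
  using \<omega>
proof (induction "card {i\<in>\<Omega>. \<omega> i = \<sigma> i \<or> \<omega> i = \<tau> i}" arbitrary: \<omega> rule: less_induct)
  case less
  let ?bad = "\<lambda>\<omega>. {i\<in>\<Omega>. \<omega> i = \<sigma> i \<or> \<omega> i = \<tau> i}"
  show ?case
  proof (cases "?bad \<omega> = {}")
    case True
    thus ?thesis using less.prems by blast
  next
    case False
    then obtain x where x: "x \<in> \<Omega>" and bad: "\<omega> x = \<sigma> x \<or> \<omega> x = \<tau> x" by blast
    have xa: "x \<noteq> a" using bad b less.prems by auto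
    have inj: "inj \<omega>" "inj \<sigma>" "inj \<tau>" using less.prems \<sigma> \<tau> permutes_inj by blast+
    \<comment> \<open>Swapping the values at the bad position \<open>x\<close> and at any \<open>y \<notin> ?E\<close> repairs \<open>x\<close> and spoils nothing.\<close>
    let ?E = "{a, x, inv' \<omega> (\<sigma> x), inv' \<omega> (\<tau> x), inv' \<sigma> (\<omega> x), inv' \<tau> (\<omega> x)}"
    \<comment> \<open>The coincidence at \<open>x\<close> turns two of the last four candidates into
      \<open>x\<close> itself, so at most four positions are forbidden and five points leave a free
      \<open>y\<close>.\<close>
    have "\<exists>p r. ?E \<subseteq> {a, x, p, r}"
    proof (cases "\<omega> x = \<sigma> x")
      case True
      hence "inv' \<omega> (\<sigma> x) = x" "inv' \<sigma> (\<omega> x) = x"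
        using inj by (metis inv_f_f)+
      thus ?thesis by blast
    next
      case False
      hence "\<omega> x = \<tau> x" using bad by blast
      hence "inv' \<omega> (\<tau> x) = x" "inv' \<tau> (\<omega> x) = x"
        using inj by (metis inv_f_f)+
      thus ?thesis by blast
    qed
    then obtain p r where "?E \<subseteq> {a, x, p, r}" by blast
    moreover have "card {a, x, p, r} \<le> 4"
      using card_insert_le_Suc[of a "{x,p,r}"] card_insert_le_Suc[of x "{p,r}"]
        card_insert_le_Suc[of p "{r}"] by simp
    ultimately have "card ?E < card \<Omega>"
      using \<Omega> card_mono[of "{a, x, p, r}" ?E] by simp
    then obtain y where y: "y \<in> \<Omega>" "y \<notin> ?E"
      by (metis card_mono finite.emptyI finite.insertI linorder_not_less subsetI)
    define \<omega>' where "\<omega>' = \<omega> \<circ> transpose x y"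
    have p': "\<omega>' permutes \<Omega>" unfolding \<omega>'_def
      using less.prems x y by (intro permutes_compose permutes_swap_id)
    have v: "\<omega>' x = \<omega> y" "\<omega>' y = \<omega> x" "\<And>i. i \<noteq> x \<Longrightarrow> i \<noteq> y \<Longrightarrow> \<omega>' i = \<omega> i"
      by (auto simp: \<omega>'_def)
    have g: "\<omega> y \<noteq> \<sigma> x" "\<omega> y \<noteq> \<tau> x" "\<omega> x \<noteq> \<sigma> y" "\<omega> x \<noteq> \<tau> y"
      using y inj by (auto simp: inv_f_f dest: sym)
    have "?bad \<omega>' \<subset> ?bad \<omega>"
    proof
      show "?bad \<omega>' \<subseteq> ?bad \<omega>"
      proof
        fix i assume i: "i \<in> ?bad \<omega>'"
        hence "i \<noteq> x" "i \<noteq> y" using g v by auto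
        thus "i \<in> ?bad \<omega>" using i v by auto
      qed
      have "x \<notin> ?bad \<omega>'" "x \<in> ?bad \<omega>" using g v x bad by auto
      thus "?bad \<omega>' \<noteq> ?bad \<omega>" by blast
    qed
    hence "card (?bad \<omega>') < card (?bad \<omega>)"
      using \<Omega> by (intro psubset_card_mono) auto
    moreover have "\<omega>' a = b" using v(3)[of a] xa y less.prems by auto
    ultimately show ?thesis using less.hyps p' by blast
  qed
qed

lemma evenperm_comp_transpose:
  assumes "permutation p" "x \<noteq> y"
  shows "evenperm (p \<circ> transpose x y) \<longleftrightarrow> \<not> evenperm p"
  using assms by (simp add: evenperm_comp permutation_swap_id evenperm_swap)

text \<open>An odd solution becomes even by one more swap of values away from \<open>a\<close>. No
  position is bad any more, so no coincidence at \<open>x\<close> merges forbidden positions as it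
  did before; this costs the sixth point.\<close>

lemma exists_even_permutation_avoiding:
  assumes \<Omega>: "finite \<Omega>" "card \<Omega> \<ge> 6" and \<sigma>: "\<sigma> permutes \<Omega>" and \<tau>: "\<tau> permutes \<Omega>"
    and a: "a \<in> \<Omega>" and b: "b \<in> \<Omega>" "b \<noteq> \<sigma> a" "b \<noteq> \<tau> a"
  obtains \<omega> where "\<omega> permutes \<Omega>" "evenperm \<omega>" "\<omega> a = b" "\<And>i. i \<in> \<Omega> \<Longrightarrow> \<omega> i \<noteq> \<sigma> i \<and> \<omega> i \<noteq> \<tau> i"
proof -
  have "\<exists>\<omega>. \<omega> permutes \<Omega> \<and> \<omega> a = b \<and> (\<forall>i\<in>\<Omega>. \<omega> i \<noteq> \<sigma> i \<and> \<omega> i \<noteq> \<tau> i)"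
    by (rule exists_permutation_avoiding[OF \<Omega>(1) _ \<sigma> \<tau> b(2,3), of "transpose a b"])
      (use \<Omega> a b in \<open>auto intro: permutes_swap_id\<close>)
  then obtain \<omega> where \<omega>: "\<omega> permutes \<Omega>" "\<omega> a = b" "\<And>i. i \<in> \<Omega> \<Longrightarrow> \<omega> i \<noteq> \<sigma> i \<and> \<omega> i \<noteq> \<tau> i"
    by blast
  show thesis
  proof (cases "evenperm \<omega>")
    case True
    thus ?thesis using \<omega> that by blast
  next
    case False
    have inj: "inj \<omega>" "inj \<sigma>" "inj \<tau>" using \<omega> \<sigma> \<tau> permutes_inj by blast+
    \<comment> \<open>With this choice of \<open>x\<close> only five positions \<open>y\<close> are forbidden for a parity-changing swap.\<close>
    define x where "x = inv' \<sigma> b"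
    have sx: "\<sigma> x = b" unfolding x_def using \<sigma> by (simp add: permutes_inverses)
    have x: "x \<in> \<Omega>" using sx b \<sigma> by (metis permutes_in_image)
    have xa: "x \<noteq> a" using sx b by auto
    let ?E = "{a, x, inv' \<omega> (\<tau> x), inv' \<sigma> (\<omega> x), inv' \<tau> (\<omega> x)}"
    have "card ?E \<le> 5"
      by (rule order_trans[OF card_insert_le_Suc], simp)
        (rule order_trans[OF card_insert_le_Suc], simp,
         rule order_trans[OF card_insert_le_Suc], simp,
         rule order_trans[OF card_insert_le_Suc], simp)
    hence "card ?E < card \<Omega>" using \<Omega> by linarith
    then obtain y where y: "y \<in> \<Omega>" "y \<notin> ?E"
      by (metis card_mono finite.emptyI finite.insertI linorder_not_less subsetI)
    \<comment> \<open>The first inequality comes for free: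
      \<open>\<omega> y = \<sigma> x = b = \<omega> a\<close> would give
      \<open>y = a\<close>.\<close>
    have g: "\<omega> y \<noteq> \<sigma> x" "\<omega> y \<noteq> \<tau> x" "\<omega> x \<noteq> \<sigma> y" "\<omega> x \<noteq> \<tau> y"
      using y inj \<omega>(2) by (auto simp: inv_f_f sx inj_eq dest: sym)
    define \<omega>' where "\<omega>' = \<omega> \<circ> transpose x y"
    have p': "\<omega>' permutes \<Omega>" unfolding \<omega>'_def
      using \<omega> x y by (intro permutes_compose permutes_swap_id)
    have v: "\<omega>' x = \<omega> y" "\<omega>' y = \<omega> x" "\<And>i. i \<noteq> x \<Longrightarrow> i \<noteq> y \<Longrightarrow> \<omega>' i = \<omega> i"
      by (auto simp: \<omega>'_def)
    have "permutation \<omega>" using \<omega>(1) \<Omega>(1) permutation_permutes by blast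
    hence "evenperm \<omega>'" using False y by (auto simp: \<omega>'_def evenperm_comp_transpose)
    moreover have "\<omega>' a = b" using v(3)[of a] xa y \<omega>(2) by auto
    moreover have "\<omega>' i \<noteq> \<sigma> i \<and> \<omega>' i \<noteq> \<tau> i" if "i \<in> \<Omega>" for i
      using \<omega>(3)[OF that] g v by (cases "i = x"; cases "i = y") auto
    ultimately show ?thesis using p' that by blast
  qed
qed

section \<open>Counting even permutations, and parity bounds\<close>

text \<open>Composition with one fixed transposition exchanges even and odd permutations.\<close>

lemma card_even_permutations:
  assumes S: "finite S" "card S \<ge> 2"
  shows "2 * card {p. p permutes S \<and> evenperm p} = fact (card S)"
proof -
  obtain x y where xy: "x \<in> S" "y \<in> S" "x \<noteq> y"
    using S by (metis card_le_Suc0_iff_eq not_less_eq_eq numeral_2_eq_2)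
  let ?E = "{p. p permutes S \<and> evenperm p}" and ?O = "{p. p permutes S \<and> \<not> evenperm p}"
  have perm: "permutation p" if "p permutes S" for p using that S permutation_permutes by blast
  have "bij_betw (\<lambda>p. p \<circ> transpose x y) ?E ?O"
    by (rule bij_betw_byWitness[where f' = "\<lambda>p. p \<circ> transpose x y"])
      (use xy in \<open>auto simp: comp_assoc evenperm_comp_transpose perm intro!: permutes_compose permutes_swap_id\<close>)
  hence "card ?E = card ?O" by (rule bij_betw_same_card)
  moreover have "card ?E + card ?O = card (?E \<union> ?O)"
    using finite_permutations[OF S(1)] by (intro card_Un_disjoint[symmetric]) auto
  moreover have "?E \<union> ?O = {p. p permutes S}" by auto
  ultimately show ?thesis using card_permutations[OF refl S(1)] by simp
qed

text \<open>Below two points there is no transposition to compose with; the identity is alone, and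
  half the factorial would be wrong.\<close>

lemma card_even_permutations_small:
  assumes S: "finite S" "card S \<le> 1"
  shows "card {p. p permutes S \<and> evenperm p} = 1"
proof -
  have "p = id" if "p permutes S" for p
  proof
    fix x show "p x = id x"
    proof (cases "x \<in> S")
      case True
      hence "p x \<in> S" using that by (simp add: permutes_in_image)
      thus ?thesis using True S by (metis card_le_Suc0_iff_eq One_nat_def id_apply)
    qed (use that in \<open>auto simp: permutes_def\<close>)
  qed
  hence "{p. p permutes S \<and> evenperm p} = {id}" by (auto simp: permutes_id)
  thus ?thesis by simp
qed

text \<open>The quotient \<open>inv' \<sigma> \<circ> \<tau>\<close> moves exactly the positions of
  disagreement. A permutation other than \<open>id\<close> that moves at most two points is a
  transposition, hence odd.\<close>

lemma card_disagree_even_ge_3: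
  assumes \<Omega>: "finite \<Omega>" and \<sigma>: "\<sigma> permutes \<Omega>" "evenperm \<sigma>" and \<tau>: "\<tau> permutes \<Omega>" "evenperm \<tau>"
    and "\<sigma> \<noteq> \<tau>"
  shows "card (disagree \<Omega> \<sigma> \<tau>) \<ge> 3"
proof (rule ccontr)
  assume "\<not> ?thesis"
  hence c: "card (disagree \<Omega> \<sigma> \<tau>) \<le> 2" by simp
  have fin: "finite (disagree \<Omega> \<sigma> \<tau>)" using \<Omega> by (simp add: disagree_def)
  define p where "p = inv' \<sigma> \<circ> \<tau>"
  have st: "\<sigma> (p z) = \<tau> z" for z using \<sigma> by (simp add: p_def permutes_inverses)
  have p: "p permutes \<Omega>" unfolding p_def using \<sigma> \<tau> by (intro permutes_compose permutes_inv)
  have D: "p i \<noteq> i \<longleftrightarrow> i \<in> disagree \<Omega> \<sigma> \<tau>" for i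
  proof -
    have "p i \<noteq> i \<longleftrightarrow> \<sigma> i \<noteq> \<tau> i" using st[of i] permutes_inj[OF \<sigma>(1)] by (metis inj_eq)
    thus ?thesis using permutes_not_in[OF p, of i] by (auto simp: disagree_def)
  qed
  obtain x where x: "p x \<noteq> x"
    using st \<open>\<sigma> \<noteq> \<tau>\<close> by (metis ext)
  hence px: "p (p x) \<noteq> p x" using p by (metis permutes_inj inj_eq)
  have "disagree \<Omega> \<sigma> \<tau> = {x, p x}"
  proof (rule sym, rule card_seteq[OF fin])
    have "card {x, p x} = 2" using x by simp
    thus "card (disagree \<Omega> \<sigma> \<tau>) \<le> card {x, p x}" using c by simp
  qed (use x px D in auto)
  hence fx: "p z = z" if "z \<noteq> x" "z \<noteq> p x" for z using that D by blast
  have ppx: "p (p x) = x"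
  proof (rule ccontr)
    assume "p (p x) \<noteq> x"
    hence "p (p (p x)) = p (p x)" using fx px by blast
    thus False using px p by (metis permutes_inj inj_eq)
  qed
  have "p = transpose x (p x)"
    by (rule ext) (metis fx ppx transpose_apply_first transpose_apply_second transpose_apply_other)
  hence "\<not> evenperm p" using x by (metis evenperm_swap)
  moreover have "evenperm p"
    unfolding p_def using \<sigma> \<tau> \<Omega>
    by (metis evenperm_comp evenperm_inv permutation_inverse permutation_permutes)
  ultimately show False by blast
qed

text \<open>Two factors of size at most \<open>m\<close> already push the product below
  \<open>N ^ (card I - 1) * m\<close>, because \<open>m * m < m * N\<close>; no small factor at all
  puts it above. So exactly one factor differs from \<open>N\<close>.\<close>

lemma prod_eq_iff_one_small:
  fixes u :: "'i \<Rightarrow> nat"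
  assumes I: "finite I" "I \<noteq> {}" and m: "0 < m" "m < N" and u: "\<And>i. i \<in> I \<Longrightarrow> u i = N \<or> u i \<le> m"
  shows "prod u I = N ^ (card I - 1) * m \<longleftrightarrow> (\<exists>k\<in>I. u k = m \<and> (\<forall>j\<in>I - {k}. u j = N))"
proof
  assume *: "prod u I = N ^ (card I - 1) * m"
  have "\<exists>k\<in>I. u k \<noteq> N"
  proof (rule ccontr)
    assume "\<not> ?thesis"
    hence "prod u I = N ^ card I" by simp
    also have "\<dots> = N ^ (card I - 1) * N"
      using I by (metis card_gt_0_iff power_minus_mult)
    finally show False using * m by simp
  qed
  then obtain k where k: "k \<in> I" "u k \<noteq> N" by blast
  hence uk: "u k \<le> m" using u by blast
  have all: "u j = N" if j: "j \<in> I - {k}" for j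
  proof (rule ccontr)
    assume "u j \<noteq> N"
    hence uj: "u j \<le> m" using u j by blast
    have le: "u i \<le> N" if "i \<in> I" for i using u[OF that] m by linarith
    have "prod u (I - {k} - {j}) \<le> (\<Prod>i\<in>I - {k} - {j}. N)"
      by (rule prod_mono) (use le in auto)
    hence r: "prod u (I - {k} - {j}) \<le> N ^ card (I - {k} - {j})" by simp
    have "prod u I = u k * (u j * prod u (I - {k} - {j}))"
      using I j k by (simp add: prod.remove[of I k] prod.remove[of "I - {k}" j])
    also have "\<dots> \<le> m * (m * N ^ card (I - {k} - {j}))"
      by (intro mult_mono uk uj r) auto
    also have "\<dots> < m * (N * N ^ card (I - {k} - {j}))"
      using m by simp
    also have "N * N ^ card (I - {k} - {j}) = N ^ (card I - 1)"
      using I j k by (metis card_Suc_Diff1 card_Diff_singleton finite_Diff power_Suc)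
    finally show False using * by (simp add: mult.commute)
  qed
  have "prod u I = u k * N ^ (card I - 1)"
    using I k all by (simp add: prod.remove[of I k])
  hence "u k = m" using * m by simp
  thus "\<exists>k\<in>I. u k = m \<and> (\<forall>j\<in>I - {k}. u j = N)" using k all by blast
next
  assume "\<exists>k\<in>I. u k = m \<and> (\<forall>j\<in>I - {k}. u j = N)"
  then obtain k where "k \<in> I" "u k = m" "\<forall>j\<in>I - {k}. u j = N" by blast
  thus "prod u I = N ^ (card I - 1) * m"
    using I by (simp add: prod.remove[of I k])
qed

subsection \<open>Common neighbours in degree five\<close>


text \<open>Executable form of \<open>permutes_insert\<close>: a permutation of
  \<open>a # ys\<close> is \<open>transpose a b\<close> after a permutation of \<open>ys\<close>.
  The sign is carried along and flips exactly when \<open>a \<noteq> b\<close>, since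
  \<open>transpose a a\<close> is the identity.\<close>

fun signed_perm_lists :: "nat list \<Rightarrow> nat list \<Rightarrow> (bool \<times> nat list) list" where
  "signed_perm_lists xs [] = [(True, xs)]"
| "signed_perm_lists xs (a # ys) =
     concat (map (\<lambda>b. map (\<lambda>(e, l). (e = (a = b), map (transpose a b) l)) (signed_perm_lists xs ys))
       (a # ys))"

lemma set_signed_perm_lists:
  "distinct ys \<Longrightarrow>
    set (signed_perm_lists xs ys) = (\<lambda>p. (evenperm p, map p xs)) ` {p. p permutes set ys}"
proof (induction ys)
  case Nil
  show ?case by (auto simp: permutes_empty)
next
  case (Cons a ys)
  have ev: "evenperm (transpose a b \<circ> p) = (evenperm p = (a = b))" if "p permutes set ys" for p b
  proof -
    have "permutation p" using that permutation_permutes by blast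
    thus ?thesis by (auto simp: evenperm_comp permutation_swap_id evenperm_swap)
  qed
  have "{p. p permutes set (a # ys)} =
      (\<lambda>(b, p). transpose a b \<circ> p) ` {(b, p). b \<in> set (a # ys) \<and> p permutes set ys}"
    by (simp add: permutes_insert)
  also have "\<dots> = (\<Union>b\<in>set (a # ys). (\<lambda>p. transpose a b \<circ> p) ` {p. p permutes set ys})"
    by fast
  finally have "(\<lambda>p. (evenperm p, map p xs)) ` {p. p permutes set (a # ys)} =
     (\<Union>b\<in>set (a # ys).
       (\<lambda>p. (evenperm (transpose a b \<circ> p), map (transpose a b \<circ> p) xs)) ` {p. p permutes set ys})"
    by (simp only: image_UN image_image)
  also have "\<dots> = (\<Union>b\<in>set (a # ys).
       (\<lambda>p. (evenperm p = (a = b), map (transpose a b) (map p xs))) ` {p. p permutes set ys})"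
    by (intro SUP_cong image_cong refl) (simp add: ev)
  also have "\<dots> = (\<Union>b\<in>set (a # ys). (\<lambda>(e, l). (e = (a = b), map (transpose a b) l)) `
       (\<lambda>p. (evenperm p, map p xs)) ` {p. p permutes set ys})"
    by (simp only: image_image split_conv)
  also have "\<dots> = set (signed_perm_lists xs (a # ys))"
    using Cons by (simp only: signed_perm_lists.simps set_concat set_map) simp
  finally show ?case by simp
qed


definition A5_lists :: "nat list list" where
  "A5_lists = map snd (filter fst (signed_perm_lists [1,2,3,4,5] [1,2,3,4,5]))"

definition D5_lists :: "nat list list" where
  "D5_lists = filter (list_all2 (\<noteq>) [1,2,3,4,5]) A5_lists"

text \<open>The value 24 is the number of five-cycles, the only even derangements of five points; 12
  and 8 are the numbers of those that also avoid an even permutation moving three points, or more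
  than three. The index \<open>i - 1\<close> appears because list positions start at 0 and points at
  1.\<close>

definition avoiding_counts_ok :: "nat list list \<Rightarrow> nat list list \<Rightarrow> bool" where
  "avoiding_counts_ok A D \<longleftrightarrow> distinct D \<and>
     (\<forall>l\<in>set A. length (filter (list_all2 (\<noteq>) l) D) =
       (let d = length (filter (\<lambda>i. l ! (i - 1) \<noteq> i) [1,2,3,4,5]) in
         if d = 0 then 24 else if d = 3 then 12 else 8))"

lemma avoiding_counts_A5: "avoiding_counts_ok A5_lists D5_lists"
  by code_simp

text \<open>Carries the evaluation back from value lists to permutations. The encoding is injective
  because all these permutations fix everything outside \<open>{1..5}\<close>, and distinctness of
  the list turns its length into a cardinality.\<close>

lemma card_avoiding_A5:
  assumes \<pi>: "\<pi> \<in> carrier (alt_group 5)"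
  shows "card {p \<in> carrier (alt_group 5). \<forall>i\<in>{1..5}. i \<noteq> p i \<and> \<pi> i \<noteq> p i} =
    (let d = card (disagree {1..5} id \<pi>) in if d = 0 then 24 else if d = 3 then 12 else 8)"
proof -
  define enc :: "(nat \<Rightarrow> nat) \<Rightarrow> nat list" where "enc p = map p [1,2,3,4,5]" for p
  let ?A = "carrier (alt_group 5)"
  let ?S = "{p \<in> ?A. \<forall>i\<in>{1..5}. i \<noteq> p i \<and> \<pi> i \<noteq> p i}"
  have set5: "{1..5} = set [1,2,3,4,5::nat]" by auto
  have ball5: "(\<forall>i\<in>{1..5}. P i) \<longleftrightarrow> P 1 \<and> P 2 \<and> P 3 \<and> P 4 \<and> P 5" for P :: "nat \<Rightarrow> bool"
    unfolding set5 by simp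
  have A: "set A5_lists = enc ` ?A"
  proof -
    have "set (signed_perm_lists [1,2,3,4,5] [1,2,3,4,5]) = (\<lambda>p. (evenperm p, enc p)) ` {p. p permutes {1..5}}"
      using set_signed_perm_lists[of "[1,2,3,4,5]" "[1,2,3,4,5]"] unfolding enc_def set5 by simp
    moreover have "snd ` {x \<in> (\<lambda>p. (evenperm p, enc p)) ` {p. p permutes {1..5}}. fst x} =
        enc ` {p. p permutes {1..5} \<and> evenperm p}"
      by force
    moreover have "?A = {p. p permutes {1..5} \<and> evenperm p}"
      using alt_group_carrier by blast
    ultimately show ?thesis unfolding A5_lists_def set_map set_filter by simp
  qed
  have "list_all2 (\<noteq>) [1,2,3,4,5] (enc p) \<longleftrightarrow> (\<forall>i\<in>{1..5}. i \<noteq> p i)" for p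
    unfolding ball5 enc_def by simp
  hence D: "set D5_lists = enc ` {p \<in> ?A. \<forall>i\<in>{1..5}. i \<noteq> p i}"
    unfolding D5_lists_def set_filter A by blast
  have "list_all2 (\<noteq>) (enc \<pi>) (enc p) \<longleftrightarrow> (\<forall>i\<in>{1..5}. \<pi> i \<noteq> p i)" for p
    unfolding ball5 enc_def by simp
  hence "set (filter (list_all2 (\<noteq>) (enc \<pi>)) D5_lists) = enc ` ?S"
    unfolding set_filter D by blast
  moreover have "inj_on enc ?S"
  proof (rule inj_onI, rule ext)
    fix p r i assume pr: "p \<in> ?S" "r \<in> ?S" "enc p = enc r"
    show "p i = r i"
    proof (cases "i \<in> {1..5}")
      case True
      have "\<forall>i\<in>{1..5}. p i = r i" using pr(3) unfolding ball5 enc_def by simp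
      thus ?thesis using True by blast
    next
      case False
      have "p permutes {1..5}" "r permutes {1..5}" using pr alt_group_carrier by blast+
      thus ?thesis using False by (metis permutes_not_in)
    qed
  qed
  moreover have "distinct D5_lists"
    using avoiding_counts_A5 by (simp add: avoiding_counts_ok_def)
  ultimately have "card ?S = length (filter (list_all2 (\<noteq>) (enc \<pi>)) D5_lists)"
    using card_image[of enc ?S] distinct_card[of "filter (list_all2 (\<noteq>) (enc \<pi>)) D5_lists"] by simp
  moreover have "enc \<pi> \<in> set A5_lists" using \<pi> A by blast
  moreover have "length (filter (\<lambda>i. enc \<pi> ! (i - 1) \<noteq> i) [1,2,3,4,5]) = card (disagree {1..5} id \<pi>)"
  proof -
    have "\<forall>i\<in>{1..5}. enc \<pi> ! (i - 1) = \<pi> i" unfolding ball5 enc_def by simp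
    hence S: "set (filter (\<lambda>i. enc \<pi> ! (i - 1) \<noteq> i) [1,2,3,4,5]) = disagree {1..5} id \<pi>"
      unfolding disagree_def set_filter set5[symmetric] by fastforce
    have "distinct (filter (\<lambda>i. enc \<pi> ! (i - 1) \<noteq> i) [1,2,3,4,5])"
      by (rule distinct_filter) simp
    from distinct_card[OF this] show ?thesis unfolding S by (rule sym)
  qed
  ultimately show ?thesis
    using avoiding_counts_A5 unfolding avoiding_counts_ok_def by (simp only: Let_def)
qed

subsection \<open>Recovering the three-cycle graph\<close>


definition adjacent :: "nat \<Rightarrow> nat \<Rightarrow> (nat \<Rightarrow> nat \<Rightarrow> nat) \<Rightarrow> (nat \<Rightarrow> nat \<Rightarrow> nat) \<Rightarrow> bool" where
  "adjacent n q x y \<longleftrightarrow> (\<forall>k\<in>{1..q}. \<forall>i\<in>{1..n}. x k i \<noteq> y k i)"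

text \<open>The closeness of the overview: a permutation that moves exactly three points is a
  three-cycle.\<close>

definition tri_adjacent :: "nat \<Rightarrow> nat \<Rightarrow> (nat \<Rightarrow> nat \<Rightarrow> nat) \<Rightarrow> (nat \<Rightarrow> nat \<Rightarrow> nat) \<Rightarrow> bool" where
  "tri_adjacent n q x y \<longleftrightarrow>
     (\<exists>k\<in>{1..q}. card (disagree {1..n} (x k) (y k)) = 3 \<and> (\<forall>j\<in>{1..q} - {k}. x j = y j))"

lemma carrier_alt_power: "carrier (alt_power n q) = (\<Pi>\<^sub>E k\<in>{1..q}. carrier (alt_group n))"
  by (simp add: alt_power_def)

lemma alt_power_component:
  "x \<in> carrier (alt_power n q) \<Longrightarrow> k \<in> {1..q} \<Longrightarrow> x k \<in> carrier (alt_group n)"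
  by (auto simp: carrier_alt_power PiE_iff)

lemma alt_group_comp: "p \<in> carrier (alt_group n) \<Longrightarrow> r \<in> carrier (alt_group n) \<Longrightarrow> p \<circ> r \<in> carrier (alt_group n)"
  by (metis alt_group_is_group alt_group_mult group.is_monoid monoid.m_closed)

lemma disagree_self [simp]: "disagree \<Omega> \<sigma> \<sigma> = {}"
  by (simp add: disagree_def)

lemma card_disagree_alt_ge_3:
  assumes "\<sigma> \<in> carrier (alt_group n)" "\<tau> \<in> carrier (alt_group n)" "\<sigma> \<noteq> \<tau>"
  shows "card (disagree {1..n} \<sigma> \<tau>) \<ge> 3"
  using assms by (auto simp: alt_group_carrier intro!: card_disagree_even_ge_3)

lemma disagree_comp_left: "inj h \<Longrightarrow> disagree \<Omega> (h \<circ> \<sigma>) (h \<circ> \<tau>) = disagree \<Omega> \<sigma> \<tau>"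
  by (auto simp: disagree_def inj_eq)

text \<open>Common interface for the two counts; \<open>wt\<close> is the factor contributed by one
  coordinate. Distinct even permutations disagree in at least three positions, so the three
  assumptions on \<open>wt\<close> cover every pair.\<close>

lemma prod_weight_eq_iff_tri_adjacent:
  fixes wt :: "(nat \<Rightarrow> nat) \<Rightarrow> (nat \<Rightarrow> nat) \<Rightarrow> nat"
  assumes q: "q \<ge> 1" and m: "0 < m" "m < N"
    and wt0: "\<And>\<sigma>. \<sigma> \<in> carrier (alt_group n) \<Longrightarrow> wt \<sigma> \<sigma> = N"
    and wt3: "\<And>\<sigma> \<tau>. \<lbrakk>\<sigma> \<in> carrier (alt_group n); \<tau> \<in> carrier (alt_group n);
        card (disagree {1..n} \<sigma> \<tau>) = 3\<rbrakk> \<Longrightarrow> wt \<sigma> \<tau> = m"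
    and wt4: "\<And>\<sigma> \<tau>. \<lbrakk>\<sigma> \<in> carrier (alt_group n); \<tau> \<in> carrier (alt_group n);
        card (disagree {1..n} \<sigma> \<tau>) > 3\<rbrakk> \<Longrightarrow> wt \<sigma> \<tau> < m"
    and x: "x \<in> carrier (alt_power n q)" and y: "y \<in> carrier (alt_power n q)"
  shows "(\<Prod>k\<in>{1..q}. wt (x k) (y k)) = N ^ (q - 1) * m \<longleftrightarrow> tri_adjacent n q x y"
proof -
  have w: "wt (x k) (y k) = N \<longleftrightarrow> x k = y k" "wt (x k) (y k) = m \<longleftrightarrow> card (disagree {1..n} (x k) (y k)) = 3"
    "wt (x k) (y k) = N \<or> wt (x k) (y k) \<le> m"
    if k: "k \<in> {1..q}" for k
  proof -
    note c = alt_power_component[OF x k] alt_power_component[OF y k]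
    consider "x k = y k" | "card (disagree {1..n} (x k) (y k)) = 3" | "card (disagree {1..n} (x k) (y k)) > 3"
      using card_disagree_alt_ge_3[OF c] by fastforce
    then have "(wt (x k) (y k) = N \<longleftrightarrow> x k = y k) \<and> (wt (x k) (y k) = m \<longleftrightarrow> card (disagree {1..n} (x k) (y k)) = 3)
      \<and> (wt (x k) (y k) = N \<or> wt (x k) (y k) \<le> m)"
    proof cases
      case 1 thus ?thesis using wt0[OF c(1)] m by simp
    next
      case 2
      hence "x k \<noteq> y k" by auto
      thus ?thesis using wt3[OF c 2] 2 m by simp
    next
      case 3
      hence "x k \<noteq> y k" by auto
      thus ?thesis using wt4[OF c 3] 3 m by simp
    qed
    thus "wt (x k) (y k) = N \<longleftrightarrow> x k = y k" "wt (x k) (y k) = m \<longleftrightarrow> card (disagree {1..n} (x k) (y k)) = 3"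
      "wt (x k) (y k) = N \<or> wt (x k) (y k) \<le> m" by blast+
  qed
  have "(\<Prod>k\<in>{1..q}. wt (x k) (y k)) = N ^ (card {1..q} - 1) * m \<longleftrightarrow>
      (\<exists>k\<in>{1..q}. wt (x k) (y k) = m \<and> (\<forall>j\<in>{1..q} - {k}. wt (x j) (y j) = N))"
    by (rule prod_eq_iff_one_small) (use q m w(3) in auto)
  also have "\<dots> \<longleftrightarrow> tri_adjacent n q x y"
    unfolding tri_adjacent_def using w(1,2) by (metis DiffD1)
  finally show ?thesis by simp
qed

section \<open>The factor of a single coordinate\<close>

text \<open>Left translation, used to move one of two permutations to the identity before
  counting.\<close>

lemma card_alt_group_shift:
  assumes \<sigma>: "\<sigma> \<in> carrier (alt_group n)"
    and Q: "\<And>p. p \<in> carrier (alt_group n) \<Longrightarrow> Q p \<longleftrightarrow> Q' (inv' \<sigma> \<circ> p)"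
  shows "card {p \<in> carrier (alt_group n). Q p} = card {p \<in> carrier (alt_group n). Q' p}"
proof (rule bij_betw_same_card)
  let ?A = "carrier (alt_group n)"
  have ic: "inv' \<sigma> \<in> ?A" using \<sigma> by (rule alt_group_inv_closed)
  have "\<sigma> permutes {1..n}" using \<sigma> by (simp add: alt_group_carrier)
  hence "inv' \<sigma> \<circ> \<sigma> = id" "\<sigma> \<circ> inv' \<sigma> = id" using permutes_inv_o by blast+
  hence c: "inv' \<sigma> \<circ> (\<sigma> \<circ> p) = p" "\<sigma> \<circ> (inv' \<sigma> \<circ> p) = p" for p
    by (metis comp_assoc id_comp)+
  show "bij_betw (\<lambda>p. inv' \<sigma> \<circ> p) {p \<in> ?A. Q p} {p \<in> ?A. Q' p}"
  proof (rule bij_betw_byWitness[where f' = "\<lambda>p. \<sigma> \<circ> p"])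
    show "(\<lambda>p. \<sigma> \<circ> p) ` {p \<in> ?A. Q' p} \<subseteq> {p \<in> ?A. Q p}"
      using Q[OF alt_group_comp[OF \<sigma>]] alt_group_comp[OF \<sigma>] by (auto simp only: c)
  qed (use Q alt_group_comp[OF ic] in \<open>auto simp only: c\<close>)
qed

lemma weight_common_A5:
  fixes wt
  defines "wt \<equiv> \<lambda>\<sigma> \<tau>. card {p \<in> carrier (alt_group 5). \<forall>i\<in>{1..5}. \<sigma> i \<noteq> p i \<and> \<tau> i \<noteq> p i}"
  assumes \<sigma>: "\<sigma> \<in> carrier (alt_group 5)" and \<tau>: "\<tau> \<in> carrier (alt_group 5)"
  shows "wt \<sigma> \<tau> = (let d = card (disagree {1..5} \<sigma> \<tau>) in if d = 0 then 24 else if d = 3 then 12 else 8)"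
proof -
  let ?A = "carrier (alt_group 5)"
  have p: "\<sigma> permutes {1..5}" using \<sigma> by (simp add: alt_group_carrier)
  have ic: "inv' \<sigma> \<in> ?A" using \<sigma> by (rule alt_group_inv_closed)
  have inj: "inj (inv' \<sigma>)" using p permutes_inv permutes_inj by blast
  have c: "inv' \<sigma> \<circ> \<sigma> = id" using p permutes_inv_o by blast
  have e: "inv' \<sigma> a = b \<longleftrightarrow> a = \<sigma> b" for a b using p by (metis permutes_inverses)
  have "wt \<sigma> \<tau> = card {p \<in> ?A. \<forall>i\<in>{1..5}. i \<noteq> p i \<and> (inv' \<sigma> \<circ> \<tau>) i \<noteq> p i}"
    unfolding wt_def
    by (rule card_alt_group_shift[OF \<sigma>]) (metis comp_apply e inj inj_eq)
  moreover have "disagree {1..5} id (inv' \<sigma> \<circ> \<tau>) = disagree {1..5} \<sigma> \<tau>"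
    using disagree_comp_left[OF inj, of _ \<sigma> \<tau>] by (simp add: c)
  ultimately show ?thesis
    using card_avoiding_A5[OF alt_group_comp[OF ic \<tau>]] by simp
qed

text \<open>The condition says that \<open>p\<close> agrees with \<open>\<rho>\<close> wherever
  \<open>\<rho>\<close> and \<open>\<sigma>\<close> disagree. Translated by
  \<open>inv' \<rho>\<close>, it says that \<open>p\<close> fixes all those positions and so
  permutes the remaining ones.\<close>

lemma weight_extensions:
  fixes wt n
  defines "wt \<equiv> \<lambda>\<sigma> \<rho>. card {p \<in> carrier (alt_group n). \<forall>i\<in>{1..n}. \<rho> i = \<sigma> i \<or> \<rho> i = p i}"
  assumes \<sigma>: "\<sigma> \<in> carrier (alt_group n)" and \<rho>: "\<rho> \<in> carrier (alt_group n)"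
  defines "D \<equiv> {1..n} - disagree {1..n} \<sigma> \<rho>"
  shows "wt \<sigma> \<rho> = card {p. p permutes D \<and> evenperm p}"
proof -
  let ?A = "carrier (alt_group n)"
  have p: "\<rho> permutes {1..n}" using \<rho> by (simp add: alt_group_carrier)
  have sub: "D \<subseteq> {1..n}" by (auto simp: D_def)
  have 1: "{p. p permutes D \<and> evenperm p} = {p \<in> ?A. \<forall>i\<in>{1..n}. i \<notin> D \<longrightarrow> p i = i}"
    using permutes_subset[OF _ sub] permutes_superset[of _ "{1..n}" D]
    by (auto simp: alt_group_carrier permutes_not_in)
  show ?thesis
    unfolding wt_def 1
  proof (rule card_alt_group_shift[OF \<rho>])
    fix r
    have "inv' \<rho> (r i) = i \<longleftrightarrow> \<rho> i = r i" for i using p by (metis permutes_inverses)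
    thus "(\<forall>i\<in>{1..n}. \<rho> i = \<sigma> i \<or> \<rho> i = r i) \<longleftrightarrow>
        (\<forall>i\<in>{1..n}. i \<notin> D \<longrightarrow> (inv' \<rho> \<circ> r) i = i)"
      by (auto simp: D_def disagree_def)
  qed
qed

lemma card_Collect_bij:
  assumes f: "bij_betw f V V" and P: "\<And>z. z \<in> V \<Longrightarrow> P z \<longleftrightarrow> P' (f z)"
  shows "card {z \<in> V. P' z} = card {z \<in> V. P z}"
proof -
  have "f ` {z \<in> V. P z} = {z \<in> V. P' z}"
  proof (intro equalityI subsetI)
    fix v assume "v \<in> f ` {z \<in> V. P z}"
    thus "v \<in> {z \<in> V. P' z}" using f P by (auto simp: bij_betw_def)
  next
    fix v assume v: "v \<in> {z \<in> V. P' z}"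
    then obtain z where "z \<in> V" "v = f z" using f by (auto simp: bij_betw_def)
    thus "v \<in> f ` {z \<in> V. P z}" using P v by blast
  qed
  moreover have "inj_on f {z \<in> V. P z}"
    using f by (auto simp: bij_betw_def intro: inj_on_subset)
  ultimately show ?thesis by (metis card_image)
qed

lemma graph_aut_tri_adjacent_iff_5:
  assumes q: "q \<ge> 1" and f: "bij_betw f (carrier (alt_power 5 q)) (carrier (alt_power 5 q))"
    and adj: "\<And>x y. \<lbrakk>x \<in> carrier (alt_power 5 q); y \<in> carrier (alt_power 5 q)\<rbrakk> \<Longrightarrow>
        adjacent 5 q (f x) (f y) = adjacent 5 q x y"
    and x: "x \<in> carrier (alt_power 5 q)" and y: "y \<in> carrier (alt_power 5 q)"
  shows "tri_adjacent 5 q (f x) (f y) \<longleftrightarrow> tri_adjacent 5 q x y"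
proof -
  let ?V = "carrier (alt_power 5 q)" and ?A = "carrier (alt_group 5)"
  define wt where "wt \<sigma> \<tau> = card {p \<in> ?A. \<forall>i\<in>{1..5}. \<sigma> i \<noteq> p i \<and> \<tau> i \<noteq> p i}"
    for \<sigma> \<tau> :: "nat \<Rightarrow> nat"
  have w: "wt \<sigma> \<tau> = (if card (disagree {1..5} \<sigma> \<tau>) = 0 then 24 else if card (disagree {1..5} \<sigma> \<tau>) = 3 then 12 else 8)"
    if "\<sigma> \<in> ?A" "\<tau> \<in> ?A" for \<sigma> \<tau>
    using weight_common_A5[OF that] unfolding wt_def Let_def .
  define Co where "Co x y = {w \<in> ?V. adjacent 5 q x w \<and> adjacent 5 q y w}" for x y
  have card: "card (Co x y) = 24 ^ (q - 1) * 12 \<longleftrightarrow> tri_adjacent 5 q x y"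
    if x: "x \<in> ?V" and y: "y \<in> ?V" for x y
  proof -
    have "Co x y = (\<Pi>\<^sub>E k\<in>{1..q}. {p \<in> ?A. \<forall>i\<in>{1..5}. x k i \<noteq> p i \<and> y k i \<noteq> p i})"
      by (auto simp: Co_def adjacent_def carrier_alt_power PiE_iff extensional_def)
    hence "card (Co x y) = (\<Prod>k\<in>{1..q}. wt (x k) (y k))"
      by (simp add: card_PiE wt_def)
    moreover have "(\<Prod>k\<in>{1..q}. wt (x k) (y k)) = 24 ^ (q - 1) * 12 \<longleftrightarrow> tri_adjacent 5 q x y"
      by (rule prod_weight_eq_iff_tri_adjacent[OF q _ _ _ _ _ x y])
        (simp_all add: w)
    ultimately show ?thesis by simp
  qed
  have fV: "f ` ?V = ?V" using f by (simp add: bij_betw_def)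
  hence fx: "f x \<in> ?V" if "x \<in> ?V" for x using that by blast
  have "card (Co (f x) (f y)) = card (Co x y)"
    unfolding Co_def by (rule card_Collect_bij[OF f]) (use adj x y in simp)
  thus ?thesis using card[OF x y] card[OF fx[OF x] fx[OF y]] by simp
qed

lemma graph_aut_tri_adjacent_iff_ge_6:
  assumes q: "q \<ge> 1" and n: "n \<ge> 6" and f: "bij_betw f (carrier (alt_power n q)) (carrier (alt_power n q))"
    and adj: "\<And>x y. \<lbrakk>x \<in> carrier (alt_power n q); y \<in> carrier (alt_power n q)\<rbrakk> \<Longrightarrow>
        adjacent n q (f x) (f y) = adjacent n q x y"
    and x: "x \<in> carrier (alt_power n q)" and y: "y \<in> carrier (alt_power n q)"
  shows "tri_adjacent n q (f x) (f y) \<longleftrightarrow> tri_adjacent n q x y"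
proof -
  let ?V = "carrier (alt_power n q)" and ?A = "carrier (alt_group n)"
  define wt where "wt \<sigma> \<rho> = card {p \<in> ?A. \<forall>i\<in>{1..n}. \<rho> i = \<sigma> i \<or> \<rho> i = p i}"
    for \<sigma> \<rho> :: "nat \<Rightarrow> nat"
  \<comment> \<open>By the existence lemma, \<open>z \<in> U x y\<close> iff every value of \<open>y\<close> is a value of \<open>x\<close> or of \<open>z\<close>
    at the same place, so \<open>card (U x y)\<close> only depends on the Hamming distances of the coordinates.\<close>
  define U where "U x y = {z \<in> ?V. \<forall>w\<in>?V. adjacent n q x w \<longrightarrow> adjacent n q z w \<longrightarrow> adjacent n q y w}" for x y
  define E where "E D = card {p::nat\<Rightarrow>nat. p permutes D \<and> evenperm p}" for D
  have E2: "2 * E D = fact (card D)" if "finite D" "card D \<ge> 2" for D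
    unfolding E_def by (rule card_even_permutations[OF that])
  have E1: "E D = 1" if "finite D" "card D \<le> 1" for D
    unfolding E_def by (rule card_even_permutations_small[OF that])
  have wt: "wt \<sigma> \<rho> = E ({1..n} - disagree {1..n} \<sigma> \<rho>)" if "\<sigma> \<in> ?A" "\<rho> \<in> ?A" for \<sigma> \<rho>
    using weight_extensions[OF that] by (simp add: wt_def E_def)
  have cd: "card ({1..n} - disagree {1..n} \<sigma> \<rho>) = n - card (disagree {1..n} \<sigma> \<rho>)" for \<sigma> \<rho>
    by (subst card_Diff_subset) (auto simp: disagree_def)
  \<comment> \<open>Gives \<open>fact (n - 3) div 2 \<ge> 3\<close>, so the weight 1 that arises
    when at most one position of agreement is left stays strictly below it.\<close>
  have n3: "fact (n - 3) \<ge> (6::nat)"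
    using fact_mono_nat[of 3 "n - 3"] n by (simp add: eval_nat_numeral)
  \<comment> \<open>The bound on \<open>m'\<close> rules out \<open>fact 0 = fact 1\<close>.\<close>
  have fm: "fact m < (fact m' :: nat)" if "m < m'" "m' \<ge> 2" for m m' :: nat
    using that fact_less_mono_nat[of m m'] by (cases m) (auto intro: less_le_trans[OF _ fact_ge_self])
  have card: "card (U x y) = E {1..n} ^ (q - 1) * (fact (n - 3) div 2) \<longleftrightarrow> tri_adjacent n q x y"
    if x: "x \<in> ?V" and y: "y \<in> ?V" for x y
  proof -
    have xp: "x k permutes {1..n}" if "k \<in> {1..q}" for k
      using alt_power_component[OF x that] by (simp add: alt_group_carrier)
    have yp: "y k permutes {1..n}" if "k \<in> {1..q}" for k
      using alt_power_component[OF y that] by (simp add: alt_group_carrier)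
    have "U x y = (\<Pi>\<^sub>E k\<in>{1..q}. {p \<in> ?A. \<forall>i\<in>{1..n}. y k i = x k i \<or> y k i = p i})"
    proof (intro equalityI subsetI)
      fix z assume z: "z \<in> U x y"
      hence zV: "z \<in> ?V" by (simp add: U_def)
      have zp: "z k permutes {1..n}" if "k \<in> {1..q}" for k
        using alt_power_component[OF zV that] by (simp add: alt_group_carrier)
      have "y k i = x k i \<or> y k i = z k i" if k: "k \<in> {1..q}" and i: "i \<in> {1..n}" for k i
      proof (rule ccontr)
        assume *: "\<not> ?thesis"
        \<comment> \<open>A witness \<open>w\<close> against \<open>z\<close> is assembled
          coordinate by coordinate: in coordinate \<open>k\<close> it takes at \<open>i\<close> the
          value of \<open>y\<close>, which both \<open>x\<close> and \<open>z\<close> miss there; in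
          the other coordinates any value missed by both will do.\<close>
        have "\<exists>p. p \<in> ?A \<and> (\<forall>i\<in>{1..n}. x j i \<noteq> p i \<and> z j i \<noteq> p i) \<and> (j = k \<longrightarrow> p i = y k i)"
          if j: "j \<in> {1..q}" for j
        proof -
          have "\<exists>b. b \<in> {1..n} \<and> b \<noteq> x j i \<and> b \<noteq> z j i \<and> (j = k \<longrightarrow> b = y k i)"
          proof (cases "j = k")
            case True
            thus ?thesis using * permutes_in_image[OF yp[OF k]] i by auto
          next
            case False
            have "card {x j i, z j i} < card {1..n}"
              using n card_insert_le_Suc[of "x j i" "{z j i}"] by simp
            then obtain b where "b \<in> {1..n}" "b \<notin> {x j i, z j i}"
              by (metis card_mono finite.emptyI finite.insertI linorder_not_less subsetI)
            thus ?thesis using False by auto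
          qed
          then obtain b where b: "b \<in> {1..n}" "b \<noteq> x j i" "b \<noteq> z j i" "j = k \<longrightarrow> b = y k i" by blast
          obtain p where p: "p permutes {1..n}" "evenperm p" "p i = b"
            "\<And>i. i \<in> {1..n} \<Longrightarrow> p i \<noteq> x j i \<and> p i \<noteq> z j i"
            using exists_even_permutation_avoiding[OF _ _ xp[OF j] zp[OF j] i b(1-3)] n by auto
          have "p \<in> ?A" using p by (simp add: alt_group_carrier)
          moreover have "\<forall>i\<in>{1..n}. x j i \<noteq> p i \<and> z j i \<noteq> p i" using p(4) by metis
          ultimately show ?thesis using b(4) p(3) by blast
        qed
        then obtain w where w: "\<And>j. j \<in> {1..q} \<Longrightarrow> w j \<in> ?A \<and> (\<forall>i\<in>{1..n}. x j i \<noteq> w j i \<and> z j i \<noteq> w j i)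
            \<and> (j = k \<longrightarrow> w j i = y k i)" by metis
        let ?w = "restrict w {1..q}"
        have "?w \<in> ?V" using w by (auto simp: carrier_alt_power)
        moreover have "adjacent n q x ?w" "adjacent n q z ?w"
          using w by (auto simp: adjacent_def)
        moreover have "?w k i = y k i" using w[OF k] k by simp
        hence "\<not> adjacent n q y ?w" unfolding adjacent_def using k i by metis
        ultimately show False using z by (auto simp: U_def)
      qed
      thus "z \<in> (\<Pi>\<^sub>E k\<in>{1..q}. {p \<in> ?A. \<forall>i\<in>{1..n}. y k i = x k i \<or> y k i = p i})"
        using zV by (auto simp: carrier_alt_power PiE_iff)
    next
      fix z assume z: "z \<in> (\<Pi>\<^sub>E k\<in>{1..q}. {p \<in> ?A. \<forall>i\<in>{1..n}. y k i = x k i \<or> y k i = p i})"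
      hence zV: "z \<in> ?V" and e: "\<And>k i. k \<in> {1..q} \<Longrightarrow> i \<in> {1..n} \<Longrightarrow> y k i = x k i \<or> y k i = z k i"
        by (auto simp: carrier_alt_power PiE_iff)
      show "z \<in> U x y" unfolding U_def adjacent_def mem_Collect_eq
      proof (intro conjI ballI impI zV)
        fix w k i
        assume "\<forall>k\<in>{1..q}. \<forall>i\<in>{1..n}. x k i \<noteq> w k i" "\<forall>k\<in>{1..q}. \<forall>i\<in>{1..n}. z k i \<noteq> w k i"
          and k: "k \<in> {1..q}" and i: "i \<in> {1..n}"
        hence "x k i \<noteq> w k i" "z k i \<noteq> w k i" by blast+
        thus "y k i \<noteq> w k i" using e[OF k i] by metis
      qed
    qed
    hence "card (U x y) = (\<Prod>k\<in>{1..q}. wt (x k) (y k))"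
      by (simp add: card_PiE wt_def)
    moreover have "(\<Prod>k\<in>{1..q}. wt (x k) (y k)) = E {1..n} ^ (q - 1) * (fact (n - 3) div 2) \<longleftrightarrow> tri_adjacent n q x y"
    proof (rule prod_weight_eq_iff_tri_adjacent[OF q _ _ _ _ _ x y])
      show "0 < (fact (n - 3) :: nat) div 2" using n3 by linarith
      have "2 * E {1..n} = fact n" using E2[of "{1..n}"] n by simp
      moreover have "fact (n - 3) < (fact n :: nat)" using fm n by simp
      moreover have "even (fact n :: nat)" using n by (simp add: dvd_fact)
      ultimately show "fact (n - 3) div 2 < E {1..n}" by linarith
      fix \<sigma> \<tau> assume s: "\<sigma> \<in> ?A"
      show "wt \<sigma> \<sigma> = E {1..n}" using wt[OF s s] by simp
      assume t: "\<tau> \<in> ?A"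
      { assume "card (disagree {1..n} \<sigma> \<tau>) = 3"
        hence "2 * E ({1..n} - disagree {1..n} \<sigma> \<tau>) = fact (n - 3)"
          using E2[of "{1..n} - disagree {1..n} \<sigma> \<tau>"] n unfolding cd by simp
        thus "wt \<sigma> \<tau> = fact (n - 3) div 2" using wt[OF s t] by linarith }
      { assume d: "card (disagree {1..n} \<sigma> \<tau>) > 3"
        let ?D = "{1..n} - disagree {1..n} \<sigma> \<tau>"
        show "wt \<sigma> \<tau> < fact (n - 3) div 2"
        proof (cases "card ?D \<ge> 2")
          case True
          hence "2 * E ?D = fact (card ?D)" by (intro E2) auto
          moreover have "(fact (card ?D) :: nat) < fact (n - 3)"
            unfolding cd using d n by (intro fm) auto
          ultimately have "2 * E ?D < fact (n - 3)" by simp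
          moreover have "even (fact (n - 3) :: nat)" using n by (simp add: dvd_fact)
          ultimately show ?thesis using wt[OF s t] by presburger
        next
          case False
          hence "E ?D = 1" by (intro E1) auto
          thus ?thesis using wt[OF s t] n3 by linarith
        qed }
    qed
    ultimately show ?thesis by simp
  qed
  have fV: "f ` ?V = ?V" using f by (simp add: bij_betw_def)
  hence fx: "f x \<in> ?V" if "x \<in> ?V" for x using that by blast
  have ball: "(\<forall>w\<in>?V. Q w) \<longleftrightarrow> (\<forall>w\<in>?V. Q (f w))" for Q
  proof -
    have "(\<forall>w\<in>f ` ?V. Q w) \<longleftrightarrow> (\<forall>w\<in>?V. Q (f w))" by blast
    thus ?thesis by (simp only: fV)
  qed
  have "card (U (f x) (f y)) = card (U x y)"
    unfolding U_def
  proof (rule card_Collect_bij[OF f])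
    fix z assume z: "z \<in> ?V"
    have "(\<forall>w\<in>?V. adjacent n q (f x) w \<longrightarrow> adjacent n q (f z) w \<longrightarrow> adjacent n q (f y) w) \<longleftrightarrow>
      (\<forall>w\<in>?V. adjacent n q (f x) (f w) \<longrightarrow> adjacent n q (f z) (f w) \<longrightarrow> adjacent n q (f y) (f w))"
      by (rule ball)
    also have "\<dots> \<longleftrightarrow> (\<forall>w\<in>?V. adjacent n q x w \<longrightarrow> adjacent n q z w \<longrightarrow> adjacent n q y w)"
      using adj x y z by simp
    finally show "(\<forall>w\<in>?V. adjacent n q x w \<longrightarrow> adjacent n q z w \<longrightarrow> adjacent n q y w) \<longleftrightarrow>
      (\<forall>w\<in>?V. adjacent n q (f x) w \<longrightarrow> adjacent n q (f z) w \<longrightarrow> adjacent n q (f y) w)" by simp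
  qed
  thus ?thesis using card[OF x y] card[OF fx[OF x] fx[OF y]] by simp
qed

lemma graph_aut_tri_adjacent_iff:
  assumes "q \<ge> 1" "n \<ge> 5" "bij_betw f (carrier (alt_power n q)) (carrier (alt_power n q))"
    and "\<And>x y. \<lbrakk>x \<in> carrier (alt_power n q); y \<in> carrier (alt_power n q)\<rbrakk> \<Longrightarrow>
        adjacent n q (f x) (f y) = adjacent n q x y"
    and "x \<in> carrier (alt_power n q)" "y \<in> carrier (alt_power n q)"
  shows "tri_adjacent n q (f x) (f y) \<longleftrightarrow> tri_adjacent n q x y"
proof (cases "n = 5")
  case True
  show ?thesis
    using graph_aut_tri_adjacent_iff_5[OF assms(1) assms(3,4)[unfolded True] assms(5,6)[unfolded True]]
    unfolding True .
next
  case False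
  hence "n \<ge> 6" using assms(2) by simp
  thus ?thesis using graph_aut_tri_adjacent_iff_ge_6 assms by blast
qed

subsection \<open>Three-cycles and arcs\<close>


text \<open>Counting moved points matches \<open>tri_adjacent\<close> directly; cycle notation is
  supplied by \<open>tricycle_cases\<close>.\<close>

definition tricycles :: "'a set \<Rightarrow> ('a \<Rightarrow> 'a) set" where
  "tricycles \<Omega> = {c. c permutes \<Omega> \<and> card (disagree \<Omega> id c) = 3}"

definition cyc3 :: "'a \<Rightarrow> 'a \<Rightarrow> 'a \<Rightarrow> 'a \<Rightarrow> 'a" where
  "cyc3 a b x = id(a := b, b := x, x := a)"

text \<open>The point \<open>a\<close> cannot lie in a two-cycle, since the third moved point would
  then have to go to a fourth one. Cycle notation can thus be opened at any moved point.\<close>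

lemma tricycle_cases:
  assumes c: "c \<in> tricycles \<Omega>" and a: "c a \<noteq> a"
  obtains x where "distinct [a, c a, x]" "a \<in> \<Omega>" "c a \<in> \<Omega>" "x \<in> \<Omega>" "c = cyc3 a (c a) x"
proof -
  let ?M = "disagree \<Omega> id c"
  have p: "c permutes \<Omega>" and M3: "card ?M = 3" using c by (auto simp: tricycles_def)
  have inj: "c u = c v \<longleftrightarrow> u = v" for u v using permutes_inj[OF p] by (simp add: inj_eq)
  have M: "z \<in> ?M \<longleftrightarrow> c z \<noteq> z" for z
    using permutes_not_in[OF p] by (auto simp: disagree_def)
  have fin: "finite ?M" using M3 by (metis card.infinite zero_neq_numeral)
  define b x where "b = c a" and "x = c b"
  have bM: "c b \<noteq> b" "b \<noteq> a" using a by (auto simp: b_def inj)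
  have xa: "x \<noteq> a"
  proof
    assume xa: "x = a"
    have "card {a, b} = 2" using bM by auto
    hence "\<not> ?M \<subseteq> {a, b}" using M3 card_mono[of "{a, b}" ?M] by auto
    then obtain y where y: "y \<in> ?M" "y \<noteq> a" "y \<noteq> b" by blast
    have cy: "c y \<noteq> y" "c (c y) \<noteq> c y" "c y \<noteq> a" "c y \<noteq> b"
      using y M xa by (auto simp: b_def x_def inj)
    have "card {a, b, y, c y} = 4" using bM y cy by auto
    moreover have "{a, b, y, c y} \<subseteq> ?M" using a bM y cy M by auto
    hence "card {a, b, y, c y} \<le> card ?M" by (rule card_mono[OF fin])
    ultimately show False using M3 by simp
  qed
  have d: "distinct [a, b, x]" using bM xa by (auto simp: x_def)
  have xM: "c x \<noteq> x" using bM by (simp add: x_def inj)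
  have Meq: "{a, b, x} = ?M"
    by (rule card_seteq[OF fin]) (use M a bM xM M3 d in auto)
  have "c (c x) \<noteq> c x" using xM inj by simp
  hence "c x \<in> {a, b, x}" using Meq M by simp
  moreover have "c x \<noteq> b" using xa inj by (simp add: b_def)
  ultimately have cx: "c x = a" using xM by auto
  have "c = cyc3 a b x"
  proof
    fix z show "c z = cyc3 a b x z"
    proof (cases "z \<in> {a, b, x}")
      case True
      thus ?thesis using d cx by (auto simp: cyc3_def b_def x_def)
    next
      case False
      hence "c z = z" using Meq M by blast
      thus ?thesis using False by (simp add: cyc3_def)
    qed
  qed
  moreover have "a \<in> \<Omega>" "b \<in> \<Omega>" "x \<in> \<Omega>" using Meq by (auto simp: disagree_def)
  ultimately show thesis using that[of x] d by (simp add: b_def)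
qed

lemma cyc3_simps [simp]:
  assumes "distinct [a, b, x]"
  shows "cyc3 a b x a = b" "cyc3 a b x b = x" "cyc3 a b x x = a"
    "\<And>z. z \<noteq> a \<Longrightarrow> z \<noteq> b \<Longrightarrow> z \<noteq> x \<Longrightarrow> cyc3 a b x z = z"
  using assms by (auto simp: cyc3_def)

lemma cyc3_rotate: "distinct [a, b, x] \<Longrightarrow> cyc3 b x a = cyc3 a b x"
  by (auto simp: cyc3_def fun_eq_iff)

lemma cyc3_eq_transpose: "distinct [a, b, x] \<Longrightarrow> cyc3 a b x = transpose a b \<circ> transpose b x"
  by (auto simp: cyc3_def fun_eq_iff transpose_def)

lemma inv_cyc3: "distinct [a, b, x] \<Longrightarrow> inv' (cyc3 a b x) = cyc3 x b a"
  by (rule inv_equality) (auto simp: cyc3_def)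

lemma cyc3_in_tricycles:
  assumes "distinct [a, b, x]" "a \<in> \<Omega>" "b \<in> \<Omega>" "x \<in> \<Omega>"
  shows "cyc3 a b x \<in> tricycles \<Omega>"
proof -
  have "cyc3 a b x permutes \<Omega>"
    using assms by (simp add: cyc3_eq_transpose permutes_compose permutes_swap_id)
  moreover have "disagree \<Omega> id (cyc3 a b x) = {a, b, x}"
    using assms by (auto simp: disagree_def cyc3_def)
  hence "card (disagree \<Omega> id (cyc3 a b x)) = 3" using assms by simp
  ultimately show ?thesis by (simp add: tricycles_def)
qed

lemma tricycle_eq_cyc3:
  assumes "c \<in> tricycles \<Omega>" "distinct [a, b, x]" "c a = b" "c b = x"
  shows "c = cyc3 a b x"
proof -
  have "c a \<noteq> a" using assms by auto
  from tricycle_cases[OF assms(1) this] obtain y where y: "distinct [a, b, y]" "c = cyc3 a b y"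
    using assms(3) by metis
  hence "y = x" using assms(4) by simp
  thus ?thesis using y by simp
qed

lemma tricycle_eq_cyc3':
  assumes "c \<in> tricycles \<Omega>" "c a = b" "a \<noteq> b"
  obtains x where "distinct [a, b, x]" "x \<in> \<Omega>" "a \<in> \<Omega>" "b \<in> \<Omega>" "c = cyc3 a b x"
  using tricycle_cases[OF assms(1), of a] assms(2,3) by metis

lemma inv_in_tricycles:
  assumes "c \<in> tricycles \<Omega>" shows "inv' c \<in> tricycles \<Omega>"
proof -
  have p: "c permutes \<Omega>" using assms by (simp add: tricycles_def)
  have "disagree \<Omega> id (inv' c) = disagree \<Omega> id c"
    unfolding disagree_def id_def using permutes_inverses[OF p] by (intro Collect_cong) metis
  thus ?thesis using assms permutes_inv[OF p] by (simp add: tricycles_def)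
qed

section \<open>Arcs shared by two three-cycles\<close>

definition share_arc :: "('a \<Rightarrow> 'a) \<Rightarrow> ('a \<Rightarrow> 'a) \<Rightarrow> bool" where
  "share_arc c d \<longleftrightarrow> (\<exists>a. c a = d a \<and> c a \<noteq> a)"

text \<open>\<open>cyc3 a b x\<close> and \<open>cyc3 a b y\<close> disagree exactly at
  \<open>b\<close>, \<open>x\<close> and \<open>y\<close>.\<close>

lemma card_disagree_share_arc:
  assumes c: "c \<in> tricycles \<Omega>" and d: "d \<in> tricycles \<Omega>" and "c \<noteq> d" and s: "share_arc c d"
  shows "card (disagree \<Omega> c d) = 3"
proof -
  obtain a where a: "c a = d a" "c a \<noteq> a" using s by (auto simp: share_arc_def)
  obtain x where x: "distinct [a, c a, x]" "c = cyc3 a (c a) x" "x \<in> \<Omega>" "c a \<in> \<Omega>"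
    using tricycle_cases[OF c a(2)] by metis
  obtain y where y: "distinct [a, c a, y]" "d = cyc3 a (c a) y" "y \<in> \<Omega>"
    using tricycle_cases[OF d, of a] a by metis
  have xy: "x \<noteq> y" using x y \<open>c \<noteq> d\<close> by metis
  have "disagree \<Omega> (cyc3 a (c a) x) (cyc3 a (c a) y) = {c a, x, y}"
    using x(1,3,4) y(1,3) xy by (auto simp: disagree_def cyc3_def)
  hence "disagree \<Omega> c d = {c a, x, y}" using x(2) y(2) by metis
  thus ?thesis using x(1) y(1) xy by simp
qed

text \<open>Without a shared arc the disagreement set is the union of the two supports. It has three
  elements only if the supports coincide, and the two three-cycles on one support are inverse to
  each other.\<close>

lemma card_disagree_not_share_arc:
  assumes c: "c \<in> tricycles \<Omega>" and d: "d \<in> tricycles \<Omega>" and s: "\<not> share_arc c d"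
  shows "card (disagree \<Omega> c d) = 3 \<longleftrightarrow> d = inv' c"
proof -
  have p: "c permutes \<Omega>" "d permutes \<Omega>" and cc: "card (disagree \<Omega> id c) = 3" "card (disagree \<Omega> id d) = 3"
    using c d by (auto simp: tricycles_def)
  have fin: "finite (disagree \<Omega> id c)" "finite (disagree \<Omega> id d)"
    using cc by (metis card.infinite zero_neq_numeral)+
  have eq: "disagree \<Omega> c d = disagree \<Omega> id c \<union> disagree \<Omega> id d"
    using s by (auto simp: disagree_def share_arc_def)
  have M: "z \<in> disagree \<Omega> id c \<longleftrightarrow> c z \<noteq> z" "z \<in> disagree \<Omega> id d \<longleftrightarrow> d z \<noteq> z" for z
    using permutes_not_in p by (fastforce simp: disagree_def)+
  show ?thesis
  proof
    assume 3: "card (disagree \<Omega> c d) = 3"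
    have "disagree \<Omega> id c = disagree \<Omega> c d" "disagree \<Omega> id d = disagree \<Omega> c d"
      by (rule card_seteq; use eq fin cc 3 in auto)+
    hence same: "c z = z \<longleftrightarrow> d z = z" for z using M by metis
    have "disagree \<Omega> id c \<noteq> {}" using cc by auto
    then obtain a where a: "c a \<noteq> a" using M by blast
    obtain x where x: "distinct [a, c a, x]" "c = cyc3 a (c a) x" by (rule tricycle_cases[OF c a])
    define b where "b = c a"
    have cv: "c = cyc3 a b x" "distinct [a, b, x]" using x by (auto simp: b_def)
    have "d a \<noteq> a" using same a by blast
    moreover have "d a \<noteq> b" using s a by (metis share_arc_def b_def)
    moreover have "d (d a) \<noteq> d a" using \<open>d a \<noteq> a\<close> p(2) by (metis permutes_inj inj_eq)
    hence "c (d a) \<noteq> d a" using same by blast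
    hence "d a \<in> {a, b, x}" using cv by (metis cyc3_simps(4) insertCI)
    ultimately have da: "d a = x" by blast
    obtain y where y: "distinct [a, x, y]" "d = cyc3 a x y"
      using tricycle_cases[OF d \<open>d a \<noteq> a\<close>] da by metis
    have "d y \<noteq> y" using y by auto
    hence "c y \<noteq> y" using same by blast
    hence "y \<in> {a, b, x}" using cv by (metis cyc3_simps(4) insertCI)
    hence "y = b" using y by auto
    hence "d = cyc3 a x b" using y by simp
    also have "\<dots> = inv' c" using cv inv_cyc3 cyc3_rotate
      by (metis distinct_length_2_or_more distinct_singleton)
    finally show "d = inv' c" .
  next
    assume "d = inv' c"
    hence "d z \<noteq> z \<longleftrightarrow> c z \<noteq> z" for z using permutes_inverses[OF p(1)] by metis
    hence "disagree \<Omega> id d = disagree \<Omega> id c" using M by blast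
    thus "card (disagree \<Omega> c d) = 3" using eq cc by simp
  qed
qed

lemma not_share_arc_inv:
  assumes c: "c \<in> tricycles \<Omega>" shows "\<not> share_arc c (inv' c)"
proof
  have p: "c permutes \<Omega>" using c by (simp add: tricycles_def)
  assume "share_arc c (inv' c)"
  then obtain a where a: "c a = inv' c a" "c a \<noteq> a" by (auto simp: share_arc_def)
  hence "c (c a) = a" using permutes_inverses[OF p] by metis
  moreover obtain x where x: "distinct [a, c a, x]" "c = cyc3 a (c a) x" by (rule tricycle_cases[OF c a(2)])
  hence "c (c a) = x" by (metis cyc3_simps(2))
  ultimately show False using x by simp
qed

text \<open>Absence of triangles. If \<open>e\<close> missed the arc from \<open>a\<close> to
  \<open>b\<close>, it would share \<open>b \<mapsto> x\<close> or \<open>x \<mapsto> a\<close> with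
  \<open>c\<close>, and \<open>b \<mapsto> y\<close> or \<open>y \<mapsto> a\<close> with
  \<open>d\<close>. By injectivity one arc leaves \<open>b\<close> and one enters \<open>a\<close>,
  through different points; but a three-cycle sends its third point back to \<open>b\<close>, not to
  \<open>a\<close>.\<close>

lemma share_arc_triangle:
  assumes c: "c \<in> tricycles \<Omega>" and d: "d \<in> tricycles \<Omega>" and e: "e \<in> tricycles \<Omega>"
    and neq: "c \<noteq> d" and a: "c a = b" "d a = b" "a \<noteq> b"
    and s: "share_arc c e" "share_arc d e"
  shows "e a = b"
proof (rule ccontr)
  assume ea: "e a \<noteq> b"
  obtain x where x: "distinct [a, b, x]" "c = cyc3 a b x" using tricycle_eq_cyc3'[OF c a(1,3)] by metis
  obtain y where y: "distinct [a, b, y]" "d = cyc3 a b y" using tricycle_eq_cyc3'[OF d a(2,3)] by metis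
  have xy: "x \<noteq> y" using x y neq by metis
  have "e b = x \<or> e x = a"
    using s(1) ea x unfolding share_arc_def by (metis cyc3_simps)
  moreover have "e b = y \<or> e y = a"
    using s(2) ea y unfolding share_arc_def by (metis cyc3_simps)
  moreover have False if h: "e b = u" "e v = a" "distinct [a, b, u]" "distinct [a, b, v]" "u \<noteq> v" for u v
  proof -
    obtain z where z: "distinct [b, u, z]" "e = cyc3 b u z"
      using tricycle_eq_cyc3'[OF e h(1)] h(3) by (metis distinct_length_2_or_more)
    have "e v \<noteq> v" using h by auto
    hence "v = z" using z h by (metis cyc3_simps(4) distinct_length_2_or_more)
    thus False using z h by auto
  qed
  moreover have "inj e" using e permutes_inj by (auto simp: tricycles_def)
  ultimately show False using x(1) y(1) xy by (metis inj_eq)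
qed

text \<open>Two of its arcs determine a three-cycle; in the geometry below this says that two points
  lie on at most one line.\<close>

lemma two_shared_arcs_eq:
  assumes c: "c \<in> tricycles \<Omega>" and d: "d \<in> tricycles \<Omega>"
    and a: "c a = d a" "c a \<noteq> a" and b: "c b = d b" "c b \<noteq> b" and "a \<noteq> b"
  shows "c = d"
proof -
  obtain x where x: "distinct [a, c a, x]" "c = cyc3 a (c a) x" by (rule tricycle_cases[OF c a(2)])
  obtain y where y: "distinct [a, c a, y]" "d = cyc3 a (c a) y"
    using tricycle_cases[OF d, of a] a by metis
  have "b = c a \<or> b = x" using x b \<open>a \<noteq> b\<close> by (metis cyc3_simps(4))
  moreover have "b = c a \<or> b = y" using y b \<open>a \<noteq> b\<close> by (metis cyc3_simps(4))
  ultimately have "x = y" using x y b by (metis cyc3_simps(2))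
  thus ?thesis using x y by metis
qed

text \<open>Lines are recovered from collinearity alone because pairwise collinear points lie on one line.\<close>

lemma collineation_lines:
  assumes \<phi>: "bij_betw \<phi> P P"
    and sub: "\<And>L. L \<in> \<L> \<Longrightarrow> L \<subseteq> P"
    and two: "\<And>L. L \<in> \<L> \<Longrightarrow> \<exists>u\<in>L. \<exists>v\<in>L. u \<noteq> v"
    and tri: "\<And>u v w L L' L''. \<lbrakk>u \<noteq> v; v \<noteq> w; u \<noteq> w; L \<in> \<L>; u \<in> L; v \<in> L; L' \<in> \<L>; v \<in> L'; w \<in> L';
        L'' \<in> \<L>; u \<in> L''; w \<in> L''\<rbrakk> \<Longrightarrow> w \<in> L"
    and col: "\<And>u v. \<lbrakk>u \<in> P; v \<in> P; u \<noteq> v\<rbrakk> \<Longrightarrow> (\<exists>L\<in>\<L>. \<phi> u \<in> L \<and> \<phi> v \<in> L) \<longleftrightarrow> (\<exists>L\<in>\<L>. u \<in> L \<and> v \<in> L)"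
  shows "L \<in> \<L> \<Longrightarrow> \<phi> ` L \<in> \<L>" and "L' \<in> \<L> \<Longrightarrow> \<exists>L\<in>\<L>. \<phi> ` L = L'"
proof -
  have inj: "\<phi> u = \<phi> v \<longleftrightarrow> u = v" if "u \<in> P" "v \<in> P" for u v
    using \<phi> that by (auto simp: bij_betw_def inj_on_def)
  have surj: "\<exists>w\<in>P. z = \<phi> w" if "z \<in> P" for z
    using \<phi> that by (auto simp: bij_betw_def)
  \<comment> \<open>A third point \<open>w\<close> of \<open>L\<close> is collinear with
    \<open>u\<close> and \<open>v\<close>, hence its image is collinear with both images, and
    without triangles it must lie on \<open>L'\<close>. The other inclusion runs the same argument
    through the inverse of \<open>\<phi>\<close>.\<close>
  have key: "\<phi> ` L = L'"
    if L: "L \<in> \<L>" and L': "L' \<in> \<L>" and uv: "u \<in> L" "v \<in> L" "u \<noteq> v" "\<phi> u \<in> L'" "\<phi> v \<in> L'" for L L' u v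
  proof (intro equalityI subsetI)
    have P: "u \<in> P" "v \<in> P" using uv sub[OF L] by auto
    have ne: "\<phi> u \<noteq> \<phi> v" using inj[OF P] uv by simp
    { fix z assume "z \<in> \<phi> ` L"
      then obtain w where w: "w \<in> L" "z = \<phi> w" by blast
      have wP: "w \<in> P" using w sub[OF L] by auto
      show "z \<in> L'"
      proof (cases "w = u \<or> w = v")
        case True thus ?thesis using w uv by auto
      next
        case False
        obtain L1 where "L1 \<in> \<L>" "\<phi> v \<in> L1" "\<phi> w \<in> L1"
          using col[OF P(2) wP] False L uv w by blast
        moreover obtain L2 where "L2 \<in> \<L>" "\<phi> u \<in> L2" "\<phi> w \<in> L2"
          using col[OF P(1) wP] False L uv w by blast
        ultimately show ?thesis
          using tri[OF ne _ _ L' uv(4,5)] inj P wP False w by metis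
      qed }
    { fix z assume z: "z \<in> L'"
      then obtain w where w: "w \<in> P" "z = \<phi> w" using surj sub[OF L'] by blast
      have "w \<in> L"
      proof (cases "w = u \<or> w = v")
        case True thus ?thesis using uv by auto
      next
        case False
        obtain L1 where "L1 \<in> \<L>" "v \<in> L1" "w \<in> L1"
          using col[OF P(2) w(1)] False L' uv w z by blast
        moreover obtain L2 where "L2 \<in> \<L>" "u \<in> L2" "w \<in> L2"
          using col[OF P(1) w(1)] False L' uv w z by blast
        ultimately show ?thesis
          using tri[OF uv(3) _ _ L uv(1,2)] False by metis
      qed
      thus "z \<in> \<phi> ` L" using w by blast }
  qed
  show "\<phi> ` L \<in> \<L>" if L: "L \<in> \<L>" for L
  proof -
    obtain u v where uv: "u \<in> L" "v \<in> L" "u \<noteq> v" using two[OF L] by blast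
    then obtain L' where L': "L' \<in> \<L>" "\<phi> u \<in> L'" "\<phi> v \<in> L'" using col[of u v] sub[OF L] L by blast
    show ?thesis using key[OF L L'(1) uv L'(2,3)] L' by simp
  qed
  show "\<exists>L\<in>\<L>. \<phi> ` L = L'" if L': "L' \<in> \<L>" for L'
  proof -
    obtain u' v' where uv': "u' \<in> L'" "v' \<in> L'" "u' \<noteq> v'" using two[OF L'] by blast
    have "u' \<in> P" "v' \<in> P" using sub[OF L'] uv' by auto
    then obtain u v where uv: "u \<in> P" "u' = \<phi> u" "v \<in> P" "v' = \<phi> v" using surj by meson
    hence "u \<noteq> v" using uv' by auto
    then obtain L where L: "L \<in> \<L>" "u \<in> L" "v \<in> L" using col[of u v] uv uv' L' by blast
    show ?thesis using key[OF L(1) L' L(2,3) \<open>u \<noteq> v\<close>] uv uv' L by blast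
  qed
qed


section \<open>The geometry with three-cycles as points and arcs as lines\<close>

definition arcs :: "'i set \<Rightarrow> 'a set \<Rightarrow> ('i \<times> 'a \<times> 'a) set" where
  "arcs I \<Omega> = {(k, a, b). k \<in> I \<and> a \<in> \<Omega> \<and> b \<in> \<Omega> \<and> a \<noteq> b}"

text \<open>A line of the first geometry. Its points are neighbours of the identity, encoded by
  their nontrivial coordinate and the three-cycle found there.\<close>

definition arc_line :: "'a set \<Rightarrow> 'i \<times> 'a \<times> 'a \<Rightarrow> ('i \<times> ('a \<Rightarrow> 'a)) set" where
  "arc_line \<Omega> = (\<lambda>(k, a, b). {(k, c) | c. c \<in> tricycles \<Omega> \<and> c a = b})"

definition rev_arc :: "'i \<times> 'a \<times> 'a \<Rightarrow> 'i \<times> 'a \<times> 'a" where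
  "rev_arc = (\<lambda>(k, a, b). (k, b, a))"

text \<open>Closeness among the neighbours of the identity: two of them with different nontrivial
  coordinates differ in both and are never close.\<close>

definition tri_rel :: "'a set \<Rightarrow> 'i \<times> ('a \<Rightarrow> 'a) \<Rightarrow> 'i \<times> ('a \<Rightarrow> 'a) \<Rightarrow> bool" where
  "tri_rel \<Omega> u v \<longleftrightarrow> fst u = fst v \<and> card (disagree \<Omega> (snd u) (snd v)) = 3"

lemma rev_arc_in_arcs: "rev_arc \<alpha> \<in> arcs I \<Omega> \<longleftrightarrow> \<alpha> \<in> arcs I \<Omega>"
  by (cases \<alpha>) (auto simp: rev_arc_def arcs_def)

lemma mem_arc_line: "(j, c) \<in> arc_line \<Omega> (k, a, b) \<longleftrightarrow> j = k \<and> c \<in> tricycles \<Omega> \<and> c a = b"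
  by (auto simp: arc_line_def)

lemma share_arcI: "c a = b \<Longrightarrow> d a = b \<Longrightarrow> a \<noteq> b \<Longrightarrow> share_arc c d"
  unfolding share_arc_def by metis

lemma exists_fresh:
  assumes "finite F" "card F < card \<Omega>" obtains x where "x \<in> \<Omega>" "x \<notin> F"
  using assms by (metis card_mono linorder_not_less subsetI)

lemma exists_fresh4:
  assumes "card \<Omega> \<ge> 5" obtains x where "x \<in> \<Omega>" "x \<noteq> a" "x \<noteq> b" "x \<noteq> c" "x \<noteq> d"
proof -
  have "card {a, b, c, d} \<le> 4"
    using card_insert_le_Suc[of a "{b,c,d}"] card_insert_le_Suc[of b "{c,d}"]
      card_insert_le_Suc[of c "{d}"] by simp
  hence "card {a, b, c, d} < card \<Omega>" using assms by simp
  then obtain x where "x \<in> \<Omega>" "x \<notin> {a, b, c, d}" using exists_fresh[of "{a, b, c, d}" \<Omega>] by blast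
  thus thesis using that by blast
qed

lemma arc_line_two:
  assumes "card \<Omega> \<ge> 5" "a \<in> \<Omega>" "b \<in> \<Omega>" "a \<noteq> b"
  obtains c d where "c \<noteq> d" "c \<in> tricycles \<Omega>" "d \<in> tricycles \<Omega>" "c a = b" "d a = b"
proof -
  obtain x where x: "x \<in> \<Omega>" "x \<noteq> a" "x \<noteq> b" by (rule exists_fresh4[OF assms(1)])
  obtain y where y: "y \<in> \<Omega>" "y \<noteq> a" "y \<noteq> b" "y \<noteq> x" by (rule exists_fresh4[OF assms(1)])
  have "cyc3 a b x b \<noteq> cyc3 a b y b" using x y assms by auto
  hence "cyc3 a b x \<noteq> cyc3 a b y" by metis
  moreover have "cyc3 a b x \<in> tricycles \<Omega>" "cyc3 a b y \<in> tricycles \<Omega>"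
    by (intro cyc3_in_tricycles; use x y assms in auto)+
  ultimately show thesis using that[of "cyc3 a b x" "cyc3 a b y"] x y assms by auto
qed

lemma arc_line_inj:
  assumes n: "card \<Omega> \<ge> 5" and "\<alpha> \<in> arcs I \<Omega>" "\<beta> \<in> arcs I \<Omega>" "arc_line \<Omega> \<alpha> = arc_line \<Omega> \<beta>"
  shows "\<alpha> = \<beta>"
proof -
  obtain k a b where \<alpha>: "\<alpha> = (k, a, b)" "k \<in> I" "a \<in> \<Omega>" "b \<in> \<Omega>" "a \<noteq> b" using assms(2) by (auto simp: arcs_def)
  obtain l s t where \<beta>: "\<beta> = (l, s, t)" "s \<noteq> t" using assms(3) by (auto simp: arcs_def)
  obtain c d where cd: "c \<noteq> d" "c \<in> tricycles \<Omega>" "d \<in> tricycles \<Omega>" "c a = b" "d a = b"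
    by (rule arc_line_two[OF n \<alpha>(3-5)])
  hence "(k, c) \<in> arc_line \<Omega> \<alpha>" "(k, d) \<in> arc_line \<Omega> \<alpha>" by (auto simp: \<alpha> mem_arc_line)
  hence "(k, c) \<in> arc_line \<Omega> \<beta>" "(k, d) \<in> arc_line \<Omega> \<beta>" using assms(4) by auto
  hence st: "k = l" "c s = t" "d s = t" by (auto simp: \<beta> mem_arc_line)
  have "a = s" using two_shared_arcs_eq[OF cd(2,3), of a s] cd st \<alpha> \<beta> by metis
  thus ?thesis using cd st \<alpha> \<beta> by simp
qed

lemma collinear_iff_share_arc:
  assumes u: "u \<in> I \<times> tricycles \<Omega>" and v: "v \<in> I \<times> tricycles \<Omega>"
  shows "(\<exists>L\<in>arc_line \<Omega> ` arcs I \<Omega>. u \<in> L \<and> v \<in> L) \<longleftrightarrow> fst u = fst v \<and> share_arc (snd u) (snd v)"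
proof -
  obtain k c where uc: "u = (k, c)" "k \<in> I" "c \<in> tricycles \<Omega>" using u by blast
  obtain l d where vd: "v = (l, d)" "l \<in> I" "d \<in> tricycles \<Omega>" using v by blast
  show ?thesis
  proof
    assume "\<exists>L\<in>arc_line \<Omega> ` arcs I \<Omega>. u \<in> L \<and> v \<in> L"
    then obtain j a b where "(j, a, b) \<in> arcs I \<Omega>" "u \<in> arc_line \<Omega> (j, a, b)" "v \<in> arc_line \<Omega> (j, a, b)"
      by auto
    hence "k = l" "c a = b" "d a = b" "a \<noteq> b" by (auto simp: uc vd mem_arc_line arcs_def)
    thus "fst u = fst v \<and> share_arc (snd u) (snd v)" by (auto simp: uc vd intro: share_arcI)
  next
    assume "fst u = fst v \<and> share_arc (snd u) (snd v)"
    then obtain a where a: "k = l" "c a = d a" "c a \<noteq> a" by (auto simp: uc vd share_arc_def)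
    obtain x where "a \<in> \<Omega>" "c a \<in> \<Omega>" using tricycle_cases[OF uc(3) a(3)] by metis
    hence "(k, a, c a) \<in> arcs I \<Omega>" using uc a by (auto simp: arcs_def)
    moreover have "u \<in> arc_line \<Omega> (k, a, c a)" "v \<in> arc_line \<Omega> (k, a, c a)"
      using uc vd a by (auto simp: mem_arc_line)
    ultimately show "\<exists>L\<in>arc_line \<Omega> ` arcs I \<Omega>. u \<in> L \<and> v \<in> L" by blast
  qed
qed

lemma disagree_sym: "disagree \<Omega> c d = disagree \<Omega> d c"
  by (auto simp: disagree_def)

text \<open>Triangles separate the two kinds of closeness. A three-cycle \<open>e\<close> close to
  both \<open>c\<close> and \<open>inv' c\<close> would share an arc with each. If it contains
  \<open>a \<mapsto> b\<close> from \<open>c = cyc3 a b x\<close>, then it is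
  \<open>cyc3 a b z\<close> with \<open>z \<noteq> x\<close>, and neither of its arcs at
  \<open>a\<close> and \<open>b\<close> belongs to \<open>inv' c\<close>, while \<open>z\<close> is
  fixed by \<open>inv' c\<close>.\<close>

lemma share_arc_iff_tri_rel:
  assumes n: "card \<Omega> \<ge> 5" and u: "u \<in> I \<times> tricycles \<Omega>" and v: "v \<in> I \<times> tricycles \<Omega>" and "u \<noteq> v"
  shows "fst u = fst v \<and> share_arc (snd u) (snd v) \<longleftrightarrow>
    tri_rel \<Omega> u v \<and> (\<exists>w\<in>I \<times> tricycles \<Omega>. tri_rel \<Omega> w u \<and> tri_rel \<Omega> w v)"
proof -
  obtain k c where uc: "u = (k, c)" "k \<in> I" "c \<in> tricycles \<Omega>" using u by blast
  obtain l d where vd: "v = (l, d)" "l \<in> I" "d \<in> tricycles \<Omega>" using v by blast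
  show ?thesis
  proof
    assume "fst u = fst v \<and> share_arc (snd u) (snd v)"
    then obtain a where a: "k = l" "c a = d a" "c a \<noteq> a" and s: "share_arc c d"
      by (auto simp: uc vd share_arc_def)
    have cd: "c \<noteq> d" using \<open>u \<noteq> v\<close> uc vd a by simp
    obtain x where x: "distinct [a, c a, x]" "a \<in> \<Omega>" "c a \<in> \<Omega>" "x \<in> \<Omega>" "c = cyc3 a (c a) x"
      by (rule tricycle_cases[OF uc(3) a(3)])
    \<comment> \<open>The two three-cycles live on at most four points; a fifth one gives a third
      three-cycle through their common arc.\<close>
    obtain z where z: "z \<in> \<Omega>" "z \<noteq> a" "z \<noteq> c a" "z \<noteq> c (c a)" "z \<noteq> d (c a)" by (rule exists_fresh4[OF n])
    let ?e = "cyc3 a (c a) z"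
    have dz: "distinct [a, c a, z]" using z a by auto
    have e: "?e \<in> tricycles \<Omega>" using dz x z by (intro cyc3_in_tricycles) auto
    have ev: "?e a = c a" "?e (c a) = z" using dz by auto
    have "?e \<noteq> c" "?e \<noteq> d" using ev z by metis+
    moreover have "share_arc ?e c" "share_arc ?e d" using share_arcI[of ?e a "c a"] ev a by metis+
    ultimately have "tri_rel \<Omega> (k, ?e) u" "tri_rel \<Omega> (k, ?e) v"
      using card_disagree_share_arc e uc vd a by (auto simp: tri_rel_def)
    moreover have "tri_rel \<Omega> u v"
      using card_disagree_share_arc[OF uc(3) vd(3) cd s] uc vd a by (simp add: tri_rel_def)
    ultimately show "tri_rel \<Omega> u v \<and> (\<exists>w\<in>I \<times> tricycles \<Omega>. tri_rel \<Omega> w u \<and> tri_rel \<Omega> w v)"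
      using e uc by blast
  next
    assume "tri_rel \<Omega> u v \<and> (\<exists>w\<in>I \<times> tricycles \<Omega>. tri_rel \<Omega> w u \<and> tri_rel \<Omega> w v)"
    then obtain e where kl: "k = l" and e: "e \<in> tricycles \<Omega>"
      and cd: "card (disagree \<Omega> c d) = 3" and ec: "card (disagree \<Omega> e c) = 3" and ed: "card (disagree \<Omega> e d) = 3"
      by (auto simp: tri_rel_def uc vd)
    have "share_arc c d"
    proof (rule ccontr)
      assume ns: "\<not> share_arc c d"
      hence d: "d = inv' c" using card_disagree_not_share_arc[OF uc(3) vd(3)] cd by blast
      have pc: "c permutes \<Omega>" using uc by (simp add: tricycles_def)
      have "e \<noteq> d" "e \<noteq> c" using ec ed by auto
      have "inv' d = c" using d pc by (simp add: permutes_inv_inv)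
      hence "share_arc d e"
        using card_disagree_not_share_arc[OF vd(3) e] ed \<open>e \<noteq> c\<close> disagree_sym[of \<Omega> d e] by auto
      then obtain a' where a': "d a' = e a'" "d a' \<noteq> a'" by (auto simp: share_arc_def)
      have "share_arc c e"
        using card_disagree_not_share_arc[OF uc(3) e] ec \<open>e \<noteq> d\<close> d disagree_sym[of \<Omega> c e] by auto
      then obtain a where a: "c a = e a" "c a \<noteq> a" by (auto simp: share_arc_def)
      obtain x where x: "distinct [a, c a, x]" "c = cyc3 a (c a) x" by (rule tricycle_cases[OF uc(3) a(2)])
      obtain z where z: "distinct [a, c a, z]" "e = cyc3 a (c a) z"
        using tricycle_cases[OF e, of a] a by metis
      have dc: "d = cyc3 x (c a) a" using d x inv_cyc3 by metis
      have xz: "x \<noteq> z" using x z \<open>e \<noteq> c\<close> by metis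
      have d3: "distinct [x, c a, a]" using x by auto
      have "a' \<in> {x, c a, a}" using a' dc d3 by (metis cyc3_simps(4) insertCI)
      moreover have "e a' \<noteq> a'" using a' by metis
      hence "a' \<in> {a, c a, z}" using z by (metis cyc3_simps(4) insertCI)
      ultimately have "a' = a \<or> a' = c a" using xz by auto
      moreover have "d a = x" "d (c a) = a" using dc d3 by (metis cyc3_simps)+
      moreover have "e a = c a" "e (c a) = z" using z by (metis cyc3_simps)+
      ultimately show False using a' x z by auto
    qed
    thus "fst u = fst v \<and> share_arc (snd u) (snd v)" using kl uc vd by simp
  qed
qed

text \<open>Sharing an arc is preserved, so lines go to lines and an action \<open>F\<close> on arcs
  results. The remaining kind of closeness is inversion, which is therefore preserved too; since it
  exchanges the line of an arc with that of the reversed arc, \<open>F\<close> commutes with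
  reversal.\<close>

lemma tricycle_aut_arcs:
  fixes \<Omega> :: "'a set" and I :: "'i set"
  assumes n: "card \<Omega> \<ge> 5" and \<phi>: "bij_betw \<phi> (I \<times> tricycles \<Omega>) (I \<times> tricycles \<Omega>)"
    and adj: "\<And>u v. \<lbrakk>u \<in> I \<times> tricycles \<Omega>; v \<in> I \<times> tricycles \<Omega>\<rbrakk> \<Longrightarrow> tri_rel \<Omega> (\<phi> u) (\<phi> v) \<longleftrightarrow> tri_rel \<Omega> u v"
  obtains F where "bij_betw F (arcs I \<Omega>) (arcs I \<Omega>)"
    "\<And>\<alpha>. \<alpha> \<in> arcs I \<Omega> \<Longrightarrow> \<phi> ` arc_line \<Omega> \<alpha> = arc_line \<Omega> (F \<alpha>)"
    "\<And>\<alpha>. \<alpha> \<in> arcs I \<Omega> \<Longrightarrow> F (rev_arc \<alpha>) = rev_arc (F \<alpha>)"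
proof -
  let ?P = "I \<times> tricycles \<Omega>" and ?L = "arc_line \<Omega> ` arcs I \<Omega>"
  have \<phi>P: "\<phi> u \<in> ?P" if "u \<in> ?P" for u using \<phi> that by (metis bij_betwE)
  have surj: "\<exists>u\<in>?P. v = \<phi> u" if "v \<in> ?P" for v using bij_betw_imp_surj_on[OF \<phi>] that by blast
  have inj: "\<phi> u = \<phi> v \<longleftrightarrow> u = v" if "u \<in> ?P" "v \<in> ?P" for u v
    using \<phi> that by (auto simp: bij_betw_def inj_on_def)
  have sh: "fst (\<phi> u) = fst (\<phi> v) \<and> share_arc (snd (\<phi> u)) (snd (\<phi> v)) \<longleftrightarrow> fst u = fst v \<and> share_arc (snd u) (snd v)"
    if u: "u \<in> ?P" and v: "v \<in> ?P" and ne: "u \<noteq> v" for u v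
  proof -
    have "(\<exists>w\<in>?P. tri_rel \<Omega> w (\<phi> u) \<and> tri_rel \<Omega> w (\<phi> v)) \<longleftrightarrow> (\<exists>w\<in>?P. tri_rel \<Omega> w u \<and> tri_rel \<Omega> w v)"
      using adj surj \<phi>P u v by metis
    thus ?thesis
      using share_arc_iff_tri_rel[OF n u v ne] share_arc_iff_tri_rel[OF n \<phi>P[OF u] \<phi>P[OF v]] inj[OF u v] ne adj[OF u v]
      by simp
  qed
  have sub: "L \<subseteq> ?P" if "L \<in> ?L" for L using that by (auto simp: arcs_def arc_line_def)
  have two: "\<exists>u\<in>L. \<exists>v\<in>L. u \<noteq> v" if Lin: "L \<in> ?L" for L
  proof -
    obtain k a b where L: "L = arc_line \<Omega> (k, a, b)" "k \<in> I" "a \<in> \<Omega>" "b \<in> \<Omega>" "a \<noteq> b" using Lin by (auto simp: arcs_def)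
    obtain c d where "c \<noteq> d" "c \<in> tricycles \<Omega>" "d \<in> tricycles \<Omega>" "c a = b" "d a = b"
      by (rule arc_line_two[OF n L(3-5)])
    thus ?thesis by (intro bexI[of _ "(k, c)"] bexI[of _ "(k, d)"]) (auto simp: L mem_arc_line)
  qed
  have tri: "w \<in> L" if ne: "u \<noteq> v" "v \<noteq> w" "u \<noteq> w" and L: "L \<in> ?L" "u \<in> L" "v \<in> L"
    and L': "L' \<in> ?L" "v \<in> L'" "w \<in> L'" and L'': "L'' \<in> ?L" "u \<in> L''" "w \<in> L''" for u v w L L' L''
  proof -
    obtain k a b where kab: "L = arc_line \<Omega> (k, a, b)" "a \<noteq> b" using L by (auto simp: arcs_def)
    have P: "u \<in> ?P" "v \<in> ?P" "w \<in> ?P" using sub L L' by blast+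
    have 1: "fst v = fst w \<and> share_arc (snd v) (snd w)"
      using collinear_iff_share_arc[OF P(2,3)] L' by blast
    have 2: "fst u = fst w \<and> share_arc (snd u) (snd w)"
      using collinear_iff_share_arc[OF P(1,3)] L'' by blast
    obtain c where c: "u = (k, c)" "c \<in> tricycles \<Omega>" "c a = b"
      using L(2) unfolding kab arc_line_def by auto
    obtain d where d: "v = (k, d)" "d \<in> tricycles \<Omega>" "d a = b"
      using L(3) unfolding kab arc_line_def by auto
    obtain e where e: "w = (k, e)" "e \<in> tricycles \<Omega>"
      using P(3) conjunct1[OF 1] d(1) by (metis SigmaE2 fst_conv prod.collapse)
    have "e a = b"
      by (rule share_arc_triangle[OF c(2) d(2) e(2) _ c(3) d(3) kab(2)]) (use ne 1 2 c d e in auto)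
    thus ?thesis using e by (simp add: kab mem_arc_line)
  qed
  have col: "(\<exists>L\<in>?L. \<phi> u \<in> L \<and> \<phi> v \<in> L) \<longleftrightarrow> (\<exists>L\<in>?L. u \<in> L \<and> v \<in> L)"
    if u: "u \<in> ?P" and v: "v \<in> ?P" and ne: "u \<noteq> v" for u v
    unfolding collinear_iff_share_arc[OF u v] collinear_iff_share_arc[OF \<phi>P[OF u] \<phi>P[OF v]]
    by (rule sh[OF u v ne])
  have lines: "\<phi> ` L \<in> ?L" "\<exists>L'\<in>?L. \<phi> ` L' = L" if L: "L \<in> ?L" for L
    by (rule collineation_lines(1)[OF \<phi> _ _ _ _ L], erule sub, erule two, rule tri, assumption+, rule col, assumption+)
      (rule collineation_lines(2)[OF \<phi> _ _ _ _ L], erule sub, erule two, rule tri, assumption+, rule col, assumption+)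
  have "\<exists>\<beta>\<in>arcs I \<Omega>. \<phi> ` arc_line \<Omega> \<alpha> = arc_line \<Omega> \<beta>" if "\<alpha> \<in> arcs I \<Omega>" for \<alpha>
    using lines(1)[of "arc_line \<Omega> \<alpha>"] that by blast
  then obtain F where F: "\<And>\<alpha>. \<alpha> \<in> arcs I \<Omega> \<Longrightarrow> F \<alpha> \<in> arcs I \<Omega> \<and> \<phi> ` arc_line \<Omega> \<alpha> = arc_line \<Omega> (F \<alpha>)"
    by metis
  have lineP: "arc_line \<Omega> \<alpha> \<subseteq> ?P" if "\<alpha> \<in> arcs I \<Omega>" for \<alpha> using sub that by blast
  have bijF: "bij_betw F (arcs I \<Omega>) (arcs I \<Omega>)"
    unfolding bij_betw_def
  proof (intro conjI inj_onI equalityI subsetI)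
    fix \<alpha> \<beta> assume ab: "\<alpha> \<in> arcs I \<Omega>" "\<beta> \<in> arcs I \<Omega>" "F \<alpha> = F \<beta>"
    hence "\<phi> ` arc_line \<Omega> \<alpha> = \<phi> ` arc_line \<Omega> \<beta>" using F by metis
    hence "arc_line \<Omega> \<alpha> = arc_line \<Omega> \<beta>"
      using \<phi> lineP ab by (metis bij_betw_def inj_on_image_eq_iff)
    thus "\<alpha> = \<beta>" using arc_line_inj[OF n ab(1,2)] by blast
  next
    fix \<beta> assume "\<beta> \<in> F ` arcs I \<Omega>" thus "\<beta> \<in> arcs I \<Omega>" using F by blast
  next
    fix \<beta> assume b: "\<beta> \<in> arcs I \<Omega>"
    then obtain \<alpha> where a: "\<alpha> \<in> arcs I \<Omega>" "\<phi> ` arc_line \<Omega> \<alpha> = arc_line \<Omega> \<beta>"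
      using lines(2)[of "arc_line \<Omega> \<beta>"] by blast
    hence "arc_line \<Omega> (F \<alpha>) = arc_line \<Omega> \<beta>" using F by metis
    hence "F \<alpha> = \<beta>" using arc_line_inj[OF n _ b] F a by blast
    thus "\<beta> \<in> F ` arcs I \<Omega>" using a by blast
  qed
  \<comment> \<open>In its coordinate, \<open>inv' c\<close> is the only three-cycle close to
    \<open>c\<close> that shares no arc with it, and both notions are preserved by
    \<open>\<phi>\<close>.\<close>
  have inv\<phi>: "\<phi> (k, inv' c) = (l, inv' d)" if kc: "(k, c) \<in> ?P" and ld: "\<phi> (k, c) = (l, d)" for k c l d
  proof -
    have c: "c \<in> tricycles \<Omega>" and k: "k \<in> I" using kc by auto
    have ic: "(k, inv' c) \<in> ?P" using inv_in_tricycles[OF c] k by simp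
    have ns: "\<not> share_arc c (inv' c)" by (rule not_share_arc_inv[OF c])
    have ne: "(k, c) \<noteq> (k, inv' c)"
    proof
      assume "(k, c) = (k, inv' c)"
      moreover have "disagree \<Omega> id c \<noteq> {}" using c by (auto simp: tricycles_def)
      then obtain a where "a \<in> disagree \<Omega> id c" by blast
      hence "a \<noteq> c a" by (simp add: disagree_def)
      hence "share_arc c c" by (intro share_arcI[OF refl refl])
      ultimately show False using ns by simp
    qed
    obtain l' e where e: "\<phi> (k, inv' c) = (l', e)" by fastforce
    have d: "d \<in> tricycles \<Omega>" "e \<in> tricycles \<Omega>" using \<phi>P[OF kc] \<phi>P[OF ic] ld e by auto
    have "tri_rel \<Omega> (k, c) (k, inv' c)"
      using card_disagree_not_share_arc[OF c inv_in_tricycles[OF c] ns] by (simp add: tri_rel_def)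
    hence t: "tri_rel \<Omega> (l, d) (l', e)" using adj[OF kc ic] ld e by simp
    hence "\<not> share_arc d e" using sh[OF kc ic ne] ld e ns by (simp add: tri_rel_def)
    hence "e = inv' d" using card_disagree_not_share_arc[OF d] t by (simp add: tri_rel_def)
    thus ?thesis using e t by (simp add: tri_rel_def)
  qed
  have rev_line: "(k, c) \<in> arc_line \<Omega> (rev_arc \<alpha>) \<longleftrightarrow> (k, inv' c) \<in> arc_line \<Omega> \<alpha> \<and> c \<in> tricycles \<Omega>" for k c and \<alpha> :: "'i \<times> 'a \<times> 'a"
  proof (cases "c \<in> tricycles \<Omega>")
    case True
    obtain l a b where \<alpha>: "\<alpha> = (l, a, b)" by (cases \<alpha>) auto
    have "inv' c a = b \<longleftrightarrow> c b = a"
      using True permutes_inverses[of c \<Omega>] by (auto simp: tricycles_def)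
    thus ?thesis using True inv_in_tricycles[OF True] by (auto simp: \<alpha> rev_arc_def mem_arc_line)
  qed (auto simp: rev_arc_def arc_line_def split: prod.splits)
  have rv: "F (rev_arc \<alpha>) = rev_arc (F \<alpha>)" if a: "\<alpha> \<in> arcs I \<Omega>" for \<alpha>
  proof -
    have ra: "rev_arc \<alpha> \<in> arcs I \<Omega>" "rev_arc (F \<alpha>) \<in> arcs I \<Omega>"
      using a F[OF a] by (simp_all only: rev_arc_in_arcs)
    obtain k s t where kst: "\<alpha> = (k, s, t)" "k \<in> I" "s \<in> \<Omega>" "t \<in> \<Omega>" "s \<noteq> t" using a by (auto simp: arcs_def)
    have line: "\<phi> ` arc_line \<Omega> (rev_arc \<alpha>) \<subseteq> arc_line \<Omega> (rev_arc (F \<alpha>))"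
    proof
      fix w assume "w \<in> \<phi> ` arc_line \<Omega> (rev_arc \<alpha>)"
      then obtain j c where w: "w = \<phi> (j, c)" "(j, c) \<in> arc_line \<Omega> (rev_arc \<alpha>)" by auto
      hence jc: "(j, c) \<in> ?P" using lineP[OF ra(1)] by blast
      obtain l d where ld: "\<phi> (j, c) = (l, d)" by fastforce
      have "\<phi> (j, inv' c) \<in> arc_line \<Omega> (F \<alpha>)" using w rev_line F[OF a] by blast
      hence "(l, inv' d) \<in> arc_line \<Omega> (F \<alpha>)" using inv\<phi>[OF jc ld] by simp
      moreover have "d \<in> tricycles \<Omega>" using \<phi>P[OF jc] ld by auto
      ultimately show "w \<in> arc_line \<Omega> (rev_arc (F \<alpha>))" using rev_line w ld by metis
    qed
    \<comment> \<open>Only an inclusion between the two lines is known at this point; two common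
      points are enough to identify the arcs.\<close>
    obtain c d where cd: "c \<noteq> d" "c \<in> tricycles \<Omega>" "d \<in> tricycles \<Omega>" "c t = s" "d t = s"
      by (rule arc_line_two[OF n kst(4,3)]) (use kst in auto)
    hence "(k, c) \<in> arc_line \<Omega> (rev_arc \<alpha>)" "(k, d) \<in> arc_line \<Omega> (rev_arc \<alpha>)"
      by (auto simp: kst rev_arc_def mem_arc_line)
    hence "\<phi> (k, c) \<in> arc_line \<Omega> (F (rev_arc \<alpha>))" "\<phi> (k, d) \<in> arc_line \<Omega> (F (rev_arc \<alpha>))"
      "\<phi> (k, c) \<in> arc_line \<Omega> (rev_arc (F \<alpha>))" "\<phi> (k, d) \<in> arc_line \<Omega> (rev_arc (F \<alpha>))"
      using F[OF ra(1)] line by blast+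
    moreover have "\<phi> (k, c) \<noteq> \<phi> (k, d)" using inj kst cd by simp
    moreover have "\<beta> = \<gamma>" if "\<beta> \<in> arcs I \<Omega>" "\<gamma> \<in> arcs I \<Omega>" "u \<noteq> v" and u: "u \<in> arc_line \<Omega> \<beta>" "v \<in> arc_line \<Omega> \<beta>"
      "u \<in> arc_line \<Omega> \<gamma>" "v \<in> arc_line \<Omega> \<gamma>" for \<beta> \<gamma> u v
    proof -
      obtain k' a b where b: "\<beta> = (k', a, b)" "a \<noteq> b" using \<open>\<beta> \<in> arcs I \<Omega>\<close> by (auto simp: arcs_def)
      obtain l' a' b' where g: "\<gamma> = (l', a', b')" "a' \<noteq> b'" using \<open>\<gamma> \<in> arcs I \<Omega>\<close> by (auto simp: arcs_def)
      obtain c where c: "u = (k', c)" "k' = l'" "c \<in> tricycles \<Omega>" "c a = b" "c a' = b'"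
        using u(1,3) b g by (cases u) (auto simp: mem_arc_line)
      obtain d where d: "v = (k', d)" "d \<in> tricycles \<Omega>" "d a = b" "d a' = b'"
        using u(2,4) b g by (cases v) (auto simp: mem_arc_line)
      have "a = a'" using two_shared_arcs_eq[OF c(3) d(2), of a a'] c d b g that(3) by metis
      thus ?thesis using c b g by simp
    qed
    ultimately show ?thesis using F[OF ra(1)] ra(2) by blast
  qed
  show thesis using that[OF bijF] F rv by blast
qed

subsection \<open>Automorphisms of the neighbourhood of the identity\<close>


text \<open>The lines of the second geometry, whose points are the arcs: a common tail if
  \<open>out\<close> holds, a common head otherwise.\<close>

definition star :: "'i set \<Rightarrow> 'a set \<Rightarrow> bool \<Rightarrow> 'i \<Rightarrow> 'a \<Rightarrow> ('i \<times> 'a \<times> 'a) set" where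
  "star I \<Omega> out k a = {(k, s, t) | s t. (k, s, t) \<in> arcs I \<Omega> \<and> (if out then s else t) = a}"

lemma mem_star: "(j, s, t) \<in> star I \<Omega> out k a \<longleftrightarrow> j = k \<and> (j, s, t) \<in> arcs I \<Omega> \<and> (if out then s else t) = a"
  by (auto simp: star_def)

lemma conj_cyc3:
  assumes "bij g" "distinct [a, b, x]"
  shows "g \<circ> cyc3 a b x \<circ> inv' g = cyc3 (g a) (g b) (g x)"
proof
  fix z
  have "z = g (inv' g z)" using assms by (simp add: bij_is_surj surj_f_inv_f)
  moreover have "g (cyc3 a b x y) = cyc3 (g a) (g b) (g x) (g y)" for y
    using assms by (auto simp: cyc3_def bij_is_inj inj_eq)
  ultimately show "(g \<circ> cyc3 a b x \<circ> inv' g) z = cyc3 (g a) (g b) (g x) z" by (metis comp_apply)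
qed

text \<open>Two different arcs of one three-cycle are consecutive. If the reverse of
  \<open>(s, t)\<close> follows \<open>(a, b)\<close>, then \<open>b = t\<close>; if it precedes it,
  then \<open>a = s\<close>. Collinearity in the second geometry is thereby expressed through lines
  and reversal, both of which are preserved.\<close>

lemma arc_lines_meet_iff:
  assumes \<alpha>: "(k, a, b) \<in> arcs I \<Omega>" and \<beta>: "(l, s, t) \<in> arcs I \<Omega>"
  shows "(arc_line \<Omega> (k, a, b) \<inter> arc_line \<Omega> (l, t, s) \<noteq> {} \<and> (k, a, b) \<noteq> (l, t, s)) \<longleftrightarrow>
    k = l \<and> (a, b) \<noteq> (s, t) \<and> (a = s \<or> b = t)"
proof
  assume A: "arc_line \<Omega> (k, a, b) \<inter> arc_line \<Omega> (l, t, s) \<noteq> {} \<and> (k, a, b) \<noteq> (l, t, s)"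
  then obtain c where c: "c \<in> tricycles \<Omega>" "c a = b" "c t = s" and kl: "k = l"
    by (auto simp: arc_line_def)
  have ab: "a \<noteq> b" "s \<noteq> t" using \<alpha> \<beta> by (auto simp: arcs_def)
  obtain x where x: "distinct [a, b, x]" "c = cyc3 a b x" using tricycle_eq_cyc3'[OF c(1,2) ab(1)] by metis
  have "t \<in> {a, b, x}" using ab c x by (metis cyc3_simps(4) insertCI)
  moreover have "t \<noteq> a" using A c kl by auto
  moreover have "c b = x" "c x = a" using x by auto
  ultimately show "k = l \<and> (a, b) \<noteq> (s, t) \<and> (a = s \<or> b = t)" using kl c(3) x(1) by auto
next
  assume A: "k = l \<and> (a, b) \<noteq> (s, t) \<and> (a = s \<or> b = t)"
  have o: "a \<noteq> b" "s \<noteq> t" "a \<in> \<Omega>" "b \<in> \<Omega>" "s \<in> \<Omega>" "t \<in> \<Omega>" using \<alpha> \<beta> by (auto simp: arcs_def)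
  show "arc_line \<Omega> (k, a, b) \<inter> arc_line \<Omega> (l, t, s) \<noteq> {} \<and> (k, a, b) \<noteq> (l, t, s)"
  proof (cases "a = s")
    case True
    hence d: "distinct [t, a, b]" using o A by auto
    hence "(k, cyc3 t a b) \<in> arc_line \<Omega> (k, a, b) \<inter> arc_line \<Omega> (l, t, s)"
      using cyc3_in_tricycles[OF d] o A True by (auto simp: mem_arc_line)
    thus ?thesis using d by auto
  next
    case False
    hence d: "distinct [a, b, s]" using o A by auto
    hence "(k, cyc3 a b s) \<in> arc_line \<Omega> (k, a, b) \<inter> arc_line \<Omega> (l, t, s)"
      using cyc3_in_tricycles[OF d] o A False by (auto simp: mem_arc_line)
    thus ?thesis using d o False A by auto
  qed
qed

lemma collinear_stars_iff:
  assumes "\<alpha> \<in> arcs I \<Omega>" "\<beta> \<in> arcs I \<Omega>"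
  shows "(\<exists>L\<in>{star I \<Omega> out k a | out k a. k \<in> I \<and> a \<in> \<Omega>}. \<alpha> \<in> L \<and> \<beta> \<in> L) \<longleftrightarrow>
    fst \<alpha> = fst \<beta> \<and> (fst (snd \<alpha>) = fst (snd \<beta>) \<or> snd (snd \<alpha>) = snd (snd \<beta>))"
proof -
  obtain k a b where \<alpha>: "\<alpha> = (k, a, b)" by (cases \<alpha>) auto
  obtain l s t where \<beta>: "\<beta> = (l, s, t)" by (cases \<beta>) auto
  show ?thesis
  proof
    assume "\<exists>L\<in>{star I \<Omega> out k a | out k a. k \<in> I \<and> a \<in> \<Omega>}. \<alpha> \<in> L \<and> \<beta> \<in> L"
    then obtain out j c where "(k, a, b) \<in> star I \<Omega> out j c" "(l, s, t) \<in> star I \<Omega> out j c"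
      by (auto simp: \<alpha> \<beta>)
    thus "fst \<alpha> = fst \<beta> \<and> (fst (snd \<alpha>) = fst (snd \<beta>) \<or> snd (snd \<alpha>) = snd (snd \<beta>))"
      by (cases out) (auto simp: mem_star \<alpha> \<beta>)
  next
    assume A: "fst \<alpha> = fst \<beta> \<and> (fst (snd \<alpha>) = fst (snd \<beta>) \<or> snd (snd \<alpha>) = snd (snd \<beta>))"
    have o: "k \<in> I" "a \<in> \<Omega>" "b \<in> \<Omega>" using assms by (auto simp: arcs_def \<alpha>)
    show "\<exists>L\<in>{star I \<Omega> out k a | out k a. k \<in> I \<and> a \<in> \<Omega>}. \<alpha> \<in> L \<and> \<beta> \<in> L"
    proof (cases "a = s")
      case True
      have "\<alpha> \<in> star I \<Omega> True k a" "\<beta> \<in> star I \<Omega> True k a"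
        using assms A True by (auto simp: mem_star \<alpha> \<beta>)
      thus ?thesis using o by blast
    next
      case False
      have "\<alpha> \<in> star I \<Omega> False k b" "\<beta> \<in> star I \<Omega> False k b"
        using assms A False by (auto simp: mem_star \<alpha> \<beta>)
      thus ?thesis using o by blast
    qed
  qed
qed

text \<open>Second use of \<open>collineation_lines\<close>, now with stars as lines. The image of
  the star of arcs leaving \<open>a\<close> names a point \<open>g a\<close>, a coordinate, and
  whether tails became heads; the last two turn out not to depend on \<open>a\<close>.\<close>

lemma arcs_aut:
  fixes I :: "'i set" and \<Omega> :: "'a set"
  assumes n: "card \<Omega> \<ge> 5" and F: "bij_betw F (arcs I \<Omega>) (arcs I \<Omega>)"
    and rev: "\<And>\<alpha>. \<alpha> \<in> arcs I \<Omega> \<Longrightarrow> F (rev_arc \<alpha>) = rev_arc (F \<alpha>)"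
    and meet: "\<And>\<alpha> \<beta>. \<lbrakk>\<alpha> \<in> arcs I \<Omega>; \<beta> \<in> arcs I \<Omega>\<rbrakk> \<Longrightarrow>
      arc_line \<Omega> (F \<alpha>) \<inter> arc_line \<Omega> (F \<beta>) \<noteq> {} \<longleftrightarrow> arc_line \<Omega> \<alpha> \<inter> arc_line \<Omega> \<beta> \<noteq> {}"
    and k: "k \<in> I"
  shows "\<exists>\<kappa> g e. \<kappa> \<in> I \<and> g ` \<Omega> \<subseteq> \<Omega> \<and>
    (\<forall>a\<in>\<Omega>. \<forall>b\<in>\<Omega>. a \<noteq> b \<longrightarrow> F (k, a, b) = (if e then (\<kappa>, g b, g a) else (\<kappa>, g a, g b)))"
proof -
  let ?P = "arcs I \<Omega>" and ?L = "{star I \<Omega> out k a | out k a. k \<in> I \<and> a \<in> \<Omega>}"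
  have FP: "F \<alpha> \<in> ?P" if "\<alpha> \<in> ?P" for \<alpha> using F that by (metis bij_betwE)
  have inj: "F \<alpha> = F \<beta> \<longleftrightarrow> \<alpha> = \<beta>" if "\<alpha> \<in> ?P" "\<beta> \<in> ?P" for \<alpha> \<beta>
    using F that by (auto simp: bij_betw_def inj_on_def)
  have meet2: "fst \<alpha> = fst \<beta> \<and> (fst (snd \<alpha>) = fst (snd \<beta>) \<or> snd (snd \<alpha>) = snd (snd \<beta>)) \<longleftrightarrow>
      arc_line \<Omega> \<alpha> \<inter> arc_line \<Omega> (rev_arc \<beta>) \<noteq> {} \<and> \<alpha> \<noteq> rev_arc \<beta>"
    if ab: "\<alpha> \<in> ?P" "\<beta> \<in> ?P" "\<alpha> \<noteq> \<beta>" for \<alpha> \<beta>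
  proof -
    obtain k a b where \<alpha>: "\<alpha> = (k, a, b)" by (cases \<alpha>) auto
    obtain l s t where \<beta>: "\<beta> = (l, s, t)" by (cases \<beta>) auto
    show ?thesis
      using arc_lines_meet_iff[of k a b I \<Omega> l s t] ab by (auto simp: \<alpha> \<beta> rev_arc_def)
  qed
  have col: "(\<exists>L\<in>?L. F \<alpha> \<in> L \<and> F \<beta> \<in> L) \<longleftrightarrow> (\<exists>L\<in>?L. \<alpha> \<in> L \<and> \<beta> \<in> L)"
    if a: "\<alpha> \<in> ?P" and b: "\<beta> \<in> ?P" and ne: "\<alpha> \<noteq> \<beta>" for \<alpha> \<beta>
  proof -
    have rb: "rev_arc \<beta> \<in> ?P" using b by (simp add: rev_arc_in_arcs)
    have "F \<alpha> \<noteq> F \<beta>" using inj[OF a b] ne by simp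
    hence "(\<exists>L\<in>?L. F \<alpha> \<in> L \<and> F \<beta> \<in> L) \<longleftrightarrow>
        arc_line \<Omega> (F \<alpha>) \<inter> arc_line \<Omega> (rev_arc (F \<beta>)) \<noteq> {} \<and> F \<alpha> \<noteq> rev_arc (F \<beta>)"
      using collinear_stars_iff[OF FP[OF a] FP[OF b]] meet2[OF FP[OF a] FP[OF b]] by simp
    also have "\<dots> \<longleftrightarrow> arc_line \<Omega> (F \<alpha>) \<inter> arc_line \<Omega> (F (rev_arc \<beta>)) \<noteq> {} \<and> F \<alpha> \<noteq> F (rev_arc \<beta>)"
      by (simp only: rev[OF b])
    also have "\<dots> \<longleftrightarrow> arc_line \<Omega> \<alpha> \<inter> arc_line \<Omega> (rev_arc \<beta>) \<noteq> {} \<and> \<alpha> \<noteq> rev_arc \<beta>"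
      by (simp only: meet[OF a rb] inj[OF a rb])
    also have "\<dots> \<longleftrightarrow> (\<exists>L\<in>?L. \<alpha> \<in> L \<and> \<beta> \<in> L)"
      using collinear_stars_iff[OF a b] meet2[OF a b ne] by simp
    finally show ?thesis .
  qed
  have sub: "L \<subseteq> ?P" if "L \<in> ?L" for L using that by (auto simp: star_def)
  have two: "\<exists>u\<in>L. \<exists>v\<in>L. u \<noteq> v" if Lin: "L \<in> ?L" for L
  proof -
    obtain out j a where L: "L = star I \<Omega> out j a" "j \<in> I" "a \<in> \<Omega>" using Lin by blast
    obtain x where x: "x \<in> \<Omega>" "x \<noteq> a" by (rule exists_fresh4[OF n])
    obtain y where y: "y \<in> \<Omega>" "y \<noteq> a" "y \<noteq> x" by (rule exists_fresh4[OF n])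
    show ?thesis
    proof (cases out)
      case True
      hence "(j, a, x) \<in> L" "(j, a, y) \<in> L" using L x y by (auto simp: mem_star arcs_def)
      thus ?thesis using y by (intro bexI[of _ "(j, a, x)"] bexI[of _ "(j, a, y)"]) auto
    next
      case False
      hence "(j, x, a) \<in> L" "(j, y, a) \<in> L" using L x y by (auto simp: mem_star arcs_def)
      thus ?thesis using y by (intro bexI[of _ "(j, x, a)"] bexI[of _ "(j, y, a)"]) auto
    qed
  qed
  \<comment> \<open>Say \<open>u\<close> and \<open>v\<close> have a common tail. If
    \<open>w\<close> shared only heads with both, then \<open>u\<close> and \<open>v\<close> would
    also have a common head and would coincide.\<close>
  have tri: "w \<in> L" if ne: "u \<noteq> v" "v \<noteq> w" "u \<noteq> w" and L: "L \<in> ?L" "u \<in> L" "v \<in> L"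
    and L': "L' \<in> ?L" "v \<in> L'" "w \<in> L'" and L'': "L'' \<in> ?L" "u \<in> L''" "w \<in> L''" for u v w L L' L''
  proof -
    obtain o1 k1 a1 where 1: "L = star I \<Omega> o1 k1 a1" using L by blast
    obtain o2 k2 a2 where 2: "L' = star I \<Omega> o2 k2 a2" using L' by blast
    obtain o3 k3 a3 where 3: "L'' = star I \<Omega> o3 k3 a3" using L'' by blast
    obtain ku su tu where u: "u = (ku, su, tu)" by (cases u) auto
    obtain kv sv tv where v: "v = (kv, sv, tv)" by (cases v) auto
    obtain kw sw tw where w: "w = (kw, sw, tw)" by (cases w) auto
    show ?thesis
      using ne(1) L(2,3) L'(2,3) L''(2,3) unfolding 1 2 3 u v w mem_star
      by (cases o1; cases o2; cases o3) simp_all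
  qed
  have lines: "F ` L \<in> ?L" if L: "L \<in> ?L" for L
    by (rule collineation_lines(1)[OF F _ _ _ _ L], erule sub, erule two, rule tri, assumption+, rule col, assumption+)
  have "\<exists>out \<kappa> a'. F ` star I \<Omega> True k a = star I \<Omega> out \<kappa> a' \<and> \<kappa> \<in> I \<and> a' \<in> \<Omega>" if "a \<in> \<Omega>" for a
    using lines[of "star I \<Omega> True k a"] that k by blast
  then obtain out \<kappa> g where T: "\<And>a. a \<in> \<Omega> \<Longrightarrow> F ` star I \<Omega> True k a = star I \<Omega> (out a) (\<kappa> a) (g a)"
    and \<kappa>: "\<And>a. a \<in> \<Omega> \<Longrightarrow> \<kappa> a \<in> I" and g: "\<And>a. a \<in> \<Omega> \<Longrightarrow> g a \<in> \<Omega>"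
    by metis
  have revstar: "rev_arc \<alpha> \<in> star I \<Omega> out j a \<longleftrightarrow> \<alpha> \<in> star I \<Omega> (\<not> out) j a" for \<alpha> out j a
    by (cases \<alpha>) (auto simp: rev_arc_def mem_star arcs_def)
  \<comment> \<open>Reversal transfers the result from the arcs leaving \<open>a\<close> to those
    entering it, with the same \<open>g a\<close>.\<close>
  have U: "F \<alpha> \<in> star I \<Omega> (\<not> out a) (\<kappa> a) (g a)" if a: "a \<in> \<Omega>" and \<alpha>: "\<alpha> \<in> star I \<Omega> False k a" for a \<alpha>
  proof -
    have P: "\<alpha> \<in> ?P" using \<alpha> by (auto simp: star_def)
    have "rev_arc \<alpha> \<in> star I \<Omega> True k a" using revstar[of \<alpha> True] \<alpha> by simp
    hence "F (rev_arc \<alpha>) \<in> star I \<Omega> (out a) (\<kappa> a) (g a)" using T[OF a] by blast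
    thus ?thesis using rev[OF P] revstar[of "F \<alpha>" "out a"] by simp
  qed
  have same: "\<kappa> a = \<kappa> b \<and> out a = out b" if a: "a \<in> \<Omega>" and b: "b \<in> \<Omega>" and ne: "a \<noteq> b" for a b
  proof -
    have P: "(k, a, b) \<in> ?P" using a b ne k by (simp add: arcs_def)
    have 1: "F (k, a, b) \<in> star I \<Omega> (out a) (\<kappa> a) (g a)" using T[OF a] P by (auto simp: mem_star)
    have 2: "F (k, a, b) \<in> star I \<Omega> (\<not> out b) (\<kappa> b) (g b)" by (rule U[OF b]) (use P in \<open>simp add: mem_star\<close>)
    obtain s t where Fst: "F (k, a, b) = (\<kappa> a, s, t)" using 1 by (auto simp: star_def)
    have kk: "\<kappa> a = \<kappa> b" using 2 Fst by (simp add: mem_star)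
    \<comment> \<open>Otherwise the arcs leaving \<open>a\<close> and those entering
      \<open>b\<close> would be mapped into the same star, and an arc from a third point
      \<open>x\<close> to \<open>b\<close> would coincide with one leaving \<open>a\<close>.\<close>
    have "out a = out b"
    proof (rule ccontr)
      assume "out a \<noteq> out b"
      hence o: "(\<not> out b) = out a" by blast
      hence gg: "g a = g b" using 1 2 unfolding Fst mem_star by simp
      obtain x where x: "x \<in> \<Omega>" "x \<noteq> a" "x \<noteq> b" by (rule exists_fresh4[OF n])
      have xP: "(k, x, b) \<in> ?P" using x b k by (simp add: arcs_def)
      have "F (k, x, b) \<in> star I \<Omega> (\<not> out b) (\<kappa> b) (g b)" by (rule U[OF b]) (use xP in \<open>simp add: mem_star\<close>)
      hence "F (k, x, b) \<in> F ` star I \<Omega> True k a" using T[OF a] gg kk o by simp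
      then obtain \<beta> where \<beta>: "\<beta> \<in> star I \<Omega> True k a" "F (k, x, b) = F \<beta>" by blast
      moreover have "\<beta> \<in> ?P" using \<beta> by (auto simp: star_def)
      ultimately have "(k, x, b) = \<beta>" using inj[OF xP] by blast
      thus False using \<beta>(1) x by (auto simp: mem_star)
    qed
    thus ?thesis using kk by simp
  qed
  obtain a0 where a0: "a0 \<in> \<Omega>" by (rule exists_fresh4[OF n])
  have const: "\<kappa> a = \<kappa> a0" "out a = out a0" if "a \<in> \<Omega>" for a
    using same[OF that a0] by (cases "a = a0"; auto)+
  have val: "F (k, a, b) = (if \<not> out a0 then (\<kappa> a0, g b, g a) else (\<kappa> a0, g a, g b))"
    if a: "a \<in> \<Omega>" and b: "b \<in> \<Omega>" and ne: "a \<noteq> b" for a b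
  proof -
    have P: "(k, a, b) \<in> ?P" using a b ne k by (simp add: arcs_def)
    have 1: "F (k, a, b) \<in> star I \<Omega> (out a0) (\<kappa> a0) (g a)"
      using T[OF a] P const[OF a] by (auto simp: mem_star)
    have "F (k, a, b) \<in> star I \<Omega> (\<not> out b) (\<kappa> b) (g b)" by (rule U[OF b]) (use P in \<open>simp add: mem_star\<close>)
    hence 2: "F (k, a, b) \<in> star I \<Omega> (\<not> out a0) (\<kappa> a0) (g b)" using const[OF b] by simp
    obtain s t where Fst: "F (k, a, b) = (\<kappa> a0, s, t)" using 1 by (auto simp: star_def)
    show ?thesis using 1 2 unfolding Fst mem_star by (cases "out a0") auto
  qed
  show ?thesis
    using val \<kappa>[OF a0] g by (intro exI[of _ "\<kappa> a0"] exI[of _ g] exI[of _ "\<not> out a0"]) auto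
qed

text \<open>Two consecutive arcs of a three-cycle determine it, so the action on arcs determines
  \<open>\<phi>\<close>; where arcs are reversed, the image is the conjugate of the inverse.\<close>

lemma tricycle_graph_aut:
  fixes I :: "'i set" and \<Omega> :: "'a set"
  assumes I: "finite I" and n: "card \<Omega> \<ge> 5" and \<phi>: "bij_betw \<phi> (I \<times> tricycles \<Omega>) (I \<times> tricycles \<Omega>)"
    and adj: "\<And>u v. \<lbrakk>u \<in> I \<times> tricycles \<Omega>; v \<in> I \<times> tricycles \<Omega>\<rbrakk> \<Longrightarrow> tri_rel \<Omega> (\<phi> u) (\<phi> v) \<longleftrightarrow> tri_rel \<Omega> u v"
  obtains \<pi> g e where "\<pi> permutes I" "\<And>k. k \<in> I \<Longrightarrow> g k permutes \<Omega>"
    "\<And>k c. \<lbrakk>k \<in> I; c \<in> tricycles \<Omega>\<rbrakk> \<Longrightarrow>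
      \<phi> (k, c) = (\<pi> k, g k \<circ> (if e k then inv' c else c) \<circ> inv' (g k))"
proof -
  have fin: "finite \<Omega>" using n by (metis card.infinite not_numeral_le_zero)
  obtain F where F: "bij_betw F (arcs I \<Omega>) (arcs I \<Omega>)"
    and line: "\<And>\<alpha>. \<alpha> \<in> arcs I \<Omega> \<Longrightarrow> \<phi> ` arc_line \<Omega> \<alpha> = arc_line \<Omega> (F \<alpha>)"
    and rev: "\<And>\<alpha>. \<alpha> \<in> arcs I \<Omega> \<Longrightarrow> F (rev_arc \<alpha>) = rev_arc (F \<alpha>)"
    using tricycle_aut_arcs[OF n \<phi> adj] by blast
  have lineP: "arc_line \<Omega> \<alpha> \<subseteq> I \<times> tricycles \<Omega>" if "\<alpha> \<in> arcs I \<Omega>" for \<alpha>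
    using that by (auto simp: arcs_def arc_line_def)
  have meet: "arc_line \<Omega> (F \<alpha>) \<inter> arc_line \<Omega> (F \<beta>) \<noteq> {} \<longleftrightarrow> arc_line \<Omega> \<alpha> \<inter> arc_line \<Omega> \<beta> \<noteq> {}"
    if "\<alpha> \<in> arcs I \<Omega>" "\<beta> \<in> arcs I \<Omega>" for \<alpha> \<beta>
  proof -
    have "\<phi> ` (arc_line \<Omega> \<alpha> \<inter> arc_line \<Omega> \<beta>) = \<phi> ` arc_line \<Omega> \<alpha> \<inter> \<phi> ` arc_line \<Omega> \<beta>"
      using \<phi> lineP that by (intro inj_on_image_Int[of \<phi> "I \<times> tricycles \<Omega>"]) (auto simp: bij_betw_def)
    thus ?thesis using line that by (metis image_is_empty)
  qed
  have "\<forall>k\<in>I. \<exists>\<kappa> g e. \<kappa> \<in> I \<and> g ` \<Omega> \<subseteq> \<Omega> \<and>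
    (\<forall>a\<in>\<Omega>. \<forall>b\<in>\<Omega>. a \<noteq> b \<longrightarrow> F (k, a, b) = (if e then (\<kappa>, g b, g a) else (\<kappa>, g a, g b)))"
    using arcs_aut[OF n F rev meet] by blast
  then obtain \<kappa> g0 e where \<kappa>: "\<And>k. k \<in> I \<Longrightarrow> \<kappa> k \<in> I" and g0: "\<And>k a. k \<in> I \<Longrightarrow> a \<in> \<Omega> \<Longrightarrow> g0 k a \<in> \<Omega>"
    and val: "\<And>k a b. \<lbrakk>k \<in> I; a \<in> \<Omega>; b \<in> \<Omega>; a \<noteq> b\<rbrakk> \<Longrightarrow>
      F (k, a, b) = (if e k then (\<kappa> k, g0 k b, g0 k a) else (\<kappa> k, g0 k a, g0 k b))"
    unfolding bchoice_iff image_subset_iff by blast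
  \<comment> \<open>\<open>g0\<close> is meaningful on \<open>\<Omega>\<close> only; fixing all
    other points is what \<open>permutes\<close> demands.\<close>
  define g where "g k x = (if x \<in> \<Omega> then g0 k x else x)" for k x
  have gp: "g k permutes \<Omega>" if k: "k \<in> I" for k
  proof (rule bij_imp_permutes)
    have "inj_on (g k) \<Omega>"
    proof (rule inj_onI, rule ccontr)
      fix a b assume ab: "a \<in> \<Omega>" "b \<in> \<Omega>" "g k a = g k b" "a \<noteq> b"
      have "(k, a, b) \<in> arcs I \<Omega>" using ab k by (simp add: arcs_def)
      hence "F (k, a, b) \<in> arcs I \<Omega>" using F by (metis bij_betwE)
      thus False using val[OF k ab(1,2,4)] ab by (auto simp: arcs_def g_def split: if_splits)
    qed
    moreover have "g k ` \<Omega> \<subseteq> \<Omega>" using g0[OF k] by (auto simp: g_def)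
    ultimately show "bij_betw (g k) \<Omega> \<Omega>"
      using endo_inj_surj[OF fin] by (auto simp: bij_betw_def)
  qed (simp add: g_def)
  have val': "F (k, a, b) = (if e k then (\<kappa> k, g k b, g k a) else (\<kappa> k, g k a, g k b))"
    if "k \<in> I" "a \<in> \<Omega>" "b \<in> \<Omega>" "a \<noteq> b" for k a b using val[OF that] that by (simp add: g_def)
  \<comment> \<open>If two coordinates had the same image, then, since \<open>g k\<close> is onto,
    an arc of coordinate \<open>k\<close> would have the same image under \<open>F\<close> as an arc
    of coordinate \<open>l\<close>.\<close>
  have "inj_on \<kappa> I"
  proof (rule inj_onI, rule ccontr)
    fix k l assume kl: "k \<in> I" "l \<in> I" "\<kappa> k = \<kappa> l" "k \<noteq> l"
    obtain a where a: "a \<in> \<Omega>" by (rule exists_fresh4[OF n])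
    obtain b where b: "b \<in> \<Omega>" "b \<noteq> a" by (rule exists_fresh4[OF n])
    have "(l, a, b) \<in> arcs I \<Omega>" using a b kl by (auto simp: arcs_def)
    hence "F (l, a, b) \<in> arcs I \<Omega>" using F by (metis bij_betwE)
    moreover have "fst (F (l, a, b)) = \<kappa> l" using val'[OF kl(2) a b(1)] b by auto
    ultimately obtain s t where st: "s \<in> \<Omega>" "t \<in> \<Omega>" "s \<noteq> t" "F (l, a, b) = (\<kappa> l, s, t)"
      by (cases "F (l, a, b)") (auto simp: arcs_def)
    define s' t' where "s' = inv' (g k) s" and "t' = inv' (g k) t"
    have gs: "g k s' = s" "g k t' = t" using gp[OF kl(1)] by (simp_all add: s'_def t'_def permutes_inverses)
    have o: "s' \<in> \<Omega>" "t' \<in> \<Omega>" "s' \<noteq> t'" using gs st permutes_in_image[OF gp[OF kl(1)]] by metis+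
    have "F (k, if e k then (t', s') else (s', t')) = (\<kappa> l, s, t)"
      using val'[OF kl(1)] o gs kl by auto
    hence eq: "F (k, if e k then (t', s') else (s', t')) = F (l, a, b)" using st by simp
    have "(k, if e k then (t', s') else (s', t')) \<in> arcs I \<Omega>" "(l, a, b) \<in> arcs I \<Omega>"
      using o kl a b by (auto simp: arcs_def)
    hence "(k, if e k then (t', s') else (s', t')) = (l, a, b)" by (rule inj_onD[OF bij_betw_imp_inj_on[OF F] eq])
    thus False using kl by simp
  qed
  hence \<kappa>b: "bij_betw \<kappa> I I" using \<kappa> endo_inj_surj[OF I, of \<kappa>] unfolding bij_betw_def by blast
  define \<pi> where "\<pi> k = (if k \<in> I then \<kappa> k else k)" for k
  have "\<pi> permutes I"
    by (rule bij_imp_permutes) (use \<kappa>b in \<open>auto simp: \<pi>_def cong: bij_betw_cong\<close>)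
  moreover have "\<phi> (k, c) = (\<pi> k, g k \<circ> (if e k then inv' c else c) \<circ> inv' (g k))"
    if k: "k \<in> I" and c: "c \<in> tricycles \<Omega>" for k c
  proof -
    have "disagree \<Omega> id c \<noteq> {}" using c by (auto simp: tricycles_def)
    then obtain a where "a \<in> disagree \<Omega> id c" by blast
    hence "c a \<noteq> a" by (auto simp: disagree_def)
    from tricycle_cases[OF c this] obtain b x where d: "distinct [a, b, x]"
      and o: "a \<in> \<Omega>" "b \<in> \<Omega>" "x \<in> \<Omega>" and cx: "c = cyc3 a b x" by metis
    have bij: "bij (g k)" using permutes_bij[OF gp[OF k]] .
    have dg: "distinct [g k a, g k b, g k x]" "distinct [g k x, g k b, g k a]"
      using d bij by (auto simp: bij_is_inj inj_eq)
    have ar: "(k, a, b) \<in> arcs I \<Omega>" "(k, b, x) \<in> arcs I \<Omega>" using o d k by (auto simp: arcs_def)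
    have "(k, c) \<in> arc_line \<Omega> (k, a, b)" "(k, c) \<in> arc_line \<Omega> (k, b, x)"
      using c d by (auto simp: mem_arc_line cx)
    hence m: "\<phi> (k, c) \<in> arc_line \<Omega> (F (k, a, b))" "\<phi> (k, c) \<in> arc_line \<Omega> (F (k, b, x))"
      using line[OF ar(1)] line[OF ar(2)] by blast+
    have pk: "\<pi> k = \<kappa> k" using k by (simp add: \<pi>_def)
    show ?thesis
    proof (cases "e k")
      case False
      hence "\<phi> (k, c) \<in> arc_line \<Omega> (\<kappa> k, g k a, g k b)" "\<phi> (k, c) \<in> arc_line \<Omega> (\<kappa> k, g k b, g k x)"
        using m val'[OF k o(1,2)] val'[OF k o(2,3)] d by auto
      then obtain r where r: "\<phi> (k, c) = (\<kappa> k, r)" "r \<in> tricycles \<Omega>" "r (g k a) = g k b" "r (g k b) = g k x"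
        by (auto simp: arc_line_def)
      have "r = cyc3 (g k a) (g k b) (g k x)" by (rule tricycle_eq_cyc3[OF r(2) dg(1) r(3,4)])
      thus ?thesis using r(1) False conj_cyc3[OF bij d] by (simp add: cx pk)
    next
      case True
      hence "\<phi> (k, c) \<in> arc_line \<Omega> (\<kappa> k, g k b, g k a)" "\<phi> (k, c) \<in> arc_line \<Omega> (\<kappa> k, g k x, g k b)"
        using m val'[OF k o(1,2)] val'[OF k o(2,3)] d by auto
      then obtain r where r: "\<phi> (k, c) = (\<kappa> k, r)" "r \<in> tricycles \<Omega>" "r (g k b) = g k a" "r (g k x) = g k b"
        by (auto simp: arc_line_def)
      have "r = cyc3 (g k x) (g k b) (g k a)" by (rule tricycle_eq_cyc3[OF r(2) dg(2) r(4,3)])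
      moreover have "distinct [x, b, a]" using d by auto
      ultimately show ?thesis using r(1) True conj_cyc3[OF bij, of x b a] inv_cyc3[OF d] by (simp add: cx pk)
    qed
  qed
  ultimately show thesis using that gp by blast
qed

subsection \<open>Rigidity\<close>


definition even_perms :: "'a set \<Rightarrow> ('a \<Rightarrow> 'a) set" where
  "even_perms \<Omega> = {p. p permutes \<Omega> \<and> evenperm p}"

lemma card_disagree_comp_right:
  assumes "u permutes \<Omega>"
  shows "card (disagree \<Omega> (\<sigma> \<circ> u) (\<tau> \<circ> u)) = card (disagree \<Omega> \<sigma> \<tau>)"
proof -
  have "u ` disagree \<Omega> (\<sigma> \<circ> u) (\<tau> \<circ> u) = disagree \<Omega> \<sigma> \<tau>"
  proof (intro equalityI subsetI)
    fix i assume "i \<in> u ` disagree \<Omega> (\<sigma> \<circ> u) (\<tau> \<circ> u)"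
    thus "i \<in> disagree \<Omega> \<sigma> \<tau>" using assms by (auto simp: disagree_def permutes_in_image)
  next
    fix i assume i: "i \<in> disagree \<Omega> \<sigma> \<tau>"
    have "i = u (inv' u i)" using assms by (simp add: permutes_inverses)
    moreover have "inv' u i \<in> disagree \<Omega> (\<sigma> \<circ> u) (\<tau> \<circ> u)"
      using i assms permutes_in_image[OF permutes_inv[OF assms]] by (simp add: disagree_def permutes_inverses)
    ultimately show "i \<in> u ` disagree \<Omega> (\<sigma> \<circ> u) (\<tau> \<circ> u)" by blast
  qed
  moreover have "inj_on u (disagree \<Omega> (\<sigma> \<circ> u) (\<tau> \<circ> u))"
    using permutes_inj[OF assms] by (meson inj_on_subset subset_UNIV)
  ultimately show ?thesis by (metis card_image)
qed

text \<open>The hypothesis makes \<open>g\<close> preserve every support \<open>{a, b, y}\<close>,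
  hence also \<open>{a, b}\<close>, and so it fixes every other point. What remains is the identity
  or the exchange of \<open>a\<close> and \<open>b\<close>; the exchange reverses orientation, so
  \<open>e\<close> decides between them.\<close>

lemma conj_fixes_arc_line:
  assumes n: "card \<Omega> \<ge> 5" and g: "g permutes \<Omega>" and ab: "a \<in> \<Omega>" "b \<in> \<Omega>" "a \<noteq> b"
    and fixed: "\<And>y. \<lbrakk>y \<in> \<Omega>; y \<noteq> a; y \<noteq> b\<rbrakk> \<Longrightarrow>
      g \<circ> (if e then inv' (cyc3 a b y) else cyc3 a b y) \<circ> inv' g = cyc3 a b y"
  shows "if e then g a = b \<and> g b = a else g = id"
proof -
  have bij: "bij g" using permutes_bij[OF g] .
  have inj: "g u = g v \<longleftrightarrow> u = v" for u v using bij by (simp add: bij_is_inj inj_eq)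
  have eq: "cyc3 (g a) (g b) (g y) = (if e then cyc3 y b a else cyc3 a b y)"
    if y: "y \<in> \<Omega>" "y \<noteq> a" "y \<noteq> b" for y
  proof -
    have d: "distinct [a, b, y]" "distinct [y, b, a]" using y ab by auto
    have dg: "distinct [g a, g b, g y]" "distinct [g y, g b, g a]" using d by (auto simp: inj)
    show ?thesis
    proof (cases e)
      case True
      hence "cyc3 (g y) (g b) (g a) = cyc3 a b y"
        using fixed[OF y] conj_cyc3[OF bij d(2)] inv_cyc3[OF d(1)] by simp
      hence "inv' (cyc3 (g y) (g b) (g a)) = inv' (cyc3 a b y)" by simp
      thus ?thesis using True inv_cyc3[OF d(1)] inv_cyc3[OF dg(2)] by simp
    next
      case False
      thus ?thesis using fixed[OF y] conj_cyc3[OF bij d(1)] by simp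
    qed
  qed
  have mem: "g z \<in> {a, b, y}" if y: "y \<in> \<Omega>" "y \<noteq> a" "y \<noteq> b" and z: "z \<in> {a, b, y}" for y z
  proof (rule ccontr)
    assume "g z \<notin> {a, b, y}"
    hence "(if e then cyc3 y b a else cyc3 a b y) (g z) = g z" by (auto simp: cyc3_def)
    hence "cyc3 (g a) (g b) (g y) (g z) = g z" using eq[OF y] by simp
    moreover have "distinct [g a, g b, g y]" using y ab by (auto simp: inj)
    ultimately show False using z by auto
  qed
  obtain y where y: "y \<in> \<Omega>" "y \<noteq> a" "y \<noteq> b" by (rule exists_fresh4[OF n])
  obtain w where w: "w \<in> \<Omega>" "w \<noteq> a" "w \<noteq> b" "w \<noteq> y" by (rule exists_fresh4[OF n])
  \<comment> \<open>Two of the supports meet in \<open>{a, b}\<close> only.\<close>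
  have ga: "g a \<in> {a, b}" "g b \<in> {a, b}"
    using mem[OF y, of a] mem[OF w(1-3), of a] mem[OF y, of b] mem[OF w(1-3), of b] w by auto
  have d: "distinct [a, b, y]" "distinct [g a, g b, g y]" "distinct [y, b, a]" using y ab by (auto simp: inj)
  have gy: "g z = z" if z: "z \<in> \<Omega>" "z \<noteq> a" "z \<noteq> b" for z
  proof -
    have "g z \<noteq> g a" "g z \<noteq> g b" "g a \<noteq> g b" using z ab by (auto simp: inj)
    hence "g z \<notin> {a, b}" using ga by auto
    thus ?thesis using mem[OF z, of z] by auto
  qed
  have E: "cyc3 (g a) (g b) y = (if e then cyc3 y b a else cyc3 a b y)" using eq[OF y] gy[OF y] by simp
  show ?thesis
  proof (cases "g a = a")
    case True
    hence gb: "g b = b" using ga inj[of a b] ab by auto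
    have "\<not> e"
    proof
      assume e
      hence "cyc3 a b y b = cyc3 y b a b" using E True gb by simp
      thus False using d y by simp
    qed
    moreover have "g = id"
    proof
      fix z show "g z = id z"
        using gy[of z] True gb permutes_not_in[OF g, of z] by (cases "z \<in> \<Omega>"; cases "z = a"; cases "z = b") auto
    qed
    ultimately show ?thesis by simp
  next
    case False
    hence g2: "g a = b" "g b = a" using ga inj[of a b] ab by auto
    have e
    proof (rule ccontr)
      assume "\<not> e"
      hence "cyc3 b a y b = cyc3 a b y b" using E g2 by simp
      thus False using d y by (auto simp: cyc3_def split: if_splits)
    qed
    thus ?thesis using g2 by simp
  qed
qed

text \<open>The three-cycle \<open>\<sigma> i \<mapsto> i \<mapsto> z\<close> makes \<open>i\<close>
  a fixed point. Taking \<open>z\<close> among the points moved by \<open>\<sigma>\<close> ensures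
  that no new point moves; such a third point exists because \<open>\<sigma>\<close> is even. This
  gives a path of close vertices down to the identity.\<close>

lemma exists_closer_tricycle:
  assumes fin: "finite \<Omega>" and \<sigma>: "\<sigma> \<in> even_perms \<Omega>" "\<sigma> \<noteq> id"
  obtains c where "c \<in> tricycles \<Omega>" "disagree \<Omega> id (c \<circ> \<sigma>) \<subset> disagree \<Omega> id \<sigma>"
proof -
  have p: "\<sigma> permutes \<Omega>" using \<sigma> by (simp add: even_perms_def)
  have inj: "\<sigma> u = \<sigma> v \<longleftrightarrow> u = v" for u v using permutes_inj[OF p] by (simp add: inj_eq)
  have M: "z \<in> disagree \<Omega> id \<sigma> \<longleftrightarrow> \<sigma> z \<noteq> z" for z
    using permutes_not_in[OF p] by (fastforce simp: disagree_def)
  obtain i where i: "\<sigma> i \<noteq> i" using \<sigma>(2) by (auto simp: fun_eq_iff)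
  have "card (disagree \<Omega> id \<sigma>) \<ge> 3"
    by (rule card_disagree_even_ge_3[OF fin]) (use \<sigma> in \<open>auto simp: even_perms_def permutes_id\<close>)
  moreover have "card {i, \<sigma> i} \<le> 2" using card_insert_le_Suc[of i "{\<sigma> i}"] by simp
  ultimately have "card {i, \<sigma> i} < card (disagree \<Omega> id \<sigma>)" by linarith
  then obtain z where z: "z \<in> disagree \<Omega> id \<sigma>" "z \<notin> {i, \<sigma> i}"
    using exists_fresh[of "{i, \<sigma> i}" "disagree \<Omega> id \<sigma>"] by blast
  have sM: "\<sigma> (\<sigma> i) \<noteq> \<sigma> i" using i inj by simp
  have mem: "i \<in> \<Omega>" "\<sigma> i \<in> \<Omega>" "z \<in> \<Omega>" using M i z sM by (auto simp: disagree_def)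
  have d: "distinct [\<sigma> i, i, z]" using i z by auto
  show thesis
  proof (rule that)
    show "cyc3 (\<sigma> i) i z \<in> tricycles \<Omega>" using d mem by (intro cyc3_in_tricycles) auto
    show "disagree \<Omega> id (cyc3 (\<sigma> i) i z \<circ> \<sigma>) \<subset> disagree \<Omega> id \<sigma>"
    proof
      show "disagree \<Omega> id (cyc3 (\<sigma> i) i z \<circ> \<sigma>) \<subseteq> disagree \<Omega> id \<sigma>"
      proof (rule subsetI, rule ccontr)
        fix p assume p: "p \<in> disagree \<Omega> id (cyc3 (\<sigma> i) i z \<circ> \<sigma>)" "p \<notin> disagree \<Omega> id \<sigma>"
        hence sp: "\<sigma> p = p" using M by blast
        hence "p \<noteq> \<sigma> i" "p \<noteq> i" "p \<noteq> z" using sM i z M by auto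
        hence "cyc3 (\<sigma> i) i z (\<sigma> p) = p" using sp d by simp
        thus False using p(1) by (simp add: disagree_def)
      qed
      have "i \<in> disagree \<Omega> id \<sigma>" using M i by blast
      moreover have "i \<notin> disagree \<Omega> id (cyc3 (\<sigma> i) i z \<circ> \<sigma>)" using d by (simp add: disagree_def)
      ultimately show "disagree \<Omega> id (cyc3 (\<sigma> i) i z \<circ> \<sigma>) \<noteq> disagree \<Omega> id \<sigma>" by blast
    qed
  qed
qed

section \<open>The closeness graph on a power of the alternating group\<close>

locale tri_graph =
  fixes I :: "'i set" and \<Omega> :: "'a set"
  assumes finite_I: "finite I" and card_5: "card \<Omega> \<ge> 5"
begin

definition V :: "('i \<Rightarrow> 'a \<Rightarrow> 'a) set" where "V = (\<Pi>\<^sub>E k\<in>I. even_perms \<Omega>)"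

definition T :: "('i \<Rightarrow> 'a \<Rightarrow> 'a) \<Rightarrow> ('i \<Rightarrow> 'a \<Rightarrow> 'a) \<Rightarrow> bool" where
  "T x y \<longleftrightarrow> (\<exists>k\<in>I. card (disagree \<Omega> (x k) (y k)) = 3 \<and> (\<forall>j\<in>I - {k}. x j = y j))"

definition unit :: "'i \<Rightarrow> 'a \<Rightarrow> 'a" where "unit = (\<lambda>k\<in>I. id)"

definition single :: "'i \<Rightarrow> ('a \<Rightarrow> 'a) \<Rightarrow> 'i \<Rightarrow> 'a \<Rightarrow> 'a" where "single k c = unit(k := c)"

definition pmul :: "('i \<Rightarrow> 'a \<Rightarrow> 'a) \<Rightarrow> ('i \<Rightarrow> 'a \<Rightarrow> 'a) \<Rightarrow> 'i \<Rightarrow> 'a \<Rightarrow> 'a" where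
  "pmul x y = (\<lambda>k\<in>I. x k \<circ> y k)"

definition pinv :: "('i \<Rightarrow> 'a \<Rightarrow> 'a) \<Rightarrow> 'i \<Rightarrow> 'a \<Rightarrow> 'a" where "pinv x = (\<lambda>k\<in>I. inv' (x k))"

definition T_aut :: "(('i \<Rightarrow> 'a \<Rightarrow> 'a) \<Rightarrow> 'i \<Rightarrow> 'a \<Rightarrow> 'a) \<Rightarrow> bool" where
  "T_aut f \<longleftrightarrow> bij_betw f V V \<and> (\<forall>x\<in>V. \<forall>y\<in>V. T (f x) (f y) \<longleftrightarrow> T x y)"

lemma finite_\<Omega>: "finite \<Omega>" using card_5 by (metis card.infinite not_numeral_le_zero)

lemma even_perms_permutation: "p \<in> even_perms \<Omega> \<Longrightarrow> permutation p"
  using finite_\<Omega> permutation_permutes by (auto simp: even_perms_def)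

lemma even_perms_id: "id \<in> even_perms \<Omega>" by (simp add: even_perms_def permutes_id)

lemma even_perms_comp: "p \<in> even_perms \<Omega> \<Longrightarrow> r \<in> even_perms \<Omega> \<Longrightarrow> p \<circ> r \<in> even_perms \<Omega>"
  using even_perms_permutation by (auto simp: even_perms_def permutes_compose evenperm_comp)

lemma even_perms_inv: "p \<in> even_perms \<Omega> \<Longrightarrow> inv' p \<in> even_perms \<Omega>"
  using even_perms_permutation by (auto simp: even_perms_def permutes_inv evenperm_inv)

lemma even_perms_inv_comp:
  "p \<in> even_perms \<Omega> \<Longrightarrow> inv' p \<circ> p = id" "p \<in> even_perms \<Omega> \<Longrightarrow> p \<circ> inv' p = id"
  using permutes_inv_o by (auto simp: even_perms_def)

lemma tricycles_even: "tricycles \<Omega> \<subseteq> even_perms \<Omega>"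
proof
  fix c assume c: "c \<in> tricycles \<Omega>"
  hence "disagree \<Omega> id c \<noteq> {}" by (auto simp: tricycles_def)
  then obtain a where "a \<in> disagree \<Omega> id c" by blast
  hence "c a \<noteq> a" by (auto simp: disagree_def)
  then obtain x where x: "distinct [a, c a, x]" "c = cyc3 a (c a) x" by (rule tricycle_cases[OF c])
  have "evenperm (cyc3 a (c a) x)"
    using x(1) by (auto simp: cyc3_eq_transpose evenperm_comp permutation_swap_id evenperm_swap)
  thus "c \<in> even_perms \<Omega>" using c x(2) by (simp add: even_perms_def tricycles_def)
qed

lemma V_component: "x \<in> V \<Longrightarrow> k \<in> I \<Longrightarrow> x k \<in> even_perms \<Omega>"
  by (auto simp: V_def)

lemma V_ext: "x \<in> V \<Longrightarrow> y \<in> V \<Longrightarrow> (\<And>k. k \<in> I \<Longrightarrow> x k = y k) \<Longrightarrow> x = y"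
  unfolding V_def by (rule PiE_ext)

lemma V_I: "(\<And>k. k \<in> I \<Longrightarrow> x k \<in> even_perms \<Omega>) \<Longrightarrow> (\<And>k. k \<notin> I \<Longrightarrow> x k = undefined) \<Longrightarrow> x \<in> V"
  by (auto simp: V_def)

lemma V_outside: "x \<in> V \<Longrightarrow> k \<notin> I \<Longrightarrow> x k = undefined"
  unfolding V_def by (rule PiE_arb)

lemma unit_V: "unit \<in> V" by (rule V_I) (auto simp: unit_def even_perms_id)

lemma single_V: "k \<in> I \<Longrightarrow> c \<in> even_perms \<Omega> \<Longrightarrow> single k c \<in> V"
  by (rule V_I) (auto simp: single_def unit_def even_perms_id)

lemma pmul_V: "x \<in> V \<Longrightarrow> y \<in> V \<Longrightarrow> pmul x y \<in> V"
  by (rule V_I) (auto simp: pmul_def intro: even_perms_comp V_component)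

lemma pinv_V: "x \<in> V \<Longrightarrow> pinv x \<in> V"
  by (rule V_I) (auto simp: pinv_def intro: even_perms_inv V_component)

lemma pmul_assoc: "pmul (pmul x y) z = pmul x (pmul y z)"
  by (auto simp: pmul_def comp_assoc)

lemma pmul_unit:
  assumes x: "x \<in> V" shows "pmul x unit = x" "pmul unit x = x"
  by (rule V_ext[OF pmul_V[OF x unit_V] x], simp add: pmul_def unit_def)
    (rule V_ext[OF pmul_V[OF unit_V x] x], simp add: pmul_def unit_def)

lemma pmul_pinv:
  assumes x: "x \<in> V" shows "pmul x (pinv x) = unit" "pmul (pinv x) x = unit"
  using even_perms_inv_comp[OF V_component[OF x]]
  by (auto simp: pmul_def unit_def pinv_def intro!: restrict_ext)

lemma pmul_cancel:
  assumes "x \<in> V" "u \<in> V"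
  shows "pmul (pmul x u) (pinv u) = x" "pmul (pmul x (pinv u)) u = x"
  using assms by (simp_all add: pmul_assoc pmul_pinv pmul_unit)

lemma T_pmul:
  assumes "x \<in> V" "y \<in> V" "u \<in> V"
  shows "T (pmul x u) (pmul y u) \<longleftrightarrow> T x y"
proof -
  have u: "u k permutes \<Omega>" if "k \<in> I" for k
    using V_component[OF assms(3) that] by (simp add: even_perms_def)
  have "x j \<circ> u j = y j \<circ> u j \<longleftrightarrow> x j = y j" if "j \<in> I" for j
    using permutes_surj[OF u[OF that]] by (metis surj_fun_eq comp_apply)
  thus ?thesis using u unfolding T_def
    by (intro bex_cong refl) (simp add: pmul_def card_disagree_comp_right)
qed

lemma T_single: "k \<in> I \<Longrightarrow> T (single k c) (single k d) \<longleftrightarrow> card (disagree \<Omega> c d) = 3"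
  by (auto simp: T_def single_def unit_def)

lemma not_T_single:
  assumes "k \<in> I" "l \<in> I" "k \<noteq> l" "c \<noteq> id" "d \<noteq> id"
  shows "\<not> T (single k c) (single l d)"
proof
  assume "T (single k c) (single l d)"
  then obtain j where "j \<in> I" "\<And>i. i \<in> I - {j} \<Longrightarrow> single k c i = single l d i" by (auto simp: T_def)
  moreover have "single k c k \<noteq> single l d k" "single k c l \<noteq> single l d l"
    using assms by (auto simp: single_def unit_def)
  ultimately show False using assms by (metis DiffI singletonD)
qed

lemma tricycle_neq_id: "c \<in> tricycles \<Omega> \<Longrightarrow> c \<noteq> id"
  by (auto simp: tricycles_def)

lemma tri_rel_iff_T:
  assumes "k \<in> I" "l \<in> I" "c \<in> tricycles \<Omega>" "d \<in> tricycles \<Omega>"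
  shows "tri_rel \<Omega> (k, c) (l, d) \<longleftrightarrow> T (single k c) (single l d)"
  using assms T_single not_T_single tricycle_neq_id by (cases "k = l") (auto simp: tri_rel_def)

lemma T_unit_iff:
  assumes "x \<in> V"
  shows "T unit x \<longleftrightarrow> (\<exists>k\<in>I. \<exists>c\<in>tricycles \<Omega>. x = single k c)"
proof
  assume "T unit x"
  then obtain k where k: "k \<in> I" "card (disagree \<Omega> (unit k) (x k)) = 3" "\<And>j. j \<in> I - {k} \<Longrightarrow> unit j = x j"
    by (auto simp: T_def)
  have xk: "x k \<in> even_perms \<Omega>" using assms k(1) by (rule V_component)
  have "x = single k (x k)"
    by (rule V_ext[OF assms single_V[OF k(1) xk]]) (use k in \<open>auto simp: single_def\<close>)
  moreover have "x k \<in> tricycles \<Omega>" using k xk by (auto simp: tricycles_def even_perms_def unit_def)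
  ultimately show "\<exists>k\<in>I. \<exists>c\<in>tricycles \<Omega>. x = single k c" using k by blast
next
  assume "\<exists>k\<in>I. \<exists>c\<in>tricycles \<Omega>. x = single k c"
  then obtain k c where kc: "k \<in> I" "c \<in> tricycles \<Omega>" "x = single k c" by blast
  thus "T unit x" unfolding T_def by (intro bexI[of _ k]) (auto simp: single_def tricycles_def unit_def)
qed

lemma single_eq_iff:
  assumes "k \<in> I" "l \<in> I" "c \<noteq> id"
  shows "single k c = single l d \<longleftrightarrow> k = l \<and> c = d"
proof
  assume e: "single k c = single l d"
  hence "single k c k = single l d k" by simp
  hence kl: "k = l" using assms by (auto simp: single_def unit_def split: if_splits)
  thus "k = l \<and> c = d" using fun_cong[OF e, of k] by (simp add: single_def)
qed auto

text \<open>A neighbour of \<open>unit\<close> is the same as a coordinate with a three-cycle, and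
  \<open>T\<close> becomes \<open>tri_rel\<close> there, so \<open>tricycle_graph_aut\<close>
  applies to the induced map.\<close>

lemma T_aut_local:
  assumes f: "T_aut f" and one: "f unit = unit"
  obtains \<pi> g e where "\<pi> permutes I" "\<And>k. k \<in> I \<Longrightarrow> g k permutes \<Omega>"
    "\<And>k c. \<lbrakk>k \<in> I; c \<in> tricycles \<Omega>\<rbrakk> \<Longrightarrow>
      f (single k c) = single (\<pi> k) (g k \<circ> (if e k then inv' c else c) \<circ> inv' (g k))"
proof -
  have bij: "bij_betw f V V" and Tf: "\<And>x y. x \<in> V \<Longrightarrow> y \<in> V \<Longrightarrow> T (f x) (f y) \<longleftrightarrow> T x y"
    using f by (auto simp: T_aut_def)
  have fV: "f x \<in> V" if "x \<in> V" for x using bij that by (metis bij_betwE)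
  have sV: "single k c \<in> V" if "k \<in> I" "c \<in> tricycles \<Omega>" for k c
    using that tricycles_even by (intro single_V) auto
  let ?P = "I \<times> tricycles \<Omega>"
  have "\<exists>v\<in>?P. f (single (fst u) (snd u)) = single (fst v) (snd v)" if u: "u \<in> ?P" for u
  proof -
    obtain k c where kc: "u = (k, c)" "k \<in> I" "c \<in> tricycles \<Omega>" using u by blast
    have "T unit (single k c)" using T_unit_iff[OF sV[OF kc(2,3)]] kc by blast
    hence "T unit (f (single k c))" using Tf[OF unit_V sV[OF kc(2,3)]] one by simp
    thus ?thesis using T_unit_iff[OF fV[OF sV[OF kc(2,3)]]] kc by auto
  qed
  then obtain \<phi> where \<phi>: "\<And>u. u \<in> ?P \<Longrightarrow> \<phi> u \<in> ?P \<and> f (single (fst u) (snd u)) = single (fst (\<phi> u)) (snd (\<phi> u))"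
    by metis
  have sinj: "u = v" if "u \<in> ?P" "v \<in> ?P" "single (fst u) (snd u) = single (fst v) (snd v)" for u v
    using that single_eq_iff tricycle_neq_id by (auto simp: prod_eq_iff)
  have "bij_betw \<phi> ?P ?P"
    unfolding bij_betw_def
  proof (intro conjI inj_onI equalityI subsetI)
    fix u v assume uv: "u \<in> ?P" "v \<in> ?P" "\<phi> u = \<phi> v"
    hence "f (single (fst u) (snd u)) = f (single (fst v) (snd v))" using \<phi> by metis
    moreover have "single (fst u) (snd u) \<in> V" "single (fst v) (snd v) \<in> V" using uv sV by auto
    ultimately have "single (fst u) (snd u) = single (fst v) (snd v)"
      using bij by (auto simp: bij_betw_def dest: inj_onD)
    thus "u = v" using sinj uv by blast
  next
    fix v assume "v \<in> \<phi> ` ?P" thus "v \<in> ?P" using \<phi> by blast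
  next
    fix v assume v: "v \<in> ?P"
    have vV: "single (fst v) (snd v) \<in> V" using v sV by auto
    then obtain y where y: "y \<in> V" "f y = single (fst v) (snd v)"
      using bij by (metis bij_betw_imp_surj_on imageE)
    have "fst v \<in> I" "snd v \<in> tricycles \<Omega>" using v by auto
    hence "T unit (single (fst v) (snd v))" using T_unit_iff[OF vV] by blast
    hence "T unit y" using Tf[OF unit_V y(1)] one y by simp
    then obtain k c where kc: "k \<in> I" "c \<in> tricycles \<Omega>" "y = single k c" using T_unit_iff[OF y(1)] by blast
    have "\<phi> (k, c) = v" using \<phi>[of "(k, c)"] kc y v sinj[of "\<phi> (k, c)" v] by simp
    thus "v \<in> \<phi> ` ?P" using kc by blast
  qed
  moreover have "tri_rel \<Omega> (\<phi> u) (\<phi> v) \<longleftrightarrow> tri_rel \<Omega> u v" if u: "u \<in> ?P" and v: "v \<in> ?P" for u v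
  proof -
    have *: "tri_rel \<Omega> u v \<longleftrightarrow> T (single (fst u) (snd u)) (single (fst v) (snd v))" if "u \<in> ?P" "v \<in> ?P" for u v
      using tri_rel_iff_T[of "fst u" "fst v" "snd u" "snd v"] that by auto
    have "single (fst u) (snd u) \<in> V" "single (fst v) (snd v) \<in> V" using u v sV by auto
    thus ?thesis using *[OF u v] *[of "\<phi> u" "\<phi> v"] \<phi>[OF u] \<phi>[OF v] Tf by metis
  qed
  ultimately obtain \<pi> g e where res: "\<pi> permutes I" "\<And>k. k \<in> I \<Longrightarrow> g k permutes \<Omega>"
    "\<And>k c. \<lbrakk>k \<in> I; c \<in> tricycles \<Omega>\<rbrakk> \<Longrightarrow>
      \<phi> (k, c) = (\<pi> k, g k \<circ> (if e k then inv' c else c) \<circ> inv' (g k))"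
    using tricycle_graph_aut[OF finite_I card_5, of \<phi>] by blast
  show thesis
  proof (rule that[OF res(1,2)])
    fix k c assume "k \<in> I" "c \<in> tricycles \<Omega>"
    thus "f (single k c) = single (\<pi> k) (g k \<circ> (if e k then inv' c else c) \<circ> inv' (g k))"
      using \<phi>[of "(k, c)"] res(3)[of k c] by simp
  qed
qed

end


section \<open>Automorphisms that fix a ball pointwise\<close>

context tri_graph
begin

definition fixes_ball :: "(('i \<Rightarrow> 'a \<Rightarrow> 'a) \<Rightarrow> 'i \<Rightarrow> 'a \<Rightarrow> 'a) \<Rightarrow> ('i \<Rightarrow> 'a \<Rightarrow> 'a) \<Rightarrow> bool" where
  "fixes_ball f x \<longleftrightarrow> f x = x \<and> (\<forall>y\<in>V. T x y \<longrightarrow> f y = y)"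

text \<open>Conjugation by a right translation, which is itself an automorphism: the behaviour of
  \<open>f\<close> near \<open>u\<close> becomes that of the new map near
  \<open>unit\<close>.\<close>

definition translate_aut where
  "translate_aut u f = (\<lambda>x. pmul (f (pmul x u)) (pinv u))"

lemma T_aut_V: "T_aut f \<Longrightarrow> x \<in> V \<Longrightarrow> f x \<in> V"
  unfolding T_aut_def by (metis bij_betwE)

lemma T_aut_inj: "T_aut f \<Longrightarrow> x \<in> V \<Longrightarrow> y \<in> V \<Longrightarrow> f x = f y \<longleftrightarrow> x = y"
  unfolding T_aut_def bij_betw_def inj_on_def by blast

lemma T_aut_T: "T_aut f \<Longrightarrow> x \<in> V \<Longrightarrow> y \<in> V \<Longrightarrow> T (f x) (f y) \<longleftrightarrow> T x y"
  unfolding T_aut_def by blast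

lemma bij_pmul:
  assumes "u \<in> V" shows "bij_betw (\<lambda>x. pmul x u) V V"
  by (rule bij_betw_byWitness[where f' = "\<lambda>x. pmul x (pinv u)"])
    (use assms in \<open>auto simp: pmul_cancel pmul_V pinv_V\<close>)

lemma T_aut_translate:
  assumes f: "T_aut f" and u: "u \<in> V"
  shows "T_aut (translate_aut u f)"
  unfolding T_aut_def
proof (intro conjI ballI)
  have "bij_betw (\<lambda>x. pmul x (pinv u)) V V" by (rule bij_pmul[OF pinv_V[OF u]])
  moreover have "bij_betw f V V" using f by (simp add: T_aut_def)
  ultimately have "bij_betw ((\<lambda>x. pmul x (pinv u)) \<circ> (f \<circ> (\<lambda>x. pmul x u))) V V"
    using bij_pmul[OF u] by (intro bij_betw_trans)
  thus "bij_betw (translate_aut u f) V V" by (simp add: translate_aut_def comp_def)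
  fix x y assume xy: "x \<in> V" "y \<in> V"
  show "T (translate_aut u f x) (translate_aut u f y) \<longleftrightarrow> T x y"
    using xy u by (simp add: translate_aut_def T_pmul pmul_V pinv_V T_aut_V[OF f] T_aut_T[OF f])
qed

lemma translate_aut_fix_iff:
  assumes f: "T_aut f" and u: "u \<in> V" and x: "x \<in> V"
  shows "translate_aut u f x = x \<longleftrightarrow> f (pmul x u) = pmul x u"
  using pmul_cancel[OF T_aut_V[OF f pmul_V[OF x u]] u] pmul_cancel[OF x u]
  by (auto simp: translate_aut_def)

text \<open>
  In the cartesian product structure, two neighbours of \<open>unit\<close> in different coordinates have exactly
  one common neighbour besides \<open>unit\<close>.
\<close>

lemma square_fixed:
  assumes f: "T_aut f" and fb: "fixes_ball f unit"
    and k: "k \<in> I" "c \<in> tricycles \<Omega>" and l: "l \<in> I" "d \<in> tricycles \<Omega>" and kl: "l \<noteq> k"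
  shows "f (pmul (single l d) (single k c)) = pmul (single l d) (single k c)"
proof -
  let ?y = "pmul (single l d) (single k c)"
  have cd: "c \<noteq> id" "d \<noteq> id" using k l tricycle_neq_id by auto
  have sV: "single k c \<in> V" "single l d \<in> V" using single_V k l tricycles_even by auto
  have yV: "?y \<in> V" by (rule pmul_V[OF sV(2,1)])
  have yv: "?y k = c" "?y l = d" "\<And>i. i \<in> I \<Longrightarrow> i \<noteq> k \<Longrightarrow> i \<noteq> l \<Longrightarrow> ?y i = id"
    using k l kl by (auto simp: pmul_def single_def unit_def)
  have Ty: "T (single k c) ?y" "T (single l d) ?y"
  proof -
    have c3: "card (disagree \<Omega> id d) = 3" "card (disagree \<Omega> id c) = 3" using k l by (auto simp: tricycles_def)
    have s: "single k c l = id" "single l d k = id" "single k c k = c" "single l d l = d"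
      "\<And>i. i \<in> I \<Longrightarrow> i \<noteq> k \<Longrightarrow> single k c i = id" "\<And>i. i \<in> I \<Longrightarrow> i \<noteq> l \<Longrightarrow> single l d i = id"
      using k l kl by (auto simp: single_def unit_def)
    have "single k c j = ?y j" if "j \<in> I - {l}" for j
      using that s yv by (cases "j = k") simp_all
    thus "T (single k c) ?y" unfolding T_def using l(1) c3(1) s(1) yv(2) by (intro bexI[of _ l]) auto
    have "single l d j = ?y j" if "j \<in> I - {k}" for j
      using that s yv by (cases "j = l") simp_all
    thus "T (single l d) ?y" unfolding T_def using k(1) c3(2) s(2) yv(1) by (intro bexI[of _ k]) auto
  qed
  have fs: "f unit = unit" "f (single k c) = single k c" "f (single l d) = single l d"
    using fb T_unit_iff sV k l unfolding fixes_ball_def by blast+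
  define z where "z = f ?y"
  have zV: "z \<in> V" using T_aut_V[OF f yV] by (simp add: z_def)
  have "T (single k c) z" "T (single l d) z"
    using T_aut_T[OF f sV(1) yV] T_aut_T[OF f sV(2) yV] Ty fs by (simp_all add: z_def)
  then obtain j1 j2 where j1: "\<And>i. i \<in> I \<Longrightarrow> i \<noteq> j1 \<Longrightarrow> single k c i = z i"
    and j2: "\<And>i. i \<in> I \<Longrightarrow> i \<noteq> j2 \<Longrightarrow> single l d i = z i"
    unfolding T_def by (metis DiffI singletonD)
  have dk: "single k c k \<noteq> single l d k" "single k c l \<noteq> single l d l"
    using k l kl cd by (auto simp: single_def unit_def)
  have "k = j1 \<or> k = j2" using j1[OF k(1)] j2[OF k(1)] dk by metis
  moreover have "l = j1 \<or> l = j2" using j1[OF l(1)] j2[OF l(1)] dk by metis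
  \<comment> \<open>The image is close to both fixed neighbours, which differ in \<open>k\<close>
    and \<open>l\<close>; so it leaves one of them in coordinate \<open>k\<close> and the other in
    \<open>l\<close>. One assignment gives \<open>unit\<close>, already taken as the image of
    \<open>unit\<close>, the other gives the fourth corner.\<close>
  ultimately consider "j1 = k" "j2 = l" | "j1 = l" "j2 = k" using kl by blast
  hence "z = ?y"
  proof cases
    case 1
    have "z = unit"
    proof (rule V_ext[OF zV unit_V])
      fix i assume i: "i \<in> I"
      show "z i = unit i"
        using j1[OF i] j2[OF i] 1 kl by (cases "i = k") (auto simp: single_def)
    qed
    hence "f ?y = f unit" using fs by (simp add: z_def)
    hence "?y = unit" using T_aut_inj[OF f yV unit_V] by simp
    thus ?thesis using yv(1) k cd by (simp add: unit_def)
  next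
    case 2
    show ?thesis
    proof (rule V_ext[OF zV yV])
      fix i assume i: "i \<in> I"
      show "z i = ?y i"
        using j1[OF i] j2[OF i] 2 kl yv yv(3)[OF i] i
        by (cases "i = k"; cases "i = l") (auto simp: single_def unit_def)
    qed
  qed
  thus ?thesis by (simp add: z_def)
qed

text \<open>The balls around \<open>unit\<close> and around \<open>single k c\<close> overlap.
  Translated, the overlap contains \<open>inv' c\<close> and every three-cycle sharing an arc with
  it, and these pin down \<open>\<pi> k\<close>, \<open>e k\<close> and \<open>g k\<close> in the
  local form. The neighbours in other coordinates are corners of squares.\<close>

lemma fixes_ball_single:
  assumes f: "T_aut f" and fb: "fixes_ball f unit" and k: "k \<in> I" and c: "c \<in> tricycles \<Omega>"
  shows "fixes_ball f (single k c)"
proof -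
  define u where "u = single k c"
  have sV: "single l d \<in> V" if "l \<in> I" "d \<in> tricycles \<Omega>" for l d
    using that tricycles_even by (intro single_V) auto
  have uV: "u \<in> V" using sV k c by (simp add: u_def)
  have fs: "f unit = unit" "\<And>l d. l \<in> I \<Longrightarrow> d \<in> tricycles \<Omega> \<Longrightarrow> f (single l d) = single l d"
    using fb T_unit_iff sV unfolding fixes_ball_def by blast+
  define h where "h = translate_aut u f"
  have hT: "T_aut h" unfolding h_def by (rule T_aut_translate[OF f uV])
  have h1: "h unit = unit"
    unfolding h_def translate_aut_fix_iff[OF f uV unit_V] using fs(2)[OF k c] uV by (simp add: pmul_unit u_def)
  obtain \<pi> g e where \<pi>: "\<pi> permutes I" and g: "\<And>k. k \<in> I \<Longrightarrow> g k permutes \<Omega>"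
    and form: "\<And>k c. \<lbrakk>k \<in> I; c \<in> tricycles \<Omega>\<rbrakk> \<Longrightarrow>
      h (single k c) = single (\<pi> k) (g k \<circ> (if e k then inv' c else c) \<circ> inv' (g k))"
    using T_aut_local[OF hT h1] by blast
  have pc: "c permutes \<Omega>" using c by (simp add: tricycles_def)
  \<comment> \<open>For these \<open>d\<close> the product \<open>d \<circ> c\<close> is the
    identity or a three-cycle, so the vertex reached lies in the ball that \<open>f\<close>
    fixes.\<close>
  have near: "h (single k d) = single k d"
    if d: "d \<in> tricycles \<Omega>" and s: "d = inv' c \<or> card (disagree \<Omega> d (inv' c)) = 3" for d
  proof -
    have m: "pmul (single k d) u = single k (d \<circ> c)"
      using k by (auto simp: u_def pmul_def single_def unit_def)
    have "f (single k (d \<circ> c)) = single k (d \<circ> c)"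
    proof (cases "d = inv' c")
      case True
      hence "d \<circ> c = id" using permutes_inv_o[OF pc] by simp
      moreover have "single k id = unit" using k by (auto simp: single_def unit_def)
      ultimately show ?thesis using fs by simp
    next
      case False
      hence "card (disagree \<Omega> (d \<circ> c) (inv' c \<circ> c)) = 3" using s card_disagree_comp_right[OF pc] by metis
      hence "card (disagree \<Omega> id (d \<circ> c)) = 3" using permutes_inv_o[OF pc] disagree_sym by metis
      moreover have "d \<circ> c permutes \<Omega>" using d pc by (auto simp: tricycles_def intro: permutes_compose)
      ultimately have "d \<circ> c \<in> tricycles \<Omega>" by (simp add: tricycles_def)
      thus ?thesis using fs(2)[OF k] by blast
    qed
    thus ?thesis unfolding h_def translate_aut_fix_iff[OF f uV sV[OF k d]] m .
  qed
  have ic: "inv' c \<in> tricycles \<Omega>" by (rule inv_in_tricycles[OF c])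
  have conj: "\<pi> k = k \<and> g k \<circ> (if e k then inv' d else d) \<circ> inv' (g k) = d"
    if d: "d \<in> tricycles \<Omega>" and s: "d = inv' c \<or> share_arc d (inv' c)" for d
  proof -
    have "h (single k d) = single k d"
      by (rule near[OF d]) (use s card_disagree_share_arc[OF d ic] in blast)
    hence "single k d = single (\<pi> k) (g k \<circ> (if e k then inv' d else d) \<circ> inv' (g k))" using form[OF k d] by simp
    thus ?thesis using single_eq_iff[OF k _ tricycle_neq_id[OF d]] permutes_in_image[OF \<pi>] k by metis
  qed
  have arc: "if e k then g k a = b \<and> g k b = a else g k = id"
    if ab: "a \<noteq> b" "a \<in> \<Omega>" "b \<in> \<Omega>" "inv' c a = b" for a b
  proof (rule conj_fixes_arc_line[OF card_5 g[OF k] ab(2,3,1)])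
    fix y assume y: "y \<in> \<Omega>" "y \<noteq> a" "y \<noteq> b"
    have d: "distinct [a, b, y]" using y ab by auto
    have "cyc3 a b y \<in> tricycles \<Omega>" using d y ab by (intro cyc3_in_tricycles) auto
    moreover have "share_arc (cyc3 a b y) (inv' c)" by (rule share_arcI[of _ a b]) (use d ab in auto)
    ultimately show "g k \<circ> (if e k then inv' (cyc3 a b y) else cyc3 a b y) \<circ> inv' (g k) = cyc3 a b y"
      using conj by blast
  qed
  have "disagree \<Omega> id (inv' c) \<noteq> {}" using ic by (auto simp: tricycles_def)
  then obtain a where "a \<in> disagree \<Omega> id (inv' c)" by blast
  hence "inv' c a \<noteq> a" by (auto simp: disagree_def)
  from tricycle_cases[OF ic this] obtain b x where d: "distinct [a, b, x]"
    and o: "a \<in> \<Omega>" "b \<in> \<Omega>" "x \<in> \<Omega>" and cx: "inv' c = cyc3 a b x" by metis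
  have "inv' c a = b" "inv' c b = x" using d by (simp_all add: cx)
  hence "if e k then g k a = b \<and> g k b = a else g k = id" "if e k then g k b = x \<and> g k x = b else g k = id"
    using arc d o by auto
  \<comment> \<open>If \<open>e k\<close> held, two consecutive arcs would require
    \<open>g k b = a\<close> and \<open>g k b = x\<close>.\<close>
  hence ek: "\<not> e k" "g k = id" using d by (auto split: if_splits)
  have pk: "\<pi> k = k" using conj[OF ic] by blast
  have all: "h (single l d) = single l d" if l: "l \<in> I" and d: "d \<in> tricycles \<Omega>" for l d
  proof (cases "l = k")
    case True
    thus ?thesis using form[OF k d] ek pk by (simp add: inv_id)
  next
    case False
    thus ?thesis
      unfolding h_def translate_aut_fix_iff[OF f uV sV[OF l d]]
      using square_fixed[OF f fb k c l d] by (simp add: u_def)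
  qed
  have "f y = y" if y: "y \<in> V" and Ty: "T u y" for y
  proof -
    define x where "x = pmul y (pinv u)"
    have x: "x \<in> V" "pmul x u = y" using y uV by (simp_all add: x_def pmul_V pinv_V pmul_cancel)
    have "T (pmul unit u) (pmul x u)" using Ty x uV by (simp add: pmul_unit)
    hence "T unit x" using T_pmul[OF unit_V x(1) uV] by simp
    then obtain l d where "l \<in> I" "d \<in> tricycles \<Omega>" "x = single l d" using T_unit_iff[OF x(1)] by blast
    hence "h x = x" using all by simp
    thus "f y = y" using translate_aut_fix_iff[OF f uV x(1)] x by (simp add: h_def)
  qed
  thus ?thesis unfolding fixes_ball_def using fs(2)[OF k c] by (simp add: u_def)
qed

lemma fixes_ball_step:
  assumes f: "T_aut f" and x: "x \<in> V" "fixes_ball f x" and y: "y \<in> V" "T x y"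
  shows "fixes_ball f y"
proof -
  define h where "h = translate_aut x f"
  have hT: "T_aut h" unfolding h_def by (rule T_aut_translate[OF f x(1)])
  have hfix: "h w = w \<longleftrightarrow> f (pmul w x) = pmul w x" if "w \<in> V" for w
    unfolding h_def by (rule translate_aut_fix_iff[OF f x(1) that])
  have Tx: "T (pmul w x) (pmul w' x) \<longleftrightarrow> T w w'" if "w \<in> V" "w' \<in> V" for w w'
    by (rule T_pmul[OF that x(1)])
  have ux: "pmul unit x = x" by (rule pmul_unit(2)[OF x(1)])
  have "fixes_ball h unit"
    unfolding fixes_ball_def
  proof (intro conjI ballI impI)
    show "h unit = unit" using hfix[OF unit_V] x ux by (simp add: fixes_ball_def)
    fix w assume w: "w \<in> V" "T unit w"
    hence "T x (pmul w x)" using Tx[OF unit_V w(1)] ux by simp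
    hence "f (pmul w x) = pmul w x" using x(2) pmul_V[OF w(1) x(1)] by (simp add: fixes_ball_def)
    thus "h w = w" using hfix[OF w(1)] by simp
  qed
  moreover define v where "v = pmul y (pinv x)"
  have v: "v \<in> V" "pmul v x = y" using x y by (simp_all add: v_def pmul_V pinv_V pmul_cancel)
  have "T unit v" using Tx[OF unit_V v(1)] ux v y by simp
  then obtain k c where "k \<in> I" "c \<in> tricycles \<Omega>" "v = single k c" using T_unit_iff[OF v(1)] by blast
  ultimately have hv: "fixes_ball h v" using fixes_ball_single[OF hT] by blast
  show ?thesis
    unfolding fixes_ball_def
  proof (intro conjI ballI impI)
    show "f y = y" using hv hfix[OF v(1)] v by (simp add: fixes_ball_def)
    fix z assume z: "z \<in> V" "T y z"
    define w where "w = pmul z (pinv x)"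
    have w: "w \<in> V" "pmul w x = z" using x z by (simp_all add: w_def pmul_V pinv_V pmul_cancel)
    have "T v w" using Tx[OF v(1) w(1)] v w z by simp
    hence "h w = w" using hv w by (simp add: fixes_ball_def)
    thus "f z = z" using hfix[OF w(1)] w by simp
  qed
qed

text \<open>Connectedness of the closeness graph, by induction on the number of moved points summed
  over the coordinates.\<close>

lemma fixes_ball_everywhere:
  assumes f: "T_aut f" and fb: "fixes_ball f unit" and x: "x \<in> V"
  shows "fixes_ball f x"
  using x
proof (induction "\<Sum>k\<in>I. card (disagree \<Omega> id (x k))" arbitrary: x rule: less_induct)
  case less
  show ?case
  proof (cases "x = unit")
    case True
    thus ?thesis using fb by simp
  next
    case False
    then obtain k where k: "k \<in> I" "x k \<noteq> id" using V_ext[OF less.prems unit_V] by (auto simp: unit_def)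
    have xk: "x k \<in> even_perms \<Omega>" by (rule V_component[OF less.prems k(1)])
    obtain c where c: "c \<in> tricycles \<Omega>" "disagree \<Omega> id (c \<circ> x k) \<subset> disagree \<Omega> id (x k)"
      by (rule exists_closer_tricycle[OF finite_\<Omega> xk k(2)])
    define y where "y = x(k := c \<circ> x k)"
    have yV: "y \<in> V"
      by (rule V_I) (use less.prems k c tricycles_even V_component V_outside even_perms_comp in \<open>auto simp: y_def\<close>)
    have "card (disagree \<Omega> id (y k)) < card (disagree \<Omega> id (x k))"
      using c(2) finite_\<Omega> by (auto simp: y_def disagree_def intro!: psubset_card_mono)
    hence "(\<Sum>k\<in>I. card (disagree \<Omega> id (y k))) < (\<Sum>k\<in>I. card (disagree \<Omega> id (x k)))"
      using finite_I k(1) by (intro sum_strict_mono_ex1) (auto simp: y_def)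
    hence fy: "fixes_ball f y" using less.hyps yV by blast
    have p: "x k permutes \<Omega>" using xk by (simp add: even_perms_def)
    have "card (disagree \<Omega> (c \<circ> x k) (id \<circ> x k)) = card (disagree \<Omega> c id)"
      by (rule card_disagree_comp_right[OF p])
    hence "card (disagree \<Omega> (c \<circ> x k) (x k)) = 3" using c(1) disagree_sym[of \<Omega> c id] by (simp add: tricycles_def)
    hence "T y x" unfolding T_def using k by (intro bexI[of _ k]) (auto simp: y_def)
    thus ?thesis using fixes_ball_step[OF f yV fy less.prems] by blast
  qed
qed

lemma T_aut_inv_into:
  assumes f: "T_aut f" shows "T_aut (inv_into V f)"
proof -
  have bij: "bij_betw f V V" using f by (simp add: T_aut_def)
  have b: "bij_betw (inv_into V f) V V" by (rule bij_betw_inv_into[OF bij])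
  have r: "f (inv_into V f x) = x" if "x \<in> V" for x using bij that by (rule bij_betw_inv_into_right)
  have i: "inv_into V f x \<in> V" if "x \<in> V" for x using b that by (metis bij_betwE)
  show ?thesis unfolding T_aut_def
  proof (intro conjI ballI b)
    fix x y assume xy: "x \<in> V" "y \<in> V"
    show "T (inv_into V f x) (inv_into V f y) \<longleftrightarrow> T x y"
      using T_aut_T[OF f i[OF xy(1)] i[OF xy(2)]] r xy by simp
  qed
qed

text \<open>Rigidity applied to \<open>f\<close> followed by the inverse of
  \<open>f'\<close>.\<close>

lemma T_aut_eqI:
  assumes f: "T_aut f" and f': "T_aut f'" and one: "f unit = f' unit"
    and nb: "\<And>k c. k \<in> I \<Longrightarrow> c \<in> tricycles \<Omega> \<Longrightarrow> f (single k c) = f' (single k c)"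
    and x: "x \<in> V"
  shows "f x = f' x"
proof -
  define h where "h = inv_into V f' \<circ> f"
  have bij': "bij_betw f' V V" using f' by (simp add: T_aut_def)
  have r: "f' (inv_into V f' x) = x" if "x \<in> V" for x using bij' that by (rule bij_betw_inv_into_right)
  have l: "inv_into V f' (f' x) = x" if "x \<in> V" for x using bij' that by (rule bij_betw_inv_into_left)
  have g: "T_aut (inv_into V f')" by (rule T_aut_inv_into[OF f'])
  have h: "T_aut h" unfolding T_aut_def
  proof (intro conjI ballI)
    show "bij_betw h V V" unfolding h_def using f g by (intro bij_betw_trans) (auto simp: T_aut_def)
    fix x y assume "x \<in> V" "y \<in> V"
    thus "T (h x) (h y) \<longleftrightarrow> T x y" using T_aut_T[OF f] T_aut_T[OF g] T_aut_V[OF f] by (simp add: h_def)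
  qed
  have "fixes_ball h unit" unfolding fixes_ball_def
  proof (intro conjI ballI impI)
    show "h unit = unit" using one l unit_V by (simp add: h_def)
    fix y assume y: "y \<in> V" "T unit y"
    then obtain k c where "k \<in> I" "c \<in> tricycles \<Omega>" "y = single k c" using T_unit_iff by blast
    thus "h y = y" using nb l y by (simp add: h_def)
  qed
  hence "h x = x" using fixes_ball_everywhere[OF h _ x] by (simp add: fixes_ball_def)
  thus ?thesis using r[OF T_aut_V[OF f x]] by (simp add: h_def)
qed

end

subsection \<open>Affine maps of the alternating power\<close>


lemma (in group) finite_closed_imp_subgroup:
  assumes S: "finite S" "S \<subseteq> carrier G" "S \<noteq> {}" and closed: "\<And>x y. x \<in> S \<Longrightarrow> y \<in> S \<Longrightarrow> x \<otimes> y \<in> S"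
  shows "subgroup S G"
proof (rule subgroupI[OF S(2,3)])
  fix x assume x: "x \<in> S"
  have "inj_on (\<lambda>y. x \<otimes> y) S" using x S(2) by (intro inj_onI) (metis l_cancel subsetD)
  hence surj: "(\<lambda>y. x \<otimes> y) ` S = S" using closed[OF x] endo_inj_surj[OF S(1)] by blast
  have xc: "x \<in> carrier G" using x S(2) by auto
  obtain y where y: "y \<in> S" "x \<otimes> y = x" using surj x by (metis imageE)
  have yc: "y \<in> carrier G" using y S(2) by auto
  have "y = \<one>" using l_cancel_one[OF xc yc] y by simp
  then obtain z where z: "z \<in> S" "x \<otimes> z = \<one>" using surj y by (metis imageE)
  have zc: "z \<in> carrier G" using z S(2) by auto
  have "inv x = z" by (rule inv_equality[OF inv_comm[OF z(2) xc zc] xc zc])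
  thus "inv x \<in> S" using z by simp
qed (rule closed)

text \<open>Normality in the form \<open>x m = m' x\<close>, so that no inverse of a concrete map
  has to be computed.\<close>

lemma (in group) normal_in_subgroupI:
  assumes K: "subgroup K G" and N: "subgroup N G" "N \<subseteq> K"
    and comm: "\<And>x m. x \<in> K \<Longrightarrow> m \<in> N \<Longrightarrow> \<exists>m'\<in>N. x \<otimes> m = m' \<otimes> x"
  shows "N \<lhd> (G\<lparr>carrier := K\<rparr>)"
proof -
  interpret K: group "G\<lparr>carrier := K\<rparr>" by (rule subgroup.subgroup_is_group[OF K is_group])
  show ?thesis
  proof (rule K.normal_invI)
    show "subgroup N (G\<lparr>carrier := K\<rparr>)" by (rule subgroup_incl[OF N(1) K N(2)])
    fix x m assume x: "x \<in> carrier (G\<lparr>carrier := K\<rparr>)" and m: "m \<in> N"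
    hence xK: "x \<in> K" by simp
    obtain m' where m': "m' \<in> N" "x \<otimes> m = m' \<otimes> x" using comm[OF xK m] by blast
    have c: "x \<in> carrier G" "m' \<in> carrier G" using xK m' subgroup.subset[OF K] subgroup.subset[OF N(1)] by auto
    have "x \<otimes> m \<otimes> inv x = m'" using m' c by (simp add: m_assoc)
    thus "x \<otimes>\<^bsub>G\<lparr>carrier := K\<rparr>\<^esub> m \<otimes>\<^bsub>G\<lparr>carrier := K\<rparr>\<^esub> inv\<^bsub>G\<lparr>carrier := K\<rparr>\<^esub> x \<in> N"
      using m' m_inv_consistent[OF K xK] by simp
  qed
qed

lemma inv_comp3:
  assumes "a permutes S" "b permutes S" "c permutes S"
  shows "inv' (a \<circ> b \<circ> c) = inv' c \<circ> inv' b \<circ> inv' a"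
  using assms by (simp add: o_inv_distrib permutes_bij bij_comp comp_assoc)

section \<open>Affine maps and their composition\<close>

context tri_graph
begin

text \<open>The normal form of the overview. Coordinate \<open>k\<close> of the image is built from
  coordinate \<open>inv' \<pi> k\<close>, the same convention as in
  \<open>wreath_action\<close>.\<close>

definition gen_map :: "('i \<Rightarrow> 'i) \<Rightarrow> ('i \<Rightarrow> bool) \<Rightarrow> ('i \<Rightarrow> 'a \<Rightarrow> 'a) \<Rightarrow> ('i \<Rightarrow> 'a \<Rightarrow> 'a) \<Rightarrow>
    ('i \<Rightarrow> 'a \<Rightarrow> 'a) \<Rightarrow> 'i \<Rightarrow> 'a \<Rightarrow> 'a" where
  "gen_map \<pi> e g h = (\<lambda>x\<in>V. \<lambda>k\<in>I. g k \<circ> (if e k then inv' (x (inv' \<pi> k)) else x (inv' \<pi> k)) \<circ> h k)"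

text \<open>
  The flag \<open>s\<close> allows the coordinates to be permuted, the flag \<open>v\<close> allows coordinates to be inverted.
  The equal parities of \<open>g k\<close> and \<open>h k\<close> keep the values even.
\<close>

definition params :: "bool \<Rightarrow> bool \<Rightarrow> ('i \<Rightarrow> 'i) \<Rightarrow> ('i \<Rightarrow> bool) \<Rightarrow> ('i \<Rightarrow> 'a \<Rightarrow> 'a) \<Rightarrow> ('i \<Rightarrow> 'a \<Rightarrow> 'a) \<Rightarrow> bool" where
  "params s v \<pi> e g h \<longleftrightarrow> \<pi> permutes I \<and> (s \<or> \<pi> = id) \<and> (\<forall>k\<in>I. e k \<longrightarrow> v) \<and>
     (\<forall>k\<in>I. g k permutes \<Omega> \<and> h k permutes \<Omega> \<and> (evenperm (g k) \<longleftrightarrow> evenperm (h k)))"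

definition affine where
  "affine s v = {gen_map \<pi> e g h | \<pi> e g h. params s v \<pi> e g h}"

abbreviation P where "P \<equiv> BijGroup V"

lemma finite_V: "finite V"
proof -
  have "finite (even_perms \<Omega>)"
    by (rule finite_subset[OF _ finite_permutations[OF finite_\<Omega>]]) (auto simp: even_perms_def)
  thus ?thesis unfolding V_def using finite_I by (intro finite_PiE) auto
qed

lemma finite_Bij_V: "finite (Bij V)"
proof (rule finite_subset)
  show "Bij V \<subseteq> V \<rightarrow>\<^sub>E V" by (auto simp: Bij_def bij_betw_def extensional_def)
  show "finite (V \<rightarrow>\<^sub>E V)" using finite_V by (intro finite_PiE)
qed

lemma perm_permutation: "p permutes \<Omega> \<Longrightarrow> permutation p"
  using finite_\<Omega> permutation_permutes by blast

lemma gen_map_apply: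
  "x \<in> V \<Longrightarrow> k \<in> I \<Longrightarrow>
    gen_map \<pi> e g h x k = g k \<circ> (if e k then inv' (x (inv' \<pi> k)) else x (inv' \<pi> k)) \<circ> h k"
  by (simp add: gen_map_def)

lemma inv_perm_I: "\<pi> permutes I \<Longrightarrow> k \<in> I \<Longrightarrow> inv' \<pi> k \<in> I"
  by (metis permutes_in_image permutes_inv)

lemma gen_map_V:
  assumes p: "params s v \<pi> e g h" and x: "x \<in> V"
  shows "gen_map \<pi> e g h x \<in> V"
proof (rule V_I)
  fix k assume k: "k \<in> I"
  have \<pi>: "\<pi> permutes I" and gh: "g k permutes \<Omega>" "h k permutes \<Omega>" "evenperm (g k) \<longleftrightarrow> evenperm (h k)"
    using p k by (auto simp: params_def)
  define y where "y = (if e k then inv' (x (inv' \<pi> k)) else x (inv' \<pi> k))"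
  have y: "y \<in> even_perms \<Omega>"
    using V_component[OF x inv_perm_I[OF \<pi> k]] by (auto simp: y_def even_perms_inv)
  have "g k \<circ> y \<circ> h k permutes \<Omega>" using gh y by (auto simp: even_perms_def intro: permutes_compose)
  moreover have "evenperm (g k \<circ> y \<circ> h k)"
    using gh y by (auto simp: evenperm_comp permutation_compose perm_permutation even_perms_def)
  ultimately show "gen_map \<pi> e g h x k \<in> even_perms \<Omega>"
    using x k by (simp add: gen_map_apply y_def even_perms_def)
qed (use x in \<open>simp add: gen_map_def\<close>)

lemma params_elim:
  assumes "params s v \<pi> e g h"
  shows "\<pi> permutes I" "\<And>k. k \<in> I \<Longrightarrow> g k permutes \<Omega>" "\<And>k. k \<in> I \<Longrightarrow> h k permutes \<Omega>"
    "\<And>k. k \<in> I \<Longrightarrow> evenperm (g k) \<longleftrightarrow> evenperm (h k)"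
  using assms by (auto simp: params_def)

lemma comp3_cancel:
  assumes "bij g" "bij h" "g \<circ> a \<circ> h = g \<circ> b \<circ> h" shows "a = b"
proof -
  have "inv' g \<circ> (g \<circ> a \<circ> h) \<circ> inv' h = inv' g \<circ> (g \<circ> b \<circ> h) \<circ> inv' h" using assms by simp
  moreover have "inv' g \<circ> (g \<circ> c \<circ> h) \<circ> inv' h = c" for c
    using assms by (simp add: fun_eq_iff bij_is_inj bij_is_surj surj_f_inv_f)
  ultimately show ?thesis by simp
qed

lemma gen_map_Bij:
  assumes p: "params s v \<pi> e g h"
  shows "gen_map \<pi> e g h \<in> Bij V"
proof -
  have \<pi>: "\<pi> permutes I" using p by (simp add: params_def)
  have "inj_on (gen_map \<pi> e g h) V"
  proof (rule inj_onI)
    fix x y assume xy: "x \<in> V" "y \<in> V" "gen_map \<pi> e g h x = gen_map \<pi> e g h y"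
    show "x = y"
    proof (rule V_ext[OF xy(1,2)])
      fix j assume j: "j \<in> I"
      define k where "k = \<pi> j"
      have k: "k \<in> I" "inv' \<pi> k = j" using \<pi> j by (simp_all add: k_def permutes_in_image permutes_inverses)
      have bij: "bij (g k)" "bij (h k)" using params_elim[OF p] k permutes_bij by blast+
      have "gen_map \<pi> e g h x k = gen_map \<pi> e g h y k" using xy(3) by simp
      hence "g k \<circ> (if e k then inv' (x j) else x j) \<circ> h k = g k \<circ> (if e k then inv' (y j) else y j) \<circ> h k"
        unfolding gen_map_apply[OF xy(1) k(1)] gen_map_apply[OF xy(2) k(1)] k(2) .
      hence "(if e k then inv' (x j) else x j) = (if e k then inv' (y j) else y j)"
        by (rule comp3_cancel[OF bij])
      moreover have "x j permutes \<Omega>" "y j permutes \<Omega>"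
        using V_component[OF xy(1) j] V_component[OF xy(2) j] by (auto simp: even_perms_def)
      ultimately show "x j = y j" by (metis permutes_inv_inv)
    qed
  qed
  moreover have "gen_map \<pi> e g h ` V \<subseteq> V" using gen_map_V[OF p] by blast
  ultimately have "bij_betw (gen_map \<pi> e g h) V V"
    using endo_inj_surj[OF finite_V] unfolding bij_betw_def by blast
  thus ?thesis by (simp add: Bij_def gen_map_def)
qed

text \<open>Inverting \<open>g' \<circ> z \<circ> h'\<close> inverts the outer factors and exchanges
  them; this is why \<open>h'\<close> enters the left factor, and \<open>g'\<close> the right one,
  where \<open>e k\<close> holds. The inversion flags add modulo two.\<close>

lemma gen_map_compose:
  assumes p: "params s v \<pi> e g h" and p': "params s v \<pi>' e' g' h'"
  defines "e'' \<equiv> \<lambda>k. e k \<noteq> e' (inv' \<pi> k)"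
    and "g'' \<equiv> \<lambda>k. g k \<circ> (if e k then inv' (h' (inv' \<pi> k)) else g' (inv' \<pi> k))"
    and "h'' \<equiv> \<lambda>k. (if e k then inv' (g' (inv' \<pi> k)) else h' (inv' \<pi> k)) \<circ> h k"
  shows "compose V (gen_map \<pi> e g h) (gen_map \<pi>' e' g' h') = gen_map (\<pi> \<circ> \<pi>') e'' g'' h''"
    and "params s v (\<pi> \<circ> \<pi>') e'' g'' h''"
proof -
  note q = params_elim[OF p] and q' = params_elim[OF p']
  have ip: "inv' (\<pi> \<circ> \<pi>') k = inv' \<pi>' (inv' \<pi> k)" for k
    using q(1) q'(1) by (simp add: o_inv_distrib permutes_bij)
  show "compose V (gen_map \<pi> e g h) (gen_map \<pi>' e' g' h') = gen_map (\<pi> \<circ> \<pi>') e'' g'' h''"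
  proof
    fix x
    show "compose V (gen_map \<pi> e g h) (gen_map \<pi>' e' g' h') x = gen_map (\<pi> \<circ> \<pi>') e'' g'' h'' x"
    proof (cases "x \<in> V")
      case True
      have "gen_map \<pi> e g h (gen_map \<pi>' e' g' h' x) k = gen_map (\<pi> \<circ> \<pi>') e'' g'' h'' x k" for k
      proof (cases "k \<in> I")
        case k: True
        define j where "j = inv' \<pi> k"
        have j: "j \<in> I" using inv_perm_I[OF q(1) k] by (simp add: j_def)
        define z where "z = x (inv' \<pi>' j)"
        have z: "z permutes \<Omega>" "inv' z permutes \<Omega>"
          using V_component[OF True inv_perm_I[OF q'(1) j]] permutes_inv by (auto simp: z_def even_perms_def)
        have y: "gen_map \<pi>' e' g' h' x j = g' j \<circ> (if e' j then inv' z else z) \<circ> h' j"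
          using True j by (simp add: gen_map_apply z_def)
        have L: "gen_map \<pi> e g h (gen_map \<pi>' e' g' h' x) k =
            g k \<circ> (if e k then inv' (g' j \<circ> (if e' j then inv' z else z) \<circ> h' j)
              else g' j \<circ> (if e' j then inv' z else z) \<circ> h' j) \<circ> h k"
          using gen_map_apply[OF gen_map_V[OF p' True] k, of \<pi> e g h] y by (simp add: j_def)
        have R: "gen_map (\<pi> \<circ> \<pi>') e'' g'' h'' x k = g'' k \<circ> (if e'' k then inv' z else z) \<circ> h'' k"
          using gen_map_apply[OF True k] by (simp add: ip z_def j_def)
        have "inv' (inv' z) = z" using z(1) by (rule permutes_inv_inv)
        thus ?thesis
          unfolding L R using inv_comp3[OF q'(2)[OF j] z(1) q'(3)[OF j]] inv_comp3[OF q'(2)[OF j] z(2) q'(3)[OF j]]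
          by (auto simp: e''_def g''_def h''_def j_def[symmetric] comp_assoc)
      next
        case False
        thus ?thesis using True gen_map_V[OF p' True] by (simp add: gen_map_def)
      qed
      thus ?thesis using True by (auto simp: compose_eq)
    qed (simp add: compose_def gen_map_def)
  qed
  have "g'' k permutes \<Omega> \<and> h'' k permutes \<Omega> \<and> (evenperm (g'' k) \<longleftrightarrow> evenperm (h'' k))" if k: "k \<in> I" for k
  proof -
    define j where "j = inv' \<pi> k"
    have j: "j \<in> I" using inv_perm_I[OF q(1) k] by (simp add: j_def)
    note a = q(2-4)[OF k] q'(2-4)[OF j]
    have perm: "permutation (g k)" "permutation (h k)" "permutation (g' j)" "permutation (h' j)"
      using a perm_permutation by blast+
    show ?thesis
      using a perm by (auto simp: g''_def h''_def j_def[symmetric] evenperm_comp evenperm_inv permutation_inverse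
          intro: permutes_compose permutes_inv)
  qed
  moreover have "e'' k \<longrightarrow> v" if k: "k \<in> I" for k
    using p p' k inv_perm_I[OF q(1) k] by (auto simp: params_def e''_def)
  ultimately show "params s v (\<pi> \<circ> \<pi>') e'' g'' h''"
    using p p' by (auto simp: params_def intro: permutes_compose)
qed

lemma affineI: "params s v \<pi> e g h \<Longrightarrow> gen_map \<pi> e g h \<in> affine s v"
  unfolding affine_def by blast

lemma affine_Bij: "affine s v \<subseteq> Bij V"
  using gen_map_Bij by (auto simp: affine_def)

lemma carrier_P: "carrier P = Bij V" by (simp add: BijGroup_def)

lemma mult_P: "f \<in> Bij V \<Longrightarrow> f' \<in> Bij V \<Longrightarrow> f \<otimes>\<^bsub>P\<^esub> f' = compose V f f'"
  by (simp add: BijGroup_def)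

lemma one_P: "\<one>\<^bsub>P\<^esub> = (\<lambda>x\<in>V. x)" by (simp add: BijGroup_def)

lemma apply_P: "f \<in> Bij V \<Longrightarrow> f' \<in> Bij V \<Longrightarrow> x \<in> V \<Longrightarrow> (f \<otimes>\<^bsub>P\<^esub> f') x = f (f' x)"
  by (simp add: mult_P compose_eq)

lemma Bij_V_ext: "f \<in> Bij V \<Longrightarrow> f' \<in> Bij V \<Longrightarrow> (\<And>x. x \<in> V \<Longrightarrow> f x = f' x) \<Longrightarrow> f = f'"
  by (metis Bij_imp_extensional extensionalityI)

lemma Bij_V_V: "f \<in> Bij V \<Longrightarrow> x \<in> V \<Longrightarrow> f x \<in> V"
  using Bij_imp_funcset by fastforce

lemma affine_mult:
  assumes "f \<in> affine s v" "f' \<in> affine s v" shows "f \<otimes>\<^bsub>P\<^esub> f' \<in> affine s v"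
proof -
  obtain \<pi> e g h where f: "f = gen_map \<pi> e g h" "params s v \<pi> e g h" using assms(1) by (auto simp: affine_def)
  obtain \<pi>' e' g' h' where f': "f' = gen_map \<pi>' e' g' h'" "params s v \<pi>' e' g' h'" using assms(2) by (auto simp: affine_def)
  show ?thesis
    unfolding mult_P[OF subsetD[OF affine_Bij assms(1)] subsetD[OF affine_Bij assms(2)]]
    using gen_map_compose[OF f(2) f'(2)] f f' by (auto simp: affine_def)
qed

lemma gen_map_id: "gen_map id (\<lambda>_. False) (\<lambda>_. id) (\<lambda>_. id) = (\<lambda>x\<in>V. x)"
proof
  fix x show "gen_map id (\<lambda>_. False) (\<lambda>_. id) (\<lambda>_. id) x = (\<lambda>x\<in>V. x) x"
    by (cases "x \<in> V") (auto simp: gen_map_def inv_id V_outside intro!: ext)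
qed

lemma params_id: "params s v id (\<lambda>_. False) (\<lambda>_. id) (\<lambda>_. id)"
  by (simp add: params_def permutes_id)

lemma one_affine: "\<one>\<^bsub>P\<^esub> \<in> affine s v"
  unfolding one_P gen_map_id[symmetric] by (rule affineI[OF params_id])

lemma subgroup_affine: "subgroup (affine s v) P"
proof (rule group.finite_closed_imp_subgroup[OF group_BijGroup])
  show "finite (affine s v)" by (rule finite_subset[OF affine_Bij finite_Bij_V])
  show "affine s v \<subseteq> carrier P" using affine_Bij by (simp add: carrier_P)
  show "affine s v \<noteq> {}" using one_affine by blast
qed (rule affine_mult)

section \<open>Right translations and the stabiliser of the identity\<close>

definition right_maps where "right_maps = {\<lambda>x\<in>V. pmul x g | g. g \<in> V}"

text \<open>With \<open>s\<close> true this will be the wreath product, with \<open>s\<close> false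
  its base group.\<close>

definition stab_maps where "stab_maps s = {f \<in> affine s False. f unit = unit}"

text \<open>Indexing by the set of inverted coordinates turns multiplication into symmetric
  difference, a direct model of an elementary abelian 2-group.\<close>

definition inversion :: "'i set \<Rightarrow> ('i \<Rightarrow> 'a \<Rightarrow> 'a) \<Rightarrow> 'i \<Rightarrow> 'a \<Rightarrow> 'a" where
  "inversion J = gen_map id (\<lambda>k. k \<in> J) (\<lambda>_. id) (\<lambda>_. id)"

lemma right_map_eq: "g \<in> V \<Longrightarrow> (\<lambda>x\<in>V. pmul x g) = gen_map id (\<lambda>_. False) (\<lambda>_. id) g"
  by (auto simp: gen_map_def pmul_def inv_id)

lemma params_right: "g \<in> V \<Longrightarrow> params s v id (\<lambda>_. False) (\<lambda>_. id) g"
  using V_component by (auto simp: params_def permutes_id even_perms_def)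

lemma right_maps_affine: "right_maps \<subseteq> affine s v"
proof
  fix f assume "f \<in> right_maps"
  then obtain g where "g \<in> V" "f = (\<lambda>x\<in>V. pmul x g)" unfolding right_maps_def by blast
  thus "f \<in> affine s v" using affineI[OF params_right] by (simp only: right_map_eq)
qed

lemma subgroup_right_maps: "subgroup right_maps P"
proof (rule group.finite_closed_imp_subgroup[OF group_BijGroup])
  have sub: "right_maps \<subseteq> Bij V" using right_maps_affine affine_Bij by blast
  show "finite right_maps" by (rule finite_subset[OF sub finite_Bij_V])
  show "right_maps \<subseteq> carrier P" using sub by (simp add: carrier_P)
  show "right_maps \<noteq> {}" using unit_V by (auto simp: right_maps_def)
  fix f f' assume f: "f \<in> right_maps" "f' \<in> right_maps"
  then obtain g g' where g: "g \<in> V" "f = (\<lambda>x\<in>V. pmul x g)" "g' \<in> V" "f' = (\<lambda>x\<in>V. pmul x g')"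
    by (auto simp: right_maps_def)
  have "f \<otimes>\<^bsub>P\<^esub> f' = compose V f f'" using f sub by (intro mult_P) auto
  also have "\<dots> = (\<lambda>x\<in>V. pmul x (pmul g' g))"
    using g by (auto simp: compose_def pmul_assoc pmul_V)
  finally show "f \<otimes>\<^bsub>P\<^esub> f' \<in> right_maps" using g pmul_V by (auto simp: right_maps_def)
qed

lemma subgroup_stab_maps: "subgroup (stab_maps s) P"
proof (rule group.finite_closed_imp_subgroup[OF group_BijGroup])
  have sub: "stab_maps s \<subseteq> Bij V" using affine_Bij by (auto simp: stab_maps_def)
  show "finite (stab_maps s)" by (rule finite_subset[OF sub finite_Bij_V])
  show "stab_maps s \<subseteq> carrier P" using sub by (simp add: carrier_P)
  have "\<one>\<^bsub>P\<^esub> \<in> stab_maps s" using one_affine unit_V by (simp add: stab_maps_def one_P)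
  thus "stab_maps s \<noteq> {}" by blast
  fix f f' assume f: "f \<in> stab_maps s" "f' \<in> stab_maps s"
  hence "(f \<otimes>\<^bsub>P\<^esub> f') unit = unit" using sub unit_V by (simp add: apply_P subsetD stab_maps_def)
  thus "f \<otimes>\<^bsub>P\<^esub> f' \<in> stab_maps s" using f affine_mult by (simp add: stab_maps_def)
qed

lemma gen_map_unit:
  assumes "k \<in> I" "\<pi> permutes I"
  shows "gen_map \<pi> e g h unit k = g k \<circ> h k"
  using gen_map_apply[OF unit_V assms(1)] inv_perm_I[OF assms(2,1)] by (simp add: unit_def inv_id)

text \<open>Fixing \<open>unit\<close> means \<open>g k \<circ> h k = id\<close>, which turns the
  two-sided multiplication into a conjugation.\<close>

lemma stab_maps_iff:
  "f \<in> stab_maps s \<longleftrightarrow> (\<exists>\<pi> g. \<pi> permutes I \<and> (s \<or> \<pi> = id) \<and> (\<forall>k\<in>I. g k permutes \<Omega>) \<and>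
     f = gen_map \<pi> (\<lambda>_. False) g (\<lambda>k. inv' (g k)))"
proof
  assume f: "f \<in> stab_maps s"
  then obtain \<pi> e g h where p: "params s False \<pi> e g h" "f = gen_map \<pi> e g h" by (auto simp: stab_maps_def affine_def)
  have h: "h k = inv' (g k)" if k: "k \<in> I" for k
  proof -
    have "g k \<circ> h k = id" using gen_map_unit[OF k params_elim(1)[OF p(1)], of e g h] f p k
      by (simp add: stab_maps_def unit_def)
    moreover have "g k permutes \<Omega>" using params_elim(2)[OF p(1) k] .
    ultimately show ?thesis by (metis comp_assoc id_comp comp_id permutes_inv_o(2))
  qed
  have "gen_map \<pi> e g h = gen_map \<pi> (\<lambda>_. False) g (\<lambda>k. inv' (g k))"
    unfolding gen_map_def using h p(1) by (intro restrict_ext) (auto simp: params_def)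
  thus "\<exists>\<pi> g. \<pi> permutes I \<and> (s \<or> \<pi> = id) \<and> (\<forall>k\<in>I. g k permutes \<Omega>) \<and>
     f = gen_map \<pi> (\<lambda>_. False) g (\<lambda>k. inv' (g k))" using p by (auto simp: params_def)
next
  assume "\<exists>\<pi> g. \<pi> permutes I \<and> (s \<or> \<pi> = id) \<and> (\<forall>k\<in>I. g k permutes \<Omega>) \<and>
     f = gen_map \<pi> (\<lambda>_. False) g (\<lambda>k. inv' (g k))"
  then obtain \<pi> g where g: "\<pi> permutes I" "s \<or> \<pi> = id" "\<And>k. k \<in> I \<Longrightarrow> g k permutes \<Omega>"
    and f: "f = gen_map \<pi> (\<lambda>_. False) g (\<lambda>k. inv' (g k))" by blast
  have p: "params s False \<pi> (\<lambda>_. False) g (\<lambda>k. inv' (g k))"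
    using g by (auto simp: params_def permutes_inv evenperm_inv perm_permutation)
  have "f unit = unit"
  proof (rule V_ext[OF _ unit_V])
    show "f unit \<in> V" using gen_map_V[OF p unit_V] f by simp
    fix k assume k: "k \<in> I"
    show "f unit k = unit k" using gen_map_unit[OF k g(1)] f permutes_inv_o(1)[OF g(3)[OF k]] k by (simp add: unit_def)
  qed
  thus "f \<in> stab_maps s" using affineI[OF p] f by (simp add: stab_maps_def)
qed

lemma right_maps_mult_stab_maps: "right_maps <#>\<^bsub>P\<^esub> stab_maps s = affine s False"
proof (intro equalityI subsetI)
  fix f assume "f \<in> right_maps <#>\<^bsub>P\<^esub> stab_maps s"
  then obtain r w where f: "r \<in> right_maps" "w \<in> stab_maps s" "f = r \<otimes>\<^bsub>P\<^esub> w" by (auto simp: set_mult_def)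
  have "w \<in> affine s False" using f(2) by (simp add: stab_maps_def)
  thus "f \<in> affine s False" unfolding f(3) using subsetD[OF right_maps_affine f(1)] by (intro affine_mult)
next
  fix f assume f: "f \<in> affine s False"
  define u where "u = f unit"
  have fB: "f \<in> Bij V" using f affine_Bij by blast
  have u: "u \<in> V" using Bij_V_V[OF fB unit_V] by (simp add: u_def)
  define r where "r = (\<lambda>x\<in>V. pmul x u)"
  define r' where "r' = (\<lambda>x\<in>V. pmul x (pinv u))"
  have r: "r \<in> right_maps" "r' \<in> right_maps" using u pinv_V by (auto simp: right_maps_def r_def r'_def)
  hence rB: "r \<in> Bij V" "r' \<in> Bij V" using right_maps_affine affine_Bij by blast+
  have "(r' \<otimes>\<^bsub>P\<^esub> f) unit = unit"
    using apply_P[OF rB(2) fB unit_V] u by (simp add: r'_def u_def[symmetric] pmul_pinv)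
  hence w: "r' \<otimes>\<^bsub>P\<^esub> f \<in> stab_maps s"
    using affine_mult[OF subsetD[OF right_maps_affine r(2)] f] by (simp add: stab_maps_def)
  have "r \<otimes>\<^bsub>P\<^esub> (r' \<otimes>\<^bsub>P\<^esub> f) = f"
  proof (rule Bij_V_ext)
    have wB: "r' \<otimes>\<^bsub>P\<^esub> f \<in> Bij V" using w affine_Bij by (auto simp: stab_maps_def)
    show "r \<otimes>\<^bsub>P\<^esub> (r' \<otimes>\<^bsub>P\<^esub> f) \<in> Bij V" unfolding mult_P[OF rB(1) wB] by (rule compose_Bij[OF rB(1) wB])
    show "(r \<otimes>\<^bsub>P\<^esub> (r' \<otimes>\<^bsub>P\<^esub> f)) x = f x" if "x \<in> V" for x
      using that rB fB wB u Bij_V_V[OF fB that] by (simp add: apply_P r_def r'_def pmul_cancel pmul_V pinv_V)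
  qed (rule fB)
  thus "f \<in> right_maps <#>\<^bsub>P\<^esub> stab_maps s" using r w unfolding set_mult_def by force
qed

lemma right_maps_Int_stab_maps: "right_maps \<inter> stab_maps s = {\<one>\<^bsub>P\<^esub>}"
proof (intro equalityI subsetI)
  fix f assume f: "f \<in> right_maps \<inter> stab_maps s"
  then obtain g where g: "g \<in> V" "f = (\<lambda>x\<in>V. pmul x g)" by (auto simp: right_maps_def)
  hence "g = unit" using f unit_V by (simp add: stab_maps_def pmul_unit)
  thus "f \<in> {\<one>\<^bsub>P\<^esub>}" using g by (auto simp: one_P pmul_unit)
next
  fix f assume "f \<in> {\<one>\<^bsub>P\<^esub>}"
  thus "f \<in> right_maps \<inter> stab_maps s"
    using subgroup.one_closed[OF subgroup_right_maps] subgroup.one_closed[OF subgroup_stab_maps] by auto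
qed

lemma semidirect_right_stab: "internal_semidirect P right_maps (stab_maps s) (affine s False)"
  unfolding internal_semidirect_def
proof (intro conjI subgroup_affine right_maps_Int_stab_maps right_maps_mult_stab_maps)
  interpret P: group P by (rule group_BijGroup)
  show "subgroup (stab_maps s) (P\<lparr>carrier := affine s False\<rparr>)"
    by (rule P.subgroup_incl[OF subgroup_stab_maps subgroup_affine]) (auto simp: stab_maps_def)
  show "right_maps \<lhd> P\<lparr>carrier := affine s False\<rparr>"
  proof (rule P.normal_in_subgroupI[OF subgroup_affine subgroup_right_maps right_maps_affine])
    fix f m assume f: "f \<in> affine s False" and m: "m \<in> right_maps"
    obtain \<pi> e g h where p: "params s False \<pi> e g h" and fg: "f = gen_map \<pi> e g h" using f by (auto simp: affine_def)
    note q = params_elim[OF p]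
    have e: "\<not> e k" if "k \<in> I" for k using p that by (simp add: params_def)
    obtain r where r: "r \<in> V" "m = (\<lambda>x\<in>V. pmul x r)" using m by (auto simp: right_maps_def)
    \<comment> \<open>Since \<open>f\<close> inverts nothing,
      \<open>g x r h = (g x h) (inv' h r h)\<close>: the left multiplier drops out and the right one
      conjugates \<open>r\<close>.\<close>
    define r' where "r' = (\<lambda>k\<in>I. inv' (h k) \<circ> r (inv' \<pi> k) \<circ> h k)"
    have r': "r' \<in> V"
    proof (rule V_I)
      fix k assume k: "k \<in> I"
      have a: "r (inv' \<pi> k) \<in> even_perms \<Omega>" by (rule V_component[OF r(1) inv_perm_I[OF q(1) k]])
      show "r' k \<in> even_perms \<Omega>"
        using a q(3)[OF k] k perm_permutation
        by (auto simp: r'_def even_perms_def evenperm_comp evenperm_inv permutation_compose permutation_inverse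
            intro: permutes_compose permutes_inv)
    qed (simp add: r'_def)
    define m' where "m' = (\<lambda>x\<in>V. pmul x r')"
    have m': "m' \<in> right_maps" using r' by (auto simp: m'_def right_maps_def)
    have B: "f \<in> Bij V" "m \<in> Bij V" "m' \<in> Bij V" using f m m' affine_Bij right_maps_affine by blast+
    have "f \<otimes>\<^bsub>P\<^esub> m = m' \<otimes>\<^bsub>P\<^esub> f"
    proof (rule Bij_V_ext)
      show "f \<otimes>\<^bsub>P\<^esub> m \<in> Bij V" "m' \<otimes>\<^bsub>P\<^esub> f \<in> Bij V" using B by (simp_all add: mult_P compose_Bij)
      fix x assume x: "x \<in> V"
      have "(f \<otimes>\<^bsub>P\<^esub> m) x = f (pmul x r)" using x B r by (simp add: apply_P)
      moreover have "(m' \<otimes>\<^bsub>P\<^esub> f) x = pmul (f x) r'" using x B Bij_V_V by (simp add: apply_P m'_def)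
      moreover have "f (pmul x r) = pmul (f x) r'"
      proof (rule V_ext)
        show "f (pmul x r) \<in> V" "pmul (f x) r' \<in> V" using x r r' B Bij_V_V pmul_V by blast+
        fix k assume k: "k \<in> I"
        have j: "inv' \<pi> k \<in> I" by (rule inv_perm_I[OF q(1) k])
        have "f (pmul x r) k = g k \<circ> (x (inv' \<pi> k) \<circ> r (inv' \<pi> k)) \<circ> h k"
          using gen_map_apply[OF pmul_V[OF x r(1)] k] e[OF k] fg j by (simp add: pmul_def)
        also have "\<dots> = (g k \<circ> x (inv' \<pi> k) \<circ> h k) \<circ> (inv' (h k) \<circ> r (inv' \<pi> k) \<circ> h k)"
          using permutes_inverses(1)[OF q(3)[OF k]] by (simp add: fun_eq_iff)
        also have "\<dots> = pmul (f x) r' k"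
          using gen_map_apply[OF x k] e[OF k] fg k by (simp add: pmul_def r'_def)
        finally show "f (pmul x r) k = pmul (f x) r' k" .
      qed
      ultimately show "(f \<otimes>\<^bsub>P\<^esub> m) x = (m' \<otimes>\<^bsub>P\<^esub> f) x" by simp
    qed
    thus "\<exists>m'\<in>right_maps. f \<otimes>\<^bsub>P\<^esub> m = m' \<otimes>\<^bsub>P\<^esub> f" using m' by blast
  qed
qed

end


lemma ball_disagree_conj_iff:
  assumes "g permutes \<Omega>" "h permutes \<Omega>"
  shows "(\<forall>i\<in>\<Omega>. (g \<circ> z \<circ> h) i \<noteq> (g \<circ> w \<circ> h) i) \<longleftrightarrow> (\<forall>i\<in>\<Omega>. z i \<noteq> w i)"
proof -
  have "(\<forall>i\<in>\<Omega>. (g \<circ> z \<circ> h) i \<noteq> (g \<circ> w \<circ> h) i) \<longleftrightarrow> (\<forall>i\<in>\<Omega>. z (h i) \<noteq> w (h i))"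
    using permutes_inj[OF assms(1)] by (simp add: inj_eq)
  also have "\<dots> \<longleftrightarrow> (\<forall>i\<in>h ` \<Omega>. z i \<noteq> w i)" by blast
  finally show ?thesis using permutes_image[OF assms(2)] by simp
qed

text \<open>If \<open>z\<close> and \<open>w\<close> take a common value at \<open>i\<close>, their
  inverses agree at that value.\<close>

lemma ball_disagree_inv_iff:
  assumes z: "z permutes \<Omega>" and w: "w permutes \<Omega>"
  shows "(\<forall>i\<in>\<Omega>. inv' z i \<noteq> inv' w i) \<longleftrightarrow> (\<forall>i\<in>\<Omega>. z i \<noteq> w i)"
proof -
  have 1: "\<exists>i\<in>\<Omega>. inv' z i = inv' w i" if "i \<in> \<Omega>" "z i = w i" and zw: "z permutes \<Omega>" "w permutes \<Omega>" for z w i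
  proof
    show "z i \<in> \<Omega>" using zw that by (simp add: permutes_in_image)
    have "inv' z (z i) = i" "inv' w (w i) = i" using zw by (simp_all add: permutes_inverses)
    thus "inv' z (z i) = inv' w (z i)" using that(2) by simp
  qed
  show ?thesis
    using 1[OF _ _ z w] 1[OF _ _ permutes_inv[OF z] permutes_inv[OF w]]
    unfolding permutes_inv_inv[OF z] permutes_inv_inv[OF w] by blast
qed

context tri_graph
begin

lemma noncommuting: obtains p r where "p \<in> even_perms \<Omega>" "r \<in> even_perms \<Omega>" "p \<circ> r \<noteq> r \<circ> p"
proof -
  obtain a where a: "a \<in> \<Omega>" by (rule exists_fresh4[OF card_5])
  obtain b where b: "b \<in> \<Omega>" "b \<noteq> a" by (rule exists_fresh4[OF card_5])
  obtain c where c: "c \<in> \<Omega>" "c \<noteq> a" "c \<noteq> b" by (rule exists_fresh4[OF card_5])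
  obtain d where d: "d \<in> \<Omega>" "d \<noteq> a" "d \<noteq> b" "d \<noteq> c" by (rule exists_fresh4[OF card_5])
  have dist: "distinct [a, b, c]" "distinct [a, b, d]" using a b c d by auto
  have "cyc3 a b c \<in> tricycles \<Omega>" "cyc3 a b d \<in> tricycles \<Omega>"
    using cyc3_in_tricycles[OF dist(1)] cyc3_in_tricycles[OF dist(2)] a b c d by auto
  moreover have "(cyc3 a b c \<circ> cyc3 a b d) a \<noteq> (cyc3 a b d \<circ> cyc3 a b c) a" using dist d by simp
  hence "cyc3 a b c \<circ> cyc3 a b d \<noteq> cyc3 a b d \<circ> cyc3 a b c" by metis
  ultimately show thesis using that tricycles_even by blast
qed

text \<open>Distinguishes the inversion of one coordinate from the identity;
  \<open>noncommuting\<close> serves to show that inversion is no homomorphism.\<close>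

lemma noninvolution: obtains c where "c \<in> even_perms \<Omega>" "inv' c \<noteq> c"
proof -
  obtain a where a: "a \<in> \<Omega>" by (rule exists_fresh4[OF card_5])
  obtain b where b: "b \<in> \<Omega>" "b \<noteq> a" by (rule exists_fresh4[OF card_5])
  obtain c where c: "c \<in> \<Omega>" "c \<noteq> a" "c \<noteq> b" by (rule exists_fresh4[OF card_5])
  have d: "distinct [a, b, c]" "distinct [c, b, a]" using a b c by auto
  have "cyc3 c b a a \<noteq> cyc3 a b c a" using d by simp
  hence "inv' (cyc3 a b c) \<noteq> cyc3 a b c" using inv_cyc3[OF d(1)] by metis
  moreover have "cyc3 a b c \<in> even_perms \<Omega>"
    using cyc3_in_tricycles[OF d(1)] a b c tricycles_even by blast
  ultimately show thesis using that by blast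
qed

section \<open>The group of coordinate inversions\<close>

lemma params_inversion: "params s True id (\<lambda>k. k \<in> J) (\<lambda>_. id) (\<lambda>_. id)"
  by (simp add: params_def permutes_id)

lemma inversion_affine: "inversion J \<in> affine s True"
  unfolding inversion_def by (rule affineI[OF params_inversion])

lemma inversion_Bij: "inversion J \<in> Bij V"
  using inversion_affine affine_Bij by blast

lemma inversion_apply: "x \<in> V \<Longrightarrow> k \<in> I \<Longrightarrow> inversion J x k = (if k \<in> J then inv' (x k) else x k)"
  by (simp add: inversion_def gen_map_apply inv_id)

lemma inversion_empty: "inversion {} = \<one>\<^bsub>P\<^esub>"
  unfolding inversion_def one_P using gen_map_id by simp

lemma inversion_mult: "inversion J \<otimes>\<^bsub>P\<^esub> inversion J' = inversion ((J - J') \<union> (J' - J))"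
proof (rule Bij_V_ext)
  show "inversion J \<otimes>\<^bsub>P\<^esub> inversion J' \<in> Bij V"
    using inversion_Bij by (simp add: mult_P compose_Bij)
  fix x assume x: "x \<in> V"
  have yV: "inversion J' x \<in> V" by (rule Bij_V_V[OF inversion_Bij x])
  have "inversion J (inversion J' x) = inversion ((J - J') \<union> (J' - J)) x"
  proof (rule V_ext[OF Bij_V_V[OF inversion_Bij yV] Bij_V_V[OF inversion_Bij x]])
    fix k assume k: "k \<in> I"
    have "x k permutes \<Omega>" using V_component[OF x k] by (simp add: even_perms_def)
    hence "inv' (inv' (x k)) = x k" by (rule permutes_inv_inv)
    thus "inversion J (inversion J' x) k = inversion ((J - J') \<union> (J' - J)) x k"
      using inversion_apply[OF yV k] inversion_apply[OF x k] by auto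
  qed
  thus "(inversion J \<otimes>\<^bsub>P\<^esub> inversion J') x = inversion ((J - J') \<union> (J' - J)) x"
    using apply_P[OF inversion_Bij inversion_Bij x] by simp
qed (rule inversion_Bij)

lemma inversion_inj:
  assumes "inversion J = inversion J'" "k \<in> I"
  shows "k \<in> J \<longleftrightarrow> k \<in> J'"
proof -
  obtain c where c: "c \<in> even_perms \<Omega>" "inv' c \<noteq> c" by (rule noninvolution)
  have s: "single k c \<in> V" by (rule single_V[OF assms(2) c(1)])
  have "inversion J (single k c) k = inversion J' (single k c) k" using assms(1) by simp
  thus ?thesis using inversion_apply[OF s assms(2)] c(2) by (auto simp: single_def split: if_splits)
qed

lemma subgroup_inversions: "subgroup (inversion ` Pow S) P" if "S \<subseteq> I" for S
proof (rule group.finite_closed_imp_subgroup[OF group_BijGroup])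
  have "finite S" using finite_subset[OF that finite_I] .
  thus "finite (inversion ` Pow S)" by simp
  show "inversion ` Pow S \<subseteq> carrier P" using inversion_Bij by (auto simp: carrier_P)
  show "inversion ` Pow S \<noteq> {}" by blast
  fix f f' assume "f \<in> inversion ` Pow S" "f' \<in> inversion ` Pow S"
  then obtain J J' where "J \<subseteq> S" "J' \<subseteq> S" "f = inversion J" "f' = inversion J'" by blast
  thus "f \<otimes>\<^bsub>P\<^esub> f' \<in> inversion ` Pow S" unfolding inversion_mult by (simp add: inversion_mult) blast
qed

lemma generate_inversions:
  assumes S: "S \<subseteq> I"
  shows "generate P ((\<lambda>k. inversion {k}) ` S) = inversion ` Pow S"
proof (rule equalityI)
  interpret P: group P by (rule group_BijGroup)
  show "generate P ((\<lambda>k. inversion {k}) ` S) \<subseteq> inversion ` Pow S"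
    by (rule P.generate_subgroup_incl[OF _ subgroup_inversions[OF S]]) auto
  show "inversion ` Pow S \<subseteq> generate P ((\<lambda>k. inversion {k}) ` S)"
  proof
    fix f assume "f \<in> inversion ` Pow S"
    then obtain J where J: "J \<subseteq> S" "f = inversion J" by blast
    have "finite J" using finite_subset[OF _ finite_I] J S by blast
    hence "inversion J \<in> generate P ((\<lambda>k. inversion {k}) ` S)" using J(1)
    proof (induction J)
      case empty
      show ?case unfolding inversion_empty by (rule generate.one)
    next
      case (insert k J)
      have "({k} - J) \<union> (J - {k}) = insert k J" using insert.hyps by blast
      hence "inversion (insert k J) = inversion {k} \<otimes>\<^bsub>P\<^esub> inversion J" by (simp only: inversion_mult)
      moreover have "inversion {k} \<in> generate P ((\<lambda>k. inversion {k}) ` S)"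
        using insert.prems by (intro generate.incl) auto
      ultimately show ?case using insert by (auto intro: generate.eng)
    qed
    thus "f \<in> generate P ((\<lambda>k. inversion {k}) ` S)" using J by simp
  qed
qed

lemma generate_UN_inversions:
  assumes S: "S \<subseteq> I"
  shows "generate P (\<Union>k\<in>S. generate P {inversion {k}}) = inversion ` Pow S"
proof (rule equalityI)
  interpret P: group P by (rule group_BijGroup)
  have "generate P {inversion {k}} \<subseteq> inversion ` Pow S" if "k \<in> S" for k
    by (rule P.generate_subgroup_incl[OF _ subgroup_inversions[OF S]]) (use that in auto)
  thus "generate P (\<Union>k\<in>S. generate P {inversion {k}}) \<subseteq> inversion ` Pow S"
    by (intro P.generate_subgroup_incl[OF _ subgroup_inversions[OF S]]) blast
  have "(\<lambda>k. inversion {k}) ` S \<subseteq> (\<Union>k\<in>S. generate P {inversion {k}})"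
    by (auto intro: generate.incl)
  thus "inversion ` Pow S \<subseteq> generate P (\<Union>k\<in>S. generate P {inversion {k}})"
    unfolding generate_inversions[OF S, symmetric] by (rule P.mono_generate)
qed

lemma generate_inversion:
  assumes "k \<in> I" shows "generate P {inversion {k}} = {\<one>\<^bsub>P\<^esub>, inversion {k}}"
proof -
  have "generate P {inversion {k}} = inversion ` Pow {k}" using generate_inversions[of "{k}"] assms by simp
  also have "Pow {k} = {{}, {k}}" by auto
  finally show ?thesis by (simp add: inversion_empty)
qed

lemma direct_product_inversions:
  "internal_direct_product P I (\<lambda>k. generate P {inversion {k}}) (inversion ` Pow I)"
proof -
  interpret P: group P by (rule group_BijGroup)
  have gen: "generate P {inversion {k}} = inversion ` Pow {k}" if "k \<in> I" for k
    using generate_inversions[of "{k}"] that by simp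
  show ?thesis
    unfolding internal_direct_product_def
  proof (intro conjI ballI impI)
    show "subgroup (generate P {inversion {k}}) P" if "k \<in> I" for k
      using gen[OF that] subgroup_inversions[of "{k}"] that by simp
    show "x \<otimes>\<^bsub>P\<^esub> y = y \<otimes>\<^bsub>P\<^esub> x"
      if "i \<in> I" "j \<in> I" "x \<in> generate P {inversion {i}}" "y \<in> generate P {inversion {j}}" for i j x y
      using that gen by (auto simp: inversion_mult Un_commute)
    show "generate P {inversion {i}} \<inter> generate P (\<Union>j\<in>I - {i}. generate P {inversion {j}}) = {\<one>\<^bsub>P\<^esub>}"
      if i: "i \<in> I" for i
    proof -
      have G: "generate P (\<Union>j\<in>I - {i}. generate P {inversion {j}}) = inversion ` Pow (I - {i})"
        by (rule generate_UN_inversions) auto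
      have "f = \<one>\<^bsub>P\<^esub>" if f: "f \<in> inversion ` Pow {i}" "f \<in> inversion ` Pow (I - {i})" for f
      proof -
        obtain J where J: "J \<subseteq> {i}" "f = inversion J" using f(1) by blast
        obtain J' where J': "J' \<subseteq> I - {i}" "f = inversion J'" using f(2) by blast
        have "i \<notin> J'" using J' by blast
        hence "i \<notin> J" using inversion_inj[of J J', OF _ i] J J' by simp
        hence "J = {}" using J by blast
        thus ?thesis using J inversion_empty by simp
      qed
      moreover have "\<one>\<^bsub>P\<^esub> \<in> inversion ` Pow {i}" "\<one>\<^bsub>P\<^esub> \<in> inversion ` Pow (I - {i})"
        unfolding inversion_empty[symmetric] by blast+
      ultimately show ?thesis unfolding G gen[OF i] by blast
    qed
    show "inversion ` Pow I = generate P (\<Union>i\<in>I. generate P {inversion {i}})"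
      using generate_UN_inversions[of I] by simp
  qed
qed

section \<open>Splitting off the inversions\<close>

lemma affine_mono: "affine s False \<subseteq> affine s v"
proof
  fix f assume "f \<in> affine s False"
  then obtain \<pi> e g h where p: "params s False \<pi> e g h" and f: "f = gen_map \<pi> e g h" by (auto simp: affine_def)
  have "params s v \<pi> e g h" using p by (simp add: params_def)
  thus "f \<in> affine s v" unfolding f by (rule affineI)
qed

lemma affine_mult_inversions: "affine s False <#>\<^bsub>P\<^esub> (inversion ` Pow I) = affine s True"
proof (intro equalityI subsetI)
  fix f assume "f \<in> affine s False <#>\<^bsub>P\<^esub> (inversion ` Pow I)"
  then obtain a J where "a \<in> affine s False" "f = a \<otimes>\<^bsub>P\<^esub> inversion J" by (auto simp: set_mult_def)
  thus "f \<in> affine s True" using affine_mult[OF _ inversion_affine] affine_mono by blast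
next
  fix f assume "f \<in> affine s True"
  then obtain \<pi> e g h where p: "params s True \<pi> e g h" and f: "f = gen_map \<pi> e g h" by (auto simp: affine_def)
  have p0: "params s False \<pi> (\<lambda>_. False) g h" using p by (auto simp: params_def)
  \<comment> \<open>The inversions are performed before coordinates move, so the flag of the target
    \<open>\<pi> j\<close> is attached to the source \<open>j\<close>.\<close>
  define J where "J = {j \<in> I. e (\<pi> j)}"
  have \<pi>: "\<pi> permutes I" by (rule params_elim(1)[OF p])
  have B: "f \<in> Bij V" "gen_map \<pi> (\<lambda>_. False) g h \<in> Bij V" using gen_map_Bij p p0 f by auto
  have "f = gen_map \<pi> (\<lambda>_. False) g h \<otimes>\<^bsub>P\<^esub> inversion J"
  proof (rule Bij_V_ext[OF B(1)])
    show "gen_map \<pi> (\<lambda>_. False) g h \<otimes>\<^bsub>P\<^esub> inversion J \<in> Bij V"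
      using B inversion_Bij by (simp add: mult_P compose_Bij)
    fix x assume x: "x \<in> V"
    have yV: "inversion J x \<in> V" by (rule Bij_V_V[OF inversion_Bij x])
    have "f x = gen_map \<pi> (\<lambda>_. False) g h (inversion J x)"
    proof (rule V_ext[OF Bij_V_V[OF B(1) x] Bij_V_V[OF B(2) yV]])
      fix k assume k: "k \<in> I"
      have j: "inv' \<pi> k \<in> I" "\<pi> (inv' \<pi> k) = k" using inv_perm_I[OF \<pi> k] permutes_inverses[OF \<pi>] by auto
      show "f x k = gen_map \<pi> (\<lambda>_. False) g h (inversion J x) k"
        unfolding f gen_map_apply[OF x k] gen_map_apply[OF yV k] inversion_apply[OF x j(1)]
        using j by (simp add: J_def)
    qed
    thus "f x = (gen_map \<pi> (\<lambda>_. False) g h \<otimes>\<^bsub>P\<^esub> inversion J) x"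
      using apply_P[OF B(2) inversion_Bij x] by simp
  qed
  moreover have "inversion J \<in> inversion ` Pow I" by (auto simp: J_def)
  ultimately show "f \<in> affine s False <#>\<^bsub>P\<^esub> (inversion ` Pow I)"
    using affineI[OF p0] unfolding set_mult_def by blast
qed

text \<open>Agreement with an inversion of coordinate \<open>k\<close> would mean
  \<open>inv' y = g k \<circ> y \<circ> h k\<close> for all even \<open>y\<close>. At
  \<open>y = id\<close> this makes the right side a conjugation, so inversion would be a
  homomorphism, which commutativity alone permits.\<close>

lemma affine_Int_inversions: "affine s False \<inter> inversion ` Pow I = {\<one>\<^bsub>P\<^esub>}"
proof (intro equalityI subsetI)
  fix f assume f: "f \<in> affine s False \<inter> inversion ` Pow I"
  then obtain \<pi> e g h where p: "params s False \<pi> e g h" and fg: "f = gen_map \<pi> e g h" by (auto simp: affine_def)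
  obtain J where J: "J \<subseteq> I" "f = inversion J" using f by blast
  note q = params_elim[OF p]
  have "J = {}"
  proof (rule ccontr)
    assume "J \<noteq> {}"
    then obtain k where k: "k \<in> J" "k \<in> I" using J by blast
    \<comment> \<open>On vertices with all coordinates equal it does not matter which coordinate
      \<open>\<pi>\<close> brings to \<open>k\<close>.\<close>
    define c where "c y = (\<lambda>k\<in>I. y)" for y :: "'a \<Rightarrow> 'a"
    have cV: "c y \<in> V" if "y \<in> even_perms \<Omega>" for y using that by (intro V_I) (auto simp: c_def)
    have ek: "\<not> e k" using p k by (simp add: params_def)
    have eq: "inv' y = g k \<circ> y \<circ> h k" if y: "y \<in> even_perms \<Omega>" for y
    proof -
      have "f (c y) k = inv' y" using inversion_apply[OF cV[OF y] k(2)] k J by (simp add: c_def)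
      moreover have "f (c y) k = g k \<circ> y \<circ> h k"
        using gen_map_apply[OF cV[OF y] k(2)] inv_perm_I[OF q(1) k(2)] ek fg by (simp add: c_def)
      ultimately show ?thesis by simp
    qed
    have gh: "g k \<circ> h k = id" using eq[OF even_perms_id] by (simp add: inv_id)
    have hg: "h k \<circ> g k = id"
      using gh q(2)[OF k(2)] by (metis comp_assoc id_comp comp_id permutes_inv_o(2))
    obtain a b where ab: "a \<in> even_perms \<Omega>" "b \<in> even_perms \<Omega>" "a \<circ> b \<noteq> b \<circ> a" by (rule noncommuting)
    have "inv' a \<circ> inv' b = g k \<circ> a \<circ> (h k \<circ> g k) \<circ> b \<circ> h k" using eq[OF ab(1)] eq[OF ab(2)] by (simp add: comp_assoc)
    also have "\<dots> = inv' (a \<circ> b)" using eq[OF even_perms_comp[OF ab(1,2)]] hg by (simp add: comp_assoc)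
    also have "\<dots> = inv' b \<circ> inv' a" using ab permutes_bij by (intro o_inv_distrib) (auto simp: even_perms_def)
    finally have "inv' (inv' a \<circ> inv' b) = inv' (inv' b \<circ> inv' a)" by simp
    moreover have "inv' (inv' u \<circ> inv' v) = v \<circ> u" if "u \<in> even_perms \<Omega>" "v \<in> even_perms \<Omega>" for u v
    proof -
      have "u permutes \<Omega>" "v permutes \<Omega>" using that by (auto simp: even_perms_def)
      moreover from this have "inv' (inv' u \<circ> inv' v) = inv' (inv' v) \<circ> inv' (inv' u)"
        by (intro o_inv_distrib permutes_bij[OF permutes_inv])
      ultimately show ?thesis by (simp add: permutes_inv_inv)
    qed
    ultimately show False using ab by simp
  qed
  thus "f \<in> {\<one>\<^bsub>P\<^esub>}" using J inversion_empty by simp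
next
  fix f assume "f \<in> {\<one>\<^bsub>P\<^esub>}"
  moreover have "\<one>\<^bsub>P\<^esub> \<in> inversion ` Pow I" unfolding inversion_empty[symmetric] by blast
  ultimately show "f \<in> affine s False \<inter> inversion ` Pow I" using one_affine by blast
qed

lemma factorization_affine:
  "internal_factorization P (affine s False) (inversion ` Pow I) (affine s True)"
  unfolding internal_factorization_def
proof (intro conjI subgroup_affine affine_Int_inversions affine_mult_inversions)
  interpret P: group P by (rule group_BijGroup)
  show "subgroup (affine s False) (P\<lparr>carrier := affine s True\<rparr>)"
    by (rule P.subgroup_incl[OF subgroup_affine subgroup_affine affine_mono])
  show "subgroup (inversion ` Pow I) (P\<lparr>carrier := affine s True\<rparr>)"
    by (rule P.subgroup_incl[OF subgroup_inversions subgroup_affine]) (use inversion_affine in auto)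
qed

text \<open>Normality holds because no coordinates move: the flag \<open>e k\<close> of
  \<open>f\<close> occurs on both sides of \<open>f m = m' f\<close> and cancels. If
  \<open>m\<close> moved coordinates, flags of \<open>f\<close> at different coordinates would be
  combined, and an inversion could survive in the conjugate.\<close>

lemma semidirect_affine:
  "internal_semidirect P (affine False False) (inversion ` Pow I) (affine False True)"
  unfolding internal_semidirect_def
proof (intro conjI subgroup_affine affine_Int_inversions affine_mult_inversions)
  interpret P: group P by (rule group_BijGroup)
  show "subgroup (inversion ` Pow I) (P\<lparr>carrier := affine False True\<rparr>)"
    by (rule P.subgroup_incl[OF subgroup_inversions subgroup_affine]) (use inversion_affine in auto)
  show "affine False False \<lhd> P\<lparr>carrier := affine False True\<rparr>"
  proof (rule P.normal_in_subgroupI[OF subgroup_affine subgroup_affine affine_mono])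
    fix f m assume f: "f \<in> affine False True" and m: "m \<in> affine False False"
    obtain \<pi> e g h where p: "params False True \<pi> e g h" and fg: "f = gen_map \<pi> e g h" using f by (auto simp: affine_def)
    obtain \<pi>' e' g' h' where p': "params False False \<pi>' e' g' h'" and mg: "m = gen_map \<pi>' e' g' h'"
      using m by (auto simp: affine_def)
    note q = params_elim[OF p] and q' = params_elim[OF p']
    have id: "\<pi> = id" "\<pi>' = id" using p p' by (auto simp: params_def)
    have e': "\<not> e' k" if "k \<in> I" for k using p' that by (simp add: params_def)
    \<comment> \<open>Conjugation of the multipliers of \<open>m\<close>; in an inverted coordinate
      left and right multiplier exchange roles and are inverted.\<close>
    define g2 where "g2 k = g k \<circ> (if e k then inv' (h' k) else g' k) \<circ> inv' (g k)" for k
    define h2 where "h2 k = inv' (h k) \<circ> (if e k then inv' (g' k) else h' k) \<circ> h k" for k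
    define m' where "m' = gen_map id (\<lambda>_. False) g2 h2"
    have p2: "params False False id (\<lambda>_. False) g2 h2"
    proof -
      have "g2 k permutes \<Omega> \<and> h2 k permutes \<Omega> \<and> (evenperm (g2 k) \<longleftrightarrow> evenperm (h2 k))" if k: "k \<in> I" for k
      proof -
        note a = q(2-3)[OF k] q'(2-4)[OF k]
        have perm: "permutation (g k)" "permutation (h k)" "permutation (g' k)" "permutation (h' k)"
          using a perm_permutation by blast+
        show ?thesis
          using a perm by (auto simp: g2_def h2_def evenperm_comp evenperm_inv permutation_inverse permutation_compose
              intro!: permutes_compose permutes_inv)
      qed
      thus ?thesis by (simp add: params_def permutes_id)
    qed
    have m': "m' \<in> affine False False" unfolding m'_def by (rule affineI[OF p2])
    have B: "f \<in> Bij V" "m \<in> Bij V" "m' \<in> Bij V" using f m m' affine_Bij by blast+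
    have "f \<otimes>\<^bsub>P\<^esub> m = m' \<otimes>\<^bsub>P\<^esub> f"
    proof (rule Bij_V_ext)
      show "f \<otimes>\<^bsub>P\<^esub> m \<in> Bij V" "m' \<otimes>\<^bsub>P\<^esub> f \<in> Bij V" using B by (simp_all add: mult_P compose_Bij)
      fix x assume x: "x \<in> V"
      have mx: "m x \<in> V" "f x \<in> V" using B x Bij_V_V by blast+
      have "f (m x) = m' (f x)"
      proof (rule V_ext)
        show "f (m x) \<in> V" "m' (f x) \<in> V" using B mx Bij_V_V by blast+
        fix k assume k: "k \<in> I"
        have xk: "x k permutes \<Omega>" using V_component[OF x k] by (simp add: even_perms_def)
        have mk: "m x k = g' k \<circ> x k \<circ> h' k"
          using gen_map_apply[OF x k, of \<pi>' e' g' h'] e'[OF k] by (simp add: mg id inv_id)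
        have fk: "f x k = g k \<circ> (if e k then inv' (x k) else x k) \<circ> h k"
          using gen_map_apply[OF x k, of \<pi> e g h] by (simp add: fg id inv_id)
        have L: "f (m x) k = g k \<circ> (if e k then inv' (g' k \<circ> x k \<circ> h' k) else g' k \<circ> x k \<circ> h' k) \<circ> h k"
          using gen_map_apply[OF mx(1) k, of \<pi> e g h] mk by (simp add: fg id inv_id)
        have R: "m' (f x) k = g2 k \<circ> (g k \<circ> (if e k then inv' (x k) else x k) \<circ> h k) \<circ> h2 k"
          using gen_map_apply[OF mx(2) k, of id "\<lambda>_. False" g2 h2] fk by (simp add: m'_def inv_id)
        have i3: "inv' (g' k \<circ> x k \<circ> h' k) = inv' (h' k) \<circ> inv' (x k) \<circ> inv' (g' k)"
          by (rule inv_comp3[OF q'(2)[OF k] xk q'(3)[OF k]])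
        have "inv' (g k) (g k y) = y" "h k (inv' (h k) y) = y" for y
          using q(2,3)[OF k] by (simp_all add: permutes_inverses)
        thus "f (m x) k = m' (f x) k" unfolding L R g2_def h2_def i3 by (auto simp: fun_eq_iff)
      qed
      thus "(f \<otimes>\<^bsub>P\<^esub> m) x = (m' \<otimes>\<^bsub>P\<^esub> f) x" using apply_P[OF B(1,2) x] apply_P[OF B(3,1) x] by simp
    qed
    thus "\<exists>m'\<in>affine False False. f \<otimes>\<^bsub>P\<^esub> m = m' \<otimes>\<^bsub>P\<^esub> f" using m' by blast
  qed
qed

section \<open>Automorphisms of the derangement graph\<close>

definition adj :: "('i \<Rightarrow> 'a \<Rightarrow> 'a) \<Rightarrow> ('i \<Rightarrow> 'a \<Rightarrow> 'a) \<Rightarrow> bool" where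
  "adj x y \<longleftrightarrow> (\<forall>k\<in>I. \<forall>i\<in>\<Omega>. x k i \<noteq> y k i)"

definition adj_auts where
  "adj_auts = {f \<in> Bij V. \<forall>x\<in>V. \<forall>y\<in>V. adj (f x) (f y) \<longleftrightarrow> adj x y}"

lemma affine_subset_adj_auts: "affine s v \<subseteq> adj_auts"
proof
  fix f assume f: "f \<in> affine s v"
  then obtain \<pi> e g h where p: "params s v \<pi> e g h" and fg: "f = gen_map \<pi> e g h" by (auto simp: affine_def)
  note q = params_elim[OF p]
  have "adj (f x) (f y) \<longleftrightarrow> adj x y" if x: "x \<in> V" and y: "y \<in> V" for x y
  proof -
    have c: "(\<forall>i\<in>\<Omega>. f x k i \<noteq> f y k i) \<longleftrightarrow> (\<forall>i\<in>\<Omega>. x (inv' \<pi> k) i \<noteq> y (inv' \<pi> k) i)" if k: "k \<in> I" for k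
    proof -
      have j: "inv' \<pi> k \<in> I" by (rule inv_perm_I[OF q(1) k])
      have perm: "x (inv' \<pi> k) permutes \<Omega>" "y (inv' \<pi> k) permutes \<Omega>"
        using V_component[OF x j] V_component[OF y j] by (auto simp: even_perms_def)
      show ?thesis
        unfolding fg gen_map_apply[OF x k] gen_map_apply[OF y k] ball_disagree_conj_iff[OF q(2,3)[OF k]]
        using ball_disagree_inv_iff[OF perm] by simp
    qed
    have "adj (f x) (f y) \<longleftrightarrow> (\<forall>k\<in>I. \<forall>i\<in>\<Omega>. x (inv' \<pi> k) i \<noteq> y (inv' \<pi> k) i)"
      unfolding adj_def using c by simp
    also have "\<dots> \<longleftrightarrow> (\<forall>j\<in>inv' \<pi> ` I. \<forall>i\<in>\<Omega>. x j i \<noteq> y j i)" by blast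
    also have "inv' \<pi> ` I = I" by (rule permutes_image[OF permutes_inv[OF q(1)]])
    finally show ?thesis by (simp add: adj_def)
  qed
  thus "f \<in> adj_auts" using subsetD[OF affine_Bij f] by (simp add: adj_auts_def)
qed

lemma adj_auts_mult: "f \<in> adj_auts \<Longrightarrow> f' \<in> adj_auts \<Longrightarrow> f \<otimes>\<^bsub>P\<^esub> f' \<in> adj_auts"
  using Bij_V_V by (auto simp: adj_auts_def apply_P mult_P compose_Bij compose_eq)

text \<open>A right translation reduces to the case that \<open>unit\<close> is fixed. The local
  form at \<open>unit\<close> is then also that of an affine map, and rigidity makes the two equal.
  The assumption stands for the recovery of closeness from adjacency.\<close>

lemma adj_auts_eq_affine:
  assumes T: "\<And>f. f \<in> adj_auts \<Longrightarrow> T_aut f"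
  shows "adj_auts = affine True True"
proof (intro equalityI subsetI)
  fix f assume f: "f \<in> adj_auts"
  define u where "u = f unit"
  have fB: "f \<in> Bij V" using f by (simp add: adj_auts_def)
  have u: "u \<in> V" using Bij_V_V[OF fB unit_V] by (simp add: u_def)
  define r where "r = (\<lambda>x\<in>V. pmul x u)"
  define r' where "r' = (\<lambda>x\<in>V. pmul x (pinv u))"
  have r: "r \<in> right_maps" "r' \<in> right_maps" using u pinv_V by (auto simp: right_maps_def r_def r'_def)
  have ra: "r \<in> affine True True" "r' \<in> affine True True" using subsetD[OF right_maps_affine r(1)] subsetD[OF right_maps_affine r(2)] by auto
  hence rB: "r \<in> Bij V" "r' \<in> Bij V" using affine_Bij by blast+
  define f1 where "f1 = r' \<otimes>\<^bsub>P\<^esub> f"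
  have f1: "f1 \<in> adj_auts" unfolding f1_def
    using adj_auts_mult[OF subsetD[OF affine_subset_adj_auts ra(2)] f] .
  have f1B: "f1 \<in> Bij V" using f1 by (simp add: adj_auts_def)
  have one: "f1 unit = unit"
    unfolding f1_def using apply_P[OF rB(2) fB unit_V] u by (simp add: r'_def u_def[symmetric] pmul_pinv)
  obtain \<pi> g e where \<pi>: "\<pi> permutes I" and g: "\<And>k. k \<in> I \<Longrightarrow> g k permutes \<Omega>"
    and form: "\<And>k c. \<lbrakk>k \<in> I; c \<in> tricycles \<Omega>\<rbrakk> \<Longrightarrow>
      f1 (single k c) = single (\<pi> k) (g k \<circ> (if e k then inv' c else c) \<circ> inv' (g k))"
    using T_aut_local[OF T[OF f1] one] by blast
  \<comment> \<open>The local form indexes its data by source coordinates, \<open>gen_map\<close> by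
    target coordinates; hence the argument \<open>inv' \<pi> k\<close>.\<close>
  define M where "M = gen_map \<pi> (\<lambda>k. e (inv' \<pi> k)) (\<lambda>k. g (inv' \<pi> k)) (\<lambda>k. inv' (g (inv' \<pi> k)))"
  have p: "params True True \<pi> (\<lambda>k. e (inv' \<pi> k)) (\<lambda>k. g (inv' \<pi> k)) (\<lambda>k. inv' (g (inv' \<pi> k)))"
    using \<pi> g inv_perm_I[OF \<pi>] by (auto simp: params_def permutes_inv evenperm_inv perm_permutation)
  have Ma: "M \<in> affine True True" unfolding M_def by (rule affineI[OF p])
  have MB: "M \<in> Bij V" using Ma affine_Bij by blast
  have gg: "g (inv' \<pi> k) \<circ> inv' (g (inv' \<pi> k)) = id" if "k \<in> I" for k
    using permutes_inv_o(1)[OF g[OF inv_perm_I[OF \<pi> that]]] .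
  have "M unit = unit"
  proof (rule V_ext[OF Bij_V_V[OF MB unit_V] unit_V])
    fix k assume k: "k \<in> I"
    have "M unit k = id" unfolding M_def gen_map_unit[OF k \<pi>] by (rule gg[OF k])
    thus "M unit k = unit k" using k by (simp add: unit_def)
  qed
  moreover have "M (single k c) = f1 (single k c)" if k: "k \<in> I" and c: "c \<in> tricycles \<Omega>" for k c
  proof -
    have sV: "single k c \<in> V" using k c tricycles_even by (intro single_V) auto
    show ?thesis
    proof (rule V_ext[OF Bij_V_V[OF MB sV] Bij_V_V[OF f1B sV]])
      fix l assume l: "l \<in> I"
      have il: "inv' \<pi> l = k \<longleftrightarrow> l = \<pi> k" using permutes_inverses[OF \<pi>] by metis
      have lI: "inv' \<pi> l \<in> I" by (rule inv_perm_I[OF \<pi> l])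
      have Ml: "M (single k c) l = g (inv' \<pi> l) \<circ>
          (if e (inv' \<pi> l) then inv' (single k c (inv' \<pi> l)) else single k c (inv' \<pi> l)) \<circ> inv' (g (inv' \<pi> l))"
        unfolding M_def by (rule gen_map_apply[OF sV l])
      show "M (single k c) l = f1 (single k c) l"
      proof (cases "l = \<pi> k")
        case True
        hence "inv' \<pi> l = k" using il by simp
        thus ?thesis unfolding Ml form[OF k c] using True by (simp add: single_def)
      next
        case False
        hence ne: "inv' \<pi> l \<noteq> k" using il by simp
        hence "single k c (inv' \<pi> l) = id" using lI by (simp add: single_def unit_def)
        hence "M (single k c) l = id" unfolding Ml using gg[OF l] by (simp add: inv_id)
        thus ?thesis unfolding form[OF k c] using False l by (simp add: single_def unit_def)
      qed
    qed
  qed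
  ultimately have "M x = f1 x" if "x \<in> V" for x
    using T_aut_eqI[OF T[OF subsetD[OF affine_subset_adj_auts Ma]] T[OF f1]] one that by simp
  hence "f1 = M" using Bij_V_ext[OF f1B MB] by simp
  have "f = r \<otimes>\<^bsub>P\<^esub> f1"
  proof (rule Bij_V_ext[OF fB])
    show "r \<otimes>\<^bsub>P\<^esub> f1 \<in> Bij V" using rB f1B by (simp add: mult_P compose_Bij)
    fix x assume x: "x \<in> V"
    have fx: "f x \<in> V" by (rule Bij_V_V[OF fB x])
    have "f1 x = pmul (f x) (pinv u)" unfolding f1_def using apply_P[OF rB(2) fB x] fx by (simp add: r'_def)
    thus "f x = (r \<otimes>\<^bsub>P\<^esub> f1) x"
      using apply_P[OF rB(1) f1B x] fx u by (simp add: r_def pmul_cancel pmul_V pinv_V)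
  qed
  thus "f \<in> affine True True" using affine_mult[OF ra(1) Ma] \<open>f1 = M\<close> by simp
qed (use affine_subset_adj_auts in blast)

end

subsection \<open>Inner automorphisms and the wreath product\<close>


lemma internal_direct_product_cong:
  assumes "\<And>i. i \<in> I \<Longrightarrow> H i = H' i" and "internal_direct_product G I H K"
  shows "internal_direct_product G I H' K"
proof -
  have "(\<Union>j\<in>I - {i}. H' j) = (\<Union>j\<in>I - {i}. H j)" "(\<Union>j\<in>I. H' j) = (\<Union>j\<in>I. H j)" for i
    using assms(1) by (auto intro!: SUP_cong)
  thus ?thesis using assms unfolding internal_direct_product_def by simp
qed

lemma centralizer_tricycles_trivial:
  assumes n: "card \<Omega> \<ge> 5" and g: "g permutes \<Omega>"
    and c: "\<And>c. c \<in> tricycles \<Omega> \<Longrightarrow> g \<circ> c \<circ> inv' g = c"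
  shows "g = id"
proof -
  obtain a where a: "a \<in> \<Omega>" by (rule exists_fresh4[OF n])
  obtain b where b: "b \<in> \<Omega>" "b \<noteq> a" by (rule exists_fresh4[OF n])
  \<comment> \<open>The instance of \<open>conj_fixes_arc_line\<close> without inversion.\<close>
  have "if False then g a = b \<and> g b = a else g = id"
  proof (rule conj_fixes_arc_line[OF n g a b(1)])
    fix y assume "y \<in> \<Omega>" "y \<noteq> a" "y \<noteq> b"
    hence "cyc3 a b y \<in> tricycles \<Omega>" using a b by (intro cyc3_in_tricycles) auto
    thus "g \<circ> (if False then inv' (cyc3 a b y) else cyc3 a b y) \<circ> inv' g = cyc3 a b y" using c by simp
  qed (use b in blast)
  thus ?thesis by simp
qed

text \<open>Conjugation by the symmetric group is faithful already on three-cycles, hence on even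
  permutations. This yields \<open>inn_group_iso_sym_group\<close> as well as the faithfulness of
  the wreath product on tuples of even permutations.\<close>

lemma conj_on_tricycles_inj:
  assumes n: "card \<Omega> \<ge> 5" and g: "g permutes \<Omega>" and h: "h permutes \<Omega>"
    and c: "\<And>c. c \<in> tricycles \<Omega> \<Longrightarrow> g \<circ> c \<circ> inv' g = h \<circ> c \<circ> inv' h"
  shows "g = h"
proof -
  have ih: "inv' h permutes \<Omega>" by (rule permutes_inv[OF h])
  have "inv' (inv' h \<circ> g) = inv' g \<circ> inv' (inv' h)"
    by (rule o_inv_distrib) (use g ih permutes_bij in auto)
  hence i: "inv' (inv' h \<circ> g) = inv' g \<circ> h" using permutes_inv_inv[OF h] by simp
  have "inv' h \<circ> g = id"
  proof (rule centralizer_tricycles_trivial[OF n permutes_compose[OF g ih]])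
    fix c assume "c \<in> tricycles \<Omega>"
    hence e: "g (c (inv' g x)) = h (c (inv' h x))" for x using c by (metis comp_apply)
    show "inv' h \<circ> g \<circ> c \<circ> inv' (inv' h \<circ> g) = c"
      unfolding i using e permutes_inverses[OF h] by (simp add: fun_eq_iff)
  qed
  hence "h \<circ> (inv' h \<circ> g) = h" by simp
  thus ?thesis using permutes_inv_o(1)[OF h] by (metis comp_assoc id_comp)
qed

section \<open>Conjugations and the inner automorphism group\<close>

definition conj_map :: "nat \<Rightarrow> (nat \<Rightarrow> nat) \<Rightarrow> (nat \<Rightarrow> nat) \<Rightarrow> nat \<Rightarrow> nat" where
  "conj_map n a = (\<lambda>x\<in>carrier (sym_group n). a \<circ> x \<circ> inv' a)"

lemma carrier_inn_group: "carrier (inn_group (sym_group n)) = conj_map n ` carrier (sym_group n)"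
proof -
  let ?F = "\<lambda>g. \<lambda>x\<in>carrier (sym_group n). g \<otimes>\<^bsub>sym_group n\<^esub> x \<otimes>\<^bsub>sym_group n\<^esub> inv\<^bsub>sym_group n\<^esub> g"
  have "carrier (inn_group (sym_group n)) = ?F ` carrier (sym_group n)"
    unfolding inn_group_def by (simp add: Setcompr_eq_image)
  also have "\<dots> = conj_map n ` carrier (sym_group n)"
    by (intro image_cong refl) (simp add: conj_map_def sym_group_mult)
  finally show ?thesis .
qed

lemma conj_map_apply: "x permutes {1..n} \<Longrightarrow> conj_map n a x = a \<circ> x \<circ> inv' a"
  by (simp add: conj_map_def sym_group_carrier)

lemma conj_map_Bij:
  assumes a: "a permutes {1..n}" shows "conj_map n a \<in> Bij (carrier (sym_group n))"
proof -
  let ?S = "carrier (sym_group n)"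
  have closed: "b \<circ> x \<circ> inv' b \<in> ?S" if "b permutes {1..n}" "x \<in> ?S" for b x
    using that by (auto simp: sym_group_carrier intro!: permutes_compose permutes_inv)
  have ia: "inv' a permutes {1..n}" "inv' (inv' a) = a" using permutes_inv[OF a] permutes_inv_inv[OF a] by auto
  have "bij_betw (\<lambda>x. a \<circ> x \<circ> inv' a) ?S ?S"
  proof (rule bij_betw_byWitness[where f' = "\<lambda>x. inv' a \<circ> x \<circ> inv' (inv' a)"])
    show "\<forall>x\<in>?S. inv' a \<circ> (a \<circ> x \<circ> inv' a) \<circ> inv' (inv' a) = x"
      using permutes_inverses[OF a] by (simp add: ia fun_eq_iff)
    show "\<forall>x\<in>?S. a \<circ> (inv' a \<circ> x \<circ> inv' (inv' a)) \<circ> inv' a = x"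
      using permutes_inverses[OF a] by (simp add: ia fun_eq_iff)
  qed (use closed[OF a] closed[OF ia(1)] in blast)+
  thus ?thesis unfolding Bij_def conj_map_def by (simp cong: bij_betw_cong)
qed

lemma conj_map_mult:
  assumes a: "a permutes {1..n}" and b: "b permutes {1..n}"
  shows "conj_map n a \<otimes>\<^bsub>inn_group (sym_group n)\<^esub> conj_map n b = conj_map n (a \<circ> b)"
proof -
  let ?S = "carrier (sym_group n)"
  have "conj_map n a \<otimes>\<^bsub>inn_group (sym_group n)\<^esub> conj_map n b = compose ?S (conj_map n a) (conj_map n b)"
    using conj_map_Bij[OF a] conj_map_Bij[OF b] by (simp add: inn_group_def AutoGroup_def BijGroup_def)
  also have "\<dots> = conj_map n (a \<circ> b)"
  proof
    fix x
    have i: "inv' (a \<circ> b) = inv' b \<circ> inv' a" using a b by (intro o_inv_distrib permutes_bij)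
    show "compose ?S (conj_map n a) (conj_map n b) x = conj_map n (a \<circ> b) x"
    proof (cases "x \<in> ?S")
      case True
      hence x: "x permutes {1..n}" by (simp add: sym_group_carrier)
      have "b \<circ> x \<circ> inv' b permutes {1..n}" using b x by (intro permutes_compose permutes_inv)
      thus ?thesis using True x by (simp only: compose_eq conj_map_apply i comp_assoc)
    qed (simp add: compose_def conj_map_def)
  qed
  finally show ?thesis .
qed

lemma conj_map_inj:
  assumes n: "n \<ge> 5" and a: "a permutes {1..n}" and b: "b permutes {1..n}"
    and eq: "\<And>c. c \<in> tricycles {1..n} \<Longrightarrow> conj_map n a c = conj_map n b c"
  shows "a = b"
proof (rule conj_on_tricycles_inj[OF _ a b])
  fix c assume c: "c \<in> tricycles {1..n}"
  hence "c permutes {1..n}" by (simp add: tricycles_def)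
  thus "a \<circ> c \<circ> inv' a = b \<circ> c \<circ> inv' b" using eq[OF c] conj_map_apply by metis
qed (use n in simp)

lemma inn_group_iso_sym_group:
  assumes n: "n \<ge> 5" shows "inn_group (sym_group n) \<cong> sym_group n"
proof -
  have "conj_map n \<in> iso (sym_group n) (inn_group (sym_group n))"
    unfolding iso_def mem_Collect_eq bij_betw_def carrier_inn_group
  proof (intro conjI homI inj_onI refl)
    fix a b assume ab: "a \<in> carrier (sym_group n)" "b \<in> carrier (sym_group n)"
    hence p: "a permutes {1..n}" "b permutes {1..n}" by (auto simp: sym_group_carrier)
    show "conj_map n a \<in> carrier (inn_group (sym_group n))" using ab carrier_inn_group by blast
    show "conj_map n (a \<otimes>\<^bsub>sym_group n\<^esub> b) = conj_map n a \<otimes>\<^bsub>inn_group (sym_group n)\<^esub> conj_map n b"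
      using conj_map_mult[OF p] by (simp add: sym_group_mult)
    assume "conj_map n a = conj_map n b"
    thus "a = b" using conj_map_inj[OF n p] by simp
  qed
  hence "sym_group n \<cong> inn_group (sym_group n)" by (auto simp: is_iso_def)
  thus ?thesis by (rule group.iso_sym[OF sym_group_is_group])
qed

section \<open>Transfer to the even derangement graph\<close>

context
  fixes n q :: nat
  assumes n: "n \<ge> 5"
  notes One_nat_def [simp del] \<comment> \<open>otherwise the index sets \<open>{1..n}\<close> in the constants of the interpretation get rewritten\<close>
begin

interpretation G: tri_graph "{1..q}" "{1..n}"
  by unfold_locales (use n in auto)

lemma V_eq: "G.V = carrier (alt_power n q)"
proof -
  have "even_perms {1..n} = carrier (alt_group n)"
    unfolding even_perms_def using alt_group_carrier by blast
  thus ?thesis unfolding G.V_def carrier_alt_power by simp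
qed

lemma mult_eq: "x \<otimes>\<^bsub>alt_power n q\<^esub> y = G.pmul x y"
  by (simp add: alt_power_def G.pmul_def alt_group_mult)

lemma right_regular_eq: "right_regular (alt_power n q) = G.right_maps"
  unfolding right_regular_def G.right_maps_def V_eq mult_eq by blast

lemma coord_inv_eq:
  assumes k: "k \<in> {1..q}" shows "coord_inv n q k = G.inversion {k}"
proof
  fix x show "coord_inv n q k x = G.inversion {k} x"
  proof (cases "x \<in> G.V")
    case True
    have xk: "x k \<in> carrier (alt_group n)" using True k V_eq alt_power_component by blast
    have "coord_inv n q k x j = G.inversion {k} x j" for j
    proof (cases "j \<in> {1..q}")
      case j: True
      show ?thesis
        using True G.inversion_apply[OF True j, of "{k}"] alt_group_inv_equality[OF xk]
        unfolding coord_inv_def V_eq[symmetric] by simp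
    next
      case False
      hence "j \<noteq> k" using k by auto
      thus ?thesis
        using True False G.V_outside[OF True False] G.V_outside[OF G.Bij_V_V[OF G.inversion_Bij True] False]
        unfolding coord_inv_def V_eq[symmetric] by simp
    qed
    thus ?thesis by blast
  next
    case False
    thus ?thesis unfolding coord_inv_def V_eq[symmetric] G.inversion_def G.gen_map_def by simp
  qed
qed

lemma coord_inv_group_eq: "coord_inv_group n q = G.inversion ` Pow {1..q}"
proof -
  have "coord_inv n q ` {1..q} = (\<lambda>k. G.inversion {k}) ` {1..q}"
    using coord_inv_eq by (intro image_cong) auto
  thus ?thesis
    unfolding coord_inv_group_def V_eq[symmetric] using G.generate_inversions[of "{1..q}"] by simp
qed

lemma even_derangement_aut_eq_adj_auts: "even_derangement_aut n q = G.adj_auts"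
proof -
  have "{x, y} \<in> even_derangement_edges n q \<longleftrightarrow> G.adj x y" if "x \<in> G.V" "y \<in> G.V" for x y
    using mem_even_derangement_edges_iff that unfolding V_eq G.adj_def by blast
  thus ?thesis
    unfolding even_derangement_aut_def graph_aut_def G.adj_auts_def V_eq[symmetric]
    by (intro Collect_cong conj_cong refl ball_cong) (simp add: G.Bij_V_V)
qed

lemma even_derangement_aut_eq:
  assumes q: "q \<ge> 1" shows "even_derangement_aut n q = G.affine True True"
  unfolding even_derangement_aut_eq_adj_auts
proof (rule G.adj_auts_eq_affine)
  fix f assume f: "f \<in> G.adj_auts"
  have adj: "adjacent n q x y \<longleftrightarrow> G.adj x y" for x y by (simp only: adjacent_def G.adj_def)
  have T: "tri_adjacent n q x y \<longleftrightarrow> G.T x y" for x y by (simp only: tri_adjacent_def G.T_def)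
  have bij: "bij_betw f G.V G.V" using f by (simp add: G.adj_auts_def Bij_def)
  have "G.adj (f x) (f y) = G.adj x y" if "x \<in> G.V" "y \<in> G.V" for x y using f that by (simp add: G.adj_auts_def)
  hence "G.T (f x) (f y) \<longleftrightarrow> G.T x y" if "x \<in> G.V" "y \<in> G.V" for x y
    using graph_aut_tri_adjacent_iff[OF q n, of f x y] bij that unfolding V_eq[symmetric] adj T by blast
  thus "G.T_aut f" using bij unfolding G.T_aut_def by blast
qed

lemma wreath_action_conj_map:
  assumes \<pi>: "\<pi> permutes {1..q}"
    and f: "\<And>k. k \<in> {1..q} \<Longrightarrow> f k = conj_map n (g k)"
  shows "wreath_action n q (f, \<pi>) = G.gen_map \<pi> (\<lambda>_. False) g (\<lambda>k. inv' (g k))"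
proof -
  have i: "inv\<^bsub>sym_group q\<^esub> \<pi> = inv' \<pi>" using \<pi> by (simp add: sym_group_carrier)
  have "f k (x (inv' \<pi> k)) = g k \<circ> x (inv' \<pi> k) \<circ> inv' (g k)" if x: "x \<in> G.V" and k: "k \<in> {1..q}" for x k
  proof -
    have "x (inv' \<pi> k) permutes {1..n}"
      using G.V_component[OF x G.inv_perm_I[OF \<pi> k]] by (simp add: even_perms_def)
    thus ?thesis using f[OF k] conj_map_apply by metis
  qed
  thus ?thesis
    unfolding wreath_action_def G.gen_map_def V_eq[symmetric] split_conv i if_False
    by (intro restrict_ext) auto
qed

lemma inn_obtain:
  assumes "f \<in> (\<Pi>\<^sub>E k\<in>{1..q}. carrier (inn_group (sym_group n)))"
  obtains g where "\<And>k. k \<in> {1..q} \<Longrightarrow> g k permutes {1..n}" "\<And>k. k \<in> {1..q} \<Longrightarrow> f k = conj_map n (g k)"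
proof -
  have "\<exists>a. a permutes {1..n} \<and> f k = conj_map n a" if k: "k \<in> {1..q}" for k
  proof -
    have "f k \<in> conj_map n ` carrier (sym_group n)" using PiE_mem[OF assms k] unfolding carrier_inn_group .
    thus ?thesis using sym_group_carrier by blast
  qed
  then obtain g where "\<And>k. k \<in> {1..q} \<Longrightarrow> g k permutes {1..n} \<and> f k = conj_map n (g k)" by metis
  thus thesis using that by blast
qed

text \<open>The set \<open>S\<close> of admissible coordinate permutations is kept variable, so that
  the wreath product and its base group are both covered.\<close>

lemma wreath_action_image:
  assumes S: "\<And>\<pi>. \<pi> \<in> S \<longleftrightarrow> \<pi> permutes {1..q} \<and> (s \<or> \<pi> = id)"
  shows "wreath_action n q ` ((\<Pi>\<^sub>E k\<in>{1..q}. carrier (inn_group (sym_group n))) \<times> S) = G.stab_maps s"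
proof (intro equalityI subsetI)
  fix w assume "w \<in> wreath_action n q ` ((\<Pi>\<^sub>E k\<in>{1..q}. carrier (inn_group (sym_group n))) \<times> S)"
  then obtain f \<pi> where f: "f \<in> (\<Pi>\<^sub>E k\<in>{1..q}. carrier (inn_group (sym_group n)))" and \<pi>: "\<pi> \<in> S"
    and w: "w = wreath_action n q (f, \<pi>)" by blast
  obtain g where g: "\<And>k. k \<in> {1..q} \<Longrightarrow> g k permutes {1..n}" "\<And>k. k \<in> {1..q} \<Longrightarrow> f k = conj_map n (g k)"
    using inn_obtain[OF f] by blast
  have \<pi>': "\<pi> permutes {1..q}" "s \<or> \<pi> = id" using \<pi> S by auto
  have "w = G.gen_map \<pi> (\<lambda>_. False) g (\<lambda>k. inv' (g k))"
    unfolding w by (rule wreath_action_conj_map[OF \<pi>'(1) g(2)])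
  thus "w \<in> G.stab_maps s" unfolding G.stab_maps_iff using \<pi>' g(1) by blast
next
  fix w assume "w \<in> G.stab_maps s"
  then obtain \<pi> g where \<pi>: "\<pi> permutes {1..q}" "s \<or> \<pi> = id" and g: "\<forall>k\<in>{1..q}. g k permutes {1..n}"
    and w: "w = G.gen_map \<pi> (\<lambda>_. False) g (\<lambda>k. inv' (g k))" unfolding G.stab_maps_iff by blast
  define f where "f = (\<lambda>k\<in>{1..q}. conj_map n (g k))"
  have fk: "f k = conj_map n (g k)" if "k \<in> {1..q}" for k using that by (simp add: f_def)
  have "conj_map n (g k) \<in> carrier (inn_group (sym_group n))" if "k \<in> {1..q}" for k
    unfolding carrier_inn_group using g that sym_group_carrier by blast
  hence f: "f \<in> (\<Pi>\<^sub>E k\<in>{1..q}. carrier (inn_group (sym_group n)))" unfolding f_def by simp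
  have "w = wreath_action n q (f, \<pi>)" unfolding w by (rule wreath_action_conj_map[OF \<pi>(1) fk, symmetric])
  moreover have "\<pi> \<in> S" using \<pi> S by blast
  ultimately show "w \<in> wreath_action n q ` ((\<Pi>\<^sub>E k\<in>{1..q}. carrier (inn_group (sym_group n))) \<times> S)"
    using f by blast
qed

lemma inn_wreath_eq: "inn_wreath n q = G.stab_maps True"
proof -
  have "carrier (wreath_sym (inn_group (sym_group n)) q) =
      (\<Pi>\<^sub>E k\<in>{1..q}. carrier (inn_group (sym_group n))) \<times> carrier (sym_group q)"
    by (simp add: wreath_sym_def)
  thus ?thesis
    unfolding inn_wreath_def using wreath_action_image[of "carrier (sym_group q)" True] sym_group_carrier by simp
qed

lemma inn_base_eq: "inn_base n q = G.stab_maps False"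
  unfolding inn_base_def by (rule wreath_action_image) (auto simp: sym_group_one permutes_id)

text \<open>For injectivity, vertices with a single nontrivial coordinate first reveal the
  coordinate permutation and then, on three-cycles, the conjugating elements.\<close>

lemma wreath_action_iso:
  "wreath_action n q \<in> iso (wreath_sym (inn_group (sym_group n)) q) (G.P\<lparr>carrier := inn_wreath n q\<rparr>)"
proof -
  let ?W = "wreath_sym (inn_group (sym_group n)) q"
  have carW: "carrier ?W = (\<Pi>\<^sub>E k\<in>{1..q}. carrier (inn_group (sym_group n))) \<times> carrier (sym_group q)"
    by (simp add: wreath_sym_def)
  show ?thesis
    unfolding iso_def mem_Collect_eq bij_betw_def
  proof (intro conjI homI inj_onI)
    fix a b assume a: "a \<in> carrier ?W" and b: "b \<in> carrier ?W"
    obtain f \<pi> where af: "a = (f, \<pi>)" "f \<in> (\<Pi>\<^sub>E k\<in>{1..q}. carrier (inn_group (sym_group n)))" "\<pi> permutes {1..q}"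
      using a unfolding carW using sym_group_carrier by blast
    obtain f' \<pi>' where bf: "b = (f', \<pi>')" "f' \<in> (\<Pi>\<^sub>E k\<in>{1..q}. carrier (inn_group (sym_group n)))" "\<pi>' permutes {1..q}"
      using b unfolding carW using sym_group_carrier by blast
    obtain g where g: "\<And>k. k \<in> {1..q} \<Longrightarrow> g k permutes {1..n}" "\<And>k. k \<in> {1..q} \<Longrightarrow> f k = conj_map n (g k)"
      using inn_obtain[OF af(2)] by blast
    obtain g' where g': "\<And>k. k \<in> {1..q} \<Longrightarrow> g' k permutes {1..n}" "\<And>k. k \<in> {1..q} \<Longrightarrow> f' k = conj_map n (g' k)"
      using inn_obtain[OF bf(2)] by blast
    have wa: "wreath_action n q a = G.gen_map \<pi> (\<lambda>_. False) g (\<lambda>k. inv' (g k))"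
      unfolding af(1) by (rule wreath_action_conj_map[OF af(3) g(2)])
    have wb: "wreath_action n q b = G.gen_map \<pi>' (\<lambda>_. False) g' (\<lambda>k. inv' (g' k))"
      unfolding bf(1) by (rule wreath_action_conj_map[OF bf(3) g'(2)])
    have pa: "G.params True False \<pi> (\<lambda>_. False) g (\<lambda>k. inv' (g k))"
      using af(3) g(1) by (simp add: G.params_def permutes_inv evenperm_inv G.perm_permutation)
    have pb: "G.params True False \<pi>' (\<lambda>_. False) g' (\<lambda>k. inv' (g' k))"
      using bf(3) g'(1) by (simp add: G.params_def permutes_inv evenperm_inv G.perm_permutation)
    have inI: "inv' \<pi> k \<in> {1..q}" if "k \<in> {1..q}" for k by (rule G.inv_perm_I[OF af(3) that])
    show "wreath_action n q a \<in> carrier (G.P\<lparr>carrier := inn_wreath n q\<rparr>)"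
      using a by (simp add: inn_wreath_def)
    define g2 where "g2 k = g k \<circ> g' (inv' \<pi> k)" for k
    define f2 where "f2 = (\<lambda>k\<in>{1..q}. f k \<otimes>\<^bsub>inn_group (sym_group n)\<^esub> f' (inv' \<pi> k))"
    have ab: "a \<otimes>\<^bsub>?W\<^esub> b = (f2, \<pi> \<circ> \<pi>')"
      using af bf by (simp add: wreath_sym_def f2_def sym_group_mult sym_group_carrier)
    have f2: "f2 k = conj_map n (g2 k)" if k: "k \<in> {1..q}" for k
      unfolding g2_def using k g(2)[OF k] g'(2)[OF inI[OF k]] conj_map_mult[OF g(1)[OF k] g'(1)[OF inI[OF k]]]
      by (simp add: f2_def)
    have "wreath_action n q (a \<otimes>\<^bsub>?W\<^esub> b) = G.gen_map (\<pi> \<circ> \<pi>') (\<lambda>_. False) g2 (\<lambda>k. inv' (g2 k))"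
      unfolding ab by (rule wreath_action_conj_map[OF permutes_compose[OF bf(3) af(3)] f2])
    also have "\<dots> = G.gen_map (\<pi> \<circ> \<pi>') (\<lambda>_. False) g2 (\<lambda>k. inv' (g' (inv' \<pi> k)) \<circ> inv' (g k))"
    proof -
      have "inv' (g2 k) = inv' (g' (inv' \<pi> k)) \<circ> inv' (g k)" if k: "k \<in> {1..q}" for k
        unfolding g2_def using g(1)[OF k] g'(1)[OF inI[OF k]] by (intro o_inv_distrib permutes_bij)
      thus ?thesis unfolding G.gen_map_def by (intro restrict_ext) simp
    qed
    also have "\<dots> = compose G.V (wreath_action n q a) (wreath_action n q b)"
      using G.gen_map_compose(1)[OF pa pb] unfolding wa wb g2_def by simp
    also have "\<dots> = wreath_action n q a \<otimes>\<^bsub>G.P\<^esub> wreath_action n q b"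
      unfolding wa wb by (rule G.mult_P[OF G.gen_map_Bij[OF pa] G.gen_map_Bij[OF pb], symmetric])
    finally show "wreath_action n q (a \<otimes>\<^bsub>?W\<^esub> b) =
        wreath_action n q a \<otimes>\<^bsub>G.P\<lparr>carrier := inn_wreath n q\<rparr>\<^esub> wreath_action n q b" by simp
    assume eq: "wreath_action n q a = wreath_action n q b"
    have val: "g k \<circ> x (inv' \<pi> k) \<circ> inv' (g k) = g' k \<circ> x (inv' \<pi>' k) \<circ> inv' (g' k)"
      if x: "x \<in> G.V" and k: "k \<in> {1..q}" for x k
      using fun_cong[OF fun_cong[OF eq, of x], of k] unfolding wa wb G.gen_map_apply[OF x k] by simp
    have single: "G.single j c \<in> G.V" if "j \<in> {1..q}" "c \<in> tricycles {1..n}" for j c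
      using G.single_V[OF that(1)] G.tricycles_even that(2) by blast
    \<comment> \<open>A three-cycle placed in coordinate \<open>inv' \<pi> k\<close> would be seen
      at \<open>k\<close> by the first map, while the second would see the identity there.\<close>
    have inv_eq: "inv' \<pi> k = inv' \<pi>' k" if k: "k \<in> {1..q}" for k
    proof (rule ccontr)
      assume ne: "inv' \<pi> k \<noteq> inv' \<pi>' k"
      obtain c where c: "c \<in> tricycles {1..n}"
        using cyc3_in_tricycles[of 1 2 3 "{1..n}"] n by auto
      have j: "inv' \<pi>' k \<in> {1..q}" by (rule G.inv_perm_I[OF bf(3) k])
      have s: "G.single (inv' \<pi> k) c (inv' \<pi> k) = c" "G.single (inv' \<pi> k) c (inv' \<pi>' k) = id"
        using ne j by (auto simp: G.single_def G.unit_def)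
      have "g k \<circ> c \<circ> inv' (g k) = g' k \<circ> id \<circ> inv' (g' k)"
        using val[OF single[OF inI[OF k] c] k] unfolding s .
      also have "\<dots> = id" using permutes_inv_o(1)[OF g'(1)[OF k]] by simp
      finally have "g k \<circ> c \<circ> inv' (g k) = g k \<circ> id \<circ> inv' (g k)"
        using permutes_inv_o(1)[OF g(1)[OF k]] by simp
      hence "c = id"
        by (rule G.comp3_cancel[OF permutes_bij[OF g(1)[OF k]] permutes_bij[OF permutes_inv[OF g(1)[OF k]]]])
      thus False using G.tricycle_neq_id[OF c] by simp
    qed
    have "inv' \<pi> = inv' \<pi>'"
    proof
      fix k show "inv' \<pi> k = inv' \<pi>' k"
        using inv_eq permutes_not_in[OF permutes_inv[OF af(3)]] permutes_not_in[OF permutes_inv[OF bf(3)]] by metis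
    qed
    hence pi: "\<pi> = \<pi>'" using permutes_inv_inv[OF af(3)] permutes_inv_inv[OF bf(3)] by metis
    have "f = f'"
    proof (rule PiE_ext[OF af(2) bf(2)])
      fix k assume k: "k \<in> {1..q}"
      have "g k = g' k"
      proof (rule conj_on_tricycles_inj[OF G.card_5 g(1)[OF k] g'(1)[OF k]])
        fix c assume c: "c \<in> tricycles {1..n}"
        have "G.single (inv' \<pi> k) c (inv' \<pi> k) = c" by (simp add: G.single_def)
        thus "g k \<circ> c \<circ> inv' (g k) = g' k \<circ> c \<circ> inv' (g' k)"
          using val[OF single[OF inI[OF k] c] k] pi by simp
      qed
      thus "f k = f' k" using g(2)[OF k] g'(2)[OF k] by simp
    qed
    thus "a = b" using af bf pi by simp
  next
    show "wreath_action n q ` carrier ?W = carrier (G.P\<lparr>carrier := inn_wreath n q\<rparr>)"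
      by (simp add: inn_wreath_def)
  qed
qed

lemma internal_products:
  assumes q: "q \<ge> 1"
  defines "R \<equiv> right_regular (alt_power n q)" and "W \<equiv> inn_wreath n q" and "B \<equiv> inn_base n q"
    and "Z \<equiv> coord_inv_group n q" and "Q \<equiv> BijGroup (carrier (alt_power n q))"
  shows "internal_semidirect Q R W (R <#>\<^bsub>Q\<^esub> W)"
    and "internal_factorization Q (R <#>\<^bsub>Q\<^esub> W) Z (even_derangement_aut n q)"
    and "q = 1 \<Longrightarrow> internal_semidirect Q (R <#>\<^bsub>Q\<^esub> W) Z (even_derangement_aut n q)"
    and "internal_semidirect Q (R <#>\<^bsub>Q\<^esub> B) Z ((R <#>\<^bsub>Q\<^esub> B) <#>\<^bsub>Q\<^esub> Z)"
    and "internal_direct_product Q {1..q} (\<lambda>k. generate Q {coord_inv n q k}) Z"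
    and "\<And>k. k \<in> {1..q} \<Longrightarrow> card (generate Q {coord_inv n q k}) = 2"
proof -
  have Q: "Q = G.P" unfolding Q_def V_eq ..
  have RW: "R <#>\<^bsub>Q\<^esub> W = G.affine True False"
    unfolding R_def W_def Q right_regular_eq inn_wreath_eq by (rule G.right_maps_mult_stab_maps)
  have RB: "R <#>\<^bsub>Q\<^esub> B = G.affine False False"
    unfolding R_def B_def Q right_regular_eq inn_base_eq by (rule G.right_maps_mult_stab_maps)
  have Z: "Z = G.inversion ` Pow {1..q}" unfolding Z_def by (rule coord_inv_group_eq)
  show "internal_semidirect Q R W (R <#>\<^bsub>Q\<^esub> W)"
    unfolding RW unfolding R_def W_def Q right_regular_eq inn_wreath_eq by (rule G.semidirect_right_stab)
  show "internal_factorization Q (R <#>\<^bsub>Q\<^esub> W) Z (even_derangement_aut n q)"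
    unfolding RW unfolding Z even_derangement_aut_eq[OF q] Q by (rule G.factorization_affine)
  show "internal_semidirect Q (R <#>\<^bsub>Q\<^esub> B) Z ((R <#>\<^bsub>Q\<^esub> B) <#>\<^bsub>Q\<^esub> Z)"
    unfolding RB unfolding Z Q G.affine_mult_inversions by (rule G.semidirect_affine)
  show "internal_semidirect Q (R <#>\<^bsub>Q\<^esub> W) Z (even_derangement_aut n q)" if "q = 1"
  proof -
    \<comment> \<open>With one coordinate there is nothing to permute, so normality comes from the
      case without coordinate permutations.\<close>
    have "\<pi> = id" if "\<pi> permutes {1..q}" for \<pi>
      using that permutes_sing[of \<pi> 1] \<open>q = 1\<close> by simp
    hence "G.affine True v = G.affine False v" for v
      unfolding G.affine_def G.params_def by blast
    thus ?thesis
      unfolding RW unfolding Z even_derangement_aut_eq[OF q] Q using G.semidirect_affine by simp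
  qed
  have gen: "generate Q {coord_inv n q k} = generate G.P {G.inversion {k}}" if "k \<in> {1..q}" for k
    unfolding Q coord_inv_eq[OF that] ..
  show "internal_direct_product Q {1..q} (\<lambda>k. generate Q {coord_inv n q k}) Z"
  proof -
    have D: "internal_direct_product Q {1..q} (\<lambda>k. generate G.P {G.inversion {k}}) Z"
      unfolding Z Q by (rule G.direct_product_inversions)
    show ?thesis by (rule internal_direct_product_cong[OF _ D]) (rule gen[symmetric])
  qed
  show "card (generate Q {coord_inv n q k}) = 2" if k: "k \<in> {1..q}" for k
  proof -
    have "\<one>\<^bsub>G.P\<^esub> \<noteq> G.inversion {k}"
      using G.inversion_inj[of "{}" "{k}", OF _ k] G.inversion_empty by auto
    thus ?thesis unfolding gen[OF k] G.generate_inversion[OF k] by simp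
  qed
qed

end

text \<open>The outer product appears as a factorisation with trivial intersection, because for
  \<open>q \<ge> 2\<close> its left factor is not normal (\<open>outer_factor_not_normal\<close>).
  Normality is asserted where it holds: for \<open>q = 1\<close>, and for every \<open>q\<close>
  once the wreath product is cut down to its base group.\<close>

theorem theorem1p3:
  fixes n q :: nat
  assumes "q \<ge> 1" and "n \<ge> 5"
  defines "P \<equiv> BijGroup (carrier (alt_power n q))"
    and "R \<equiv> right_regular (alt_power n q)"
    and "W \<equiv> inn_wreath n q"
    and "Z \<equiv> coord_inv_group n q"
  shows "internal_semidirect P R W (R <#>\<^bsub>P\<^esub> W)
    \<and> internal_factorization P (R <#>\<^bsub>P\<^esub> W) Z (even_derangement_aut n q)
    \<and> (q = 1 \<longrightarrow> internal_semidirect P (R <#>\<^bsub>P\<^esub> W) Z (even_derangement_aut n q))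
    \<and> internal_semidirect P (R <#>\<^bsub>P\<^esub> inn_base n q) Z ((R <#>\<^bsub>P\<^esub> inn_base n q) <#>\<^bsub>P\<^esub> Z)
    \<and> inn_group (sym_group n) \<cong> sym_group n
    \<and> wreath_action n q \<in> iso (wreath_sym (inn_group (sym_group n)) q) (P\<lparr>carrier := W\<rparr>)
    \<and> internal_direct_product P {1..q} (\<lambda>k. generate P {coord_inv n q k}) Z
    \<and> (\<forall>k\<in>{1..q}. card (generate P {coord_inv n q k}) = 2)"
  unfolding P_def R_def W_def Z_def
  using internal_products[OF assms(2,1)] inn_group_iso_sym_group[OF assms(2)]
    wreath_action_iso[OF assms(2), of q, unfolded V_eq[OF assms(2)]]
  by blast

end
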